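(* Let $k,n \geq 1$ be integers. (1) Every strongly $k$-connected $n$-vertex digraph $D$ contains a strongly $k$-connected spanning subgraph with at most $kn + 800 k \overline{\Delta}(D) + 800 k^2$ edges. (2) Every strongly $k$-arc-connected $n$-vertex directed multigraph $D$ contains a strongly $k$-arc-connected spanning subgraph with at most $kn + 670 k \overline{\Delta}(D) + 670 k^2$ edges.
   Context: A digraph is a pair $(V,E)$ with $V$ finite and $E \subseteq (V\times V)\setminus\{(v,v): v\in V\}$ (so no loops and no parallel edges, but both $(u,v)$ and $(v,u)$ may be present). A directed multigraph is the same except that $E$ is a multiset. For a directed multigraph $D$, $\overline{\Delta}(D)$ denotes $\max_{v \in V(D)} |\{w \in V(D)\setminus\{v\} : (v,w)\notin E(D) \text{ and } (w,v) \notin E(D)\}|$, i.e. the maximum degree of the complement of the underlying simple undirected graph of $D$. A digraph $D$ is strongly $k$-connected if $|V(D)| \geq k+1$ and for every $S\subseteq V(D)$ with $|S|\leq k-1$, $D-S$ is strongly connected. A directed multigraph $D$ is strongly $k$-arc-connected if for every set $T$ of at most $k-1$ edges, $D-T$ is strongly connected. *)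

theory Defs
  imports "Graph_Theory.Digraph_Component"
begin

text \<open>
  A digraph is a \<^locale>\<open>digraph\<close>, and a directed multigraph is a \<^locale>\<open>fin_digraph\<close> that
  is also a \<^locale>\<open>loopfree_digraph\<close>. The multiset of edges is represented by arc
  identifiers: parallel edges are distinct elements of \<^term>\<open>arcs G\<close>, so edges are counted and
  deleted with multiplicity.
\<close>

definition complement_max_degree :: "('a, 'b) pre_digraph \<Rightarrow> nat" where
  "complement_max_degree G =
     Max ((\<lambda>v. card {w \<in> verts G - {v}. (v, w) \<notin> arcs_ends G \<and> (w, v) \<notin> arcs_ends G}) ` verts G)"

definition delete_verts :: "('a, 'b) pre_digraph \<Rightarrow> 'a set \<Rightarrow> ('a, 'b) pre_digraph" where
  "delete_verts G S = G \<restriction> (verts G - S)"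

definition delete_arcs :: "('a, 'b) pre_digraph \<Rightarrow> 'b set \<Rightarrow> ('a, 'b) pre_digraph" where
  "delete_arcs G T = G\<lparr>arcs := arcs G - T\<rparr>"

text \<open>
  Both definitions are meant for finite graphs and \<open>k \<ge> 1\<close>, where \<open>card S < k\<close> says
  that \<open>S\<close> has at most \<open>k - 1\<close> elements.
\<close>

definition strongly_k_connected :: "nat \<Rightarrow> ('a, 'b) pre_digraph \<Rightarrow> bool" where
  "strongly_k_connected k G \<longleftrightarrow>
     card (verts G) \<ge> k + 1 \<and>
     (\<forall>S \<subseteq> verts G. card S < k \<longrightarrow> strongly_connected (delete_verts G S))"

definition strongly_k_arc_connected :: "nat \<Rightarrow> ('a, 'b) pre_digraph \<Rightarrow> bool" where
  "strongly_k_arc_connected k G \<longleftrightarrow>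
     (\<forall>T \<subseteq> arcs G. card T < k \<longrightarrow> strongly_connected (delete_arcs G T))"

end

theory Submission
  imports Defs
begin

text \<open>
  Connectivity is tested on \<^emph>\<open>rectangles\<close> \<open>(A, B)\<close> of disjoint vertex sets: the number of
  arcs from \<open>A\<close> to \<open>B\<close> plus the number of vertices outside \<open>A \<union> B\<close> has to be at least \<open>k\<close>. This
  function can be uncrossed, so that in an inclusion-minimal arc set above a given one only
  \<open>O(k)\<close> new arcs are needed per vertex of a set that contains a side of every violated rectangle. It
  remains to find a skeleton with \<open>kn + O(k (k + \<Delta>))\<close> arcs whose violated rectangles have \<open>A\<close> or
  \<open>B\<close> inside a set \<open>Q\<close> of \<open>O(k + \<Delta>)\<close> vertices.

  Among the \<open>O(k + \<Delta>)\<close> vertices of lowest out-degree there are \<open>k\<close> vertices \<open>Y\<close> that are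
  robustly reached from most of the others, and these in turn can be reached by \<open>k\<close> disjoint
  paths of length at most three from any vertex of not too low out-degree. Let \<open>X\<close> be the analogous
  set for in-degrees, and take a shortest system of \<open>k\<close> paths from \<open>Y\<close> to \<open>X\<close>. A vertex on \<open>t\<close> of
  them needs only \<open>f = k - t\<close> further out-arcs and in-arcs, which keeps the total at \<open>kn\<close> provided
  the same arcs serve as out-arcs and as in-arcs. To achieve this, order the vertices so that the
  forward arcs have maximal total weight \<open>f(u) f(v)\<close>: the median property of such an order gives
  a set of forward arcs with nearly all degrees equal to \<open>f\<close>. Following forward arcs or
  paths one always ends in one of the two hubs.
\<close>

section \<open>Rectangles and uncrossing\<close>

text \<open>Rectangles are the one-way pairs of Frank and Jordan. The long path system is treated in
  the same spirit: it is an arc set subject to a cut condition and is never decomposed into paths.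
  The obstacle is the leading coefficient. Minimality alone gives 4kn arcs
  (\<open>few_arcs_always\<close>), which is enough only while n is at most 223(k + D), with D the
  bound on the complement degree. For larger n, minimality may be spent on O(k + D) vertices only,
  and all other arcs are chosen explicitly. D enters because one direction per adjacent pair gives a
  tournament up to D exceptions per vertex: every vertex set has a member whose out-degree inside it
  is below half its size, and a set in which all inner out-degrees are small is itself small. The
  constants of hubs and fans are thresholds at which these averages become contradictory. The
  threshold 223 fits 3 * 223 = 669; above it the construction yields the smaller constants 174 and
  567.\<close>

text \<open>The vertex version allows arbitrary disjoint \<open>A\<close> and \<open>B\<close> (flag \<open>vm\<close>), the arc version only
  complementary ones.\<close>

definition rect :: "bool \<Rightarrow> 'a set \<Rightarrow> 'a set \<Rightarrow> 'a set \<Rightarrow> bool" where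
  "rect vm V A B \<longleftrightarrow> A \<subseteq> V \<and> B \<subseteq> V \<and> A \<inter> B = {} \<and> (vm \<or> A \<union> B = V)"

definition cut_size :: "'a set \<Rightarrow> ('b \<Rightarrow> 'a) \<Rightarrow> ('b \<Rightarrow> 'a) \<Rightarrow> 'b set \<Rightarrow> 'a set \<Rightarrow> 'a set \<Rightarrow> nat" where
  "cut_size V s t F A B = card {e \<in> F. s e \<in> A \<and> t e \<in> B} + card (V - (A \<union> B))"

lemma rect_sym: "rect vm V A B \<longleftrightarrow> rect vm V B A"
  unfolding rect_def by auto

lemma cut_size_rev: "cut_size V t s F B A = cut_size V s t F A B"
  unfolding cut_size_def by (simp add: conj_commute Un_commute)

section \<open>Uncrossing identities\<close>

lemma card_filter_sum:
  assumes "finite F" shows "card {e \<in> F. P e} = (\<Sum>e\<in>F. of_bool (P e))"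
  using assms by (simp add: Collect_conj_eq)

lemma card_arcs_uncross:
  assumes "finite F"
  shows "card {e \<in> F. s e \<in> A \<inter> C \<and> t e \<in> B \<union> D} + card {e \<in> F. s e \<in> A \<union> C \<and> t e \<in> B \<inter> D}
     + card {e \<in> F. s e \<in> A - C \<and> t e \<in> D - B} + card {e \<in> F. s e \<in> C - A \<and> t e \<in> B - D}
     + card {e \<in> F. s e \<in> A - C \<and> t e \<in> B - D} + card {e \<in> F. s e \<in> C - A \<and> t e \<in> D - B}
   = card {e \<in> F. s e \<in> A \<and> t e \<in> B} + card {e \<in> F. s e \<in> C \<and> t e \<in> D}
     + card {e \<in> F. s e \<in> A - C \<and> t e \<in> D - B} + card {e \<in> F. s e \<in> C - A \<and> t e \<in> B - D}"
  unfolding card_filter_sum[OF assms] sum.distrib[symmetric]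
  by (rule sum.cong) auto

text \<open>An equation and not just submodularity: if the right side is 2k and both new values are
  at least \<open>k\<close>, then the two slack terms vanish. \<open>tight_uncross\<close> uses this
  to exclude arcs from \<open>C - A\<close> to \<open>D - B\<close>.\<close>

lemma cut_size_uncross:
  assumes "finite F" "finite V" "rect vm V A B" "rect vm V C D"
  shows "cut_size V s t F (A \<inter> C) (B \<union> D) + cut_size V s t F (A \<union> C) (B \<inter> D)
     + card {e \<in> F. s e \<in> A - C \<and> t e \<in> B - D} + card {e \<in> F. s e \<in> C - A \<and> t e \<in> D - B}
   = cut_size V s t F A B + cut_size V s t F C D"
proof -
  have "card (V - ((A \<inter> C) \<union> (B \<union> D))) + card (V - ((A \<union> C) \<union> (B \<inter> D)))
      = card (V - (A \<union> B)) + card (V - (C \<union> D))"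
  proof -
    have *: "V - X = {v \<in> V. v \<notin> X}" for X by auto
    show ?thesis
      unfolding * card_filter_sum[OF assms(2)] sum.distrib[symmetric]
      using assms(3,4) by (intro sum.cong) (auto simp: rect_def)
  qed
  with card_arcs_uncross[OF assms(1), of s A C t B D] show ?thesis
    unfolding cut_size_def by linarith
qed

lemma rect_uncross:
  assumes "rect vm V A B" "rect vm V C D"
  shows "rect vm V (A \<inter> C) (B \<union> D)" "rect vm V (A \<union> C) (B \<inter> D)"
  using assms unfolding rect_def by blast+

lemma cut_size_mono:
  assumes "F \<subseteq> F'" "finite F'"
  shows "cut_size V s t F A B \<le> cut_size V s t F' A B"
  unfolding cut_size_def using assms by (intro add_mono card_mono order_refl) auto

lemma cut_size_remove:
  assumes "finite F"
  shows "cut_size V s t F A B \<le> cut_size V s t (F - {e}) A B + 1"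
    and "\<not> (s e \<in> A \<and> t e \<in> B \<and> e \<in> F) \<Longrightarrow> cut_size V s t (F - {e}) A B = cut_size V s t F A B"
proof -
  have "{x \<in> F. s x \<in> A \<and> t x \<in> B} \<subseteq> insert e {x \<in> F - {e}. s x \<in> A \<and> t x \<in> B}" by auto
  hence "card {x \<in> F. s x \<in> A \<and> t x \<in> B} \<le> card (insert e {x \<in> F - {e}. s x \<in> A \<and> t x \<in> B})"
    by (intro card_mono) (use assms in auto)
  also have "\<dots> \<le> card {x \<in> F - {e}. s x \<in> A \<and> t x \<in> B} + 1"
    by (simp add: assms)
  finally show "cut_size V s t F A B \<le> cut_size V s t (F - {e}) A B + 1"
    unfolding cut_size_def by linarith
  assume "\<not> (s e \<in> A \<and> t e \<in> B \<and> e \<in> F)"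
  hence "{x \<in> F - {e}. s x \<in> A \<and> t x \<in> B} = {x \<in> F. s x \<in> A \<and> t x \<in> B}" by auto
  thus "cut_size V s t (F - {e}) A B = cut_size V s t F A B" unfolding cut_size_def by simp
qed

lemma rect_card:
  assumes "finite V" "rect vm V A B"
  shows "card A + card B + card (V - (A \<union> B)) = card V"
proof -
  have f: "finite A" "finite B" using assms finite_subset unfolding rect_def by auto
  have "card (A \<union> B) = card A + card B"
    using f assms(2) by (intro card_Un_disjoint) (auto simp: rect_def)
  moreover have "card (V - (A \<union> B)) = card V - card (A \<union> B)"
    using f assms by (intro card_Diff_subset) (auto simp: rect_def)
  moreover have "card (A \<union> B) \<le> card V"
    using assms by (intro card_mono) (auto simp: rect_def)
  ultimately show ?thesis by linarith
qed

text \<open>Tail and head maps are separate parameters, so that reversing all arcs is another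
  interpretation of the same locale; the in-versions of results on out-arcs are obtained in this
  way.\<close>

locale arc_graph =
  fixes V :: "'a set" and E :: "'b set" and src tgt :: "'b \<Rightarrow> 'a" and vm :: bool
  assumes finV: "finite V" and finE: "finite E"
    and src_V: "e \<in> E \<Longrightarrow> src e \<in> V" and tgt_V: "e \<in> E \<Longrightarrow> tgt e \<in> V"
    and loopfree: "e \<in> E \<Longrightarrow> src e \<noteq> tgt e"
    and simple: "vm \<Longrightarrow> e \<in> E \<Longrightarrow> e' \<in> E \<Longrightarrow> src e = src e' \<Longrightarrow> tgt e = tgt e' \<Longrightarrow> e = e'"
begin

abbreviation "ct \<equiv> cut_size V src tgt"
abbreviation "rc \<equiv> rect vm V"

definition conn :: "nat \<Rightarrow> 'b set \<Rightarrow> bool" where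
  "conn k F \<longleftrightarrow> (\<forall>A B. rc A B \<longrightarrow> A \<noteq> {} \<longrightarrow> B \<noteq> {} \<longrightarrow> k \<le> ct F A B)"

lemma rev_graph: "arc_graph V E tgt src vm"
  by (rule arc_graph.intro, fact finV, fact finE, erule tgt_V, erule src_V,
      erule loopfree[THEN not_sym], erule simple)

lemma conn_rev: "arc_graph.conn V tgt src vm k F \<longleftrightarrow> conn k F"
  unfolding conn_def arc_graph.conn_def[OF rev_graph]
  using cut_size_rev rect_sym by metis

lemma sub_graph: "F \<subseteq> E \<Longrightarrow> arc_graph V F src tgt vm"
proof -
  assume F: "F \<subseteq> E"
  show ?thesis
    by (rule arc_graph.intro, fact finV, rule finite_subset[OF F finE])
      (use F src_V tgt_V loopfree simple in \<open>blast+\<close>)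
qed

text \<open>Tight rectangles through a fixed tail \<open>u\<close> with large head sides have their head sides
  inside two of them: overlapping ones can be uncrossed, and three disjoint head sides do not
  fit.\<close>

lemma tight_heads_at_tail:
  assumes "conn k E" "finite X"
    and X: "\<And>x. x \<in> X \<Longrightarrow> x \<in> E \<and> src x = u \<and> (\<exists>A B. rc A B \<and> src x \<in> A \<and> tgt x \<in> B \<and>
             ct E A B = k \<and> card V < 3 * card B)"
  shows "card X \<le> 2 * k"
proof -
  define T where "T A B \<longleftrightarrow> rc A B \<and> u \<in> A \<and> ct E A B = k \<and> card V < 3 * card B" for A B
  have fin: "finite A" "finite B" if "T A B" for A B
    using that finV finite_subset unfolding T_def rect_def by auto
  have bd: "card B \<le> card V" if "T A B" for A B
    using that finV unfolding T_def rect_def by (auto intro: card_mono)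
  \<comment> \<open>\<open>A \<inter> C\<close> contains \<open>u\<close> and
    \<open>B \<inter> D\<close> is nonempty, so both uncrossed rectangles have value at least
    \<open>k\<close>, and the sum 2k makes them tight. The one with the larger head side is
    kept.\<close>
  have un: "\<exists>A'. T A' (B \<union> D)" if "T A B" "T C D" "B \<inter> D \<noteq> {}" for A B C D
  proof
    have r: "rc (A \<inter> C) (B \<union> D)" "rc (A \<union> C) (B \<inter> D)"
      using that rect_uncross unfolding T_def by blast+
    have "ct E (A \<inter> C) (B \<union> D) + ct E (A \<union> C) (B \<inter> D) \<le> k + k"
      using cut_size_uncross[of E V vm A B C D src tgt] that finE finV unfolding T_def by linarith
    moreover have "A \<inter> C \<noteq> {}" using that unfolding T_def by auto
    then have "k \<le> ct E (A \<inter> C) (B \<union> D)" "k \<le> ct E (A \<union> C) (B \<inter> D)"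
      using assms(1) r that unfolding conn_def by blast+
    ultimately have eq: "ct E (A \<inter> C) (B \<union> D) = k" by linarith
    have "card B \<le> card (B \<union> D)"
      using fin that by (auto intro!: card_mono)
    then show "T (A \<inter> C) (B \<union> D)"
      using that r(1) eq unfolding T_def by auto
  qed
  have ex_max: "\<exists>A B. T A B \<and> P B \<and> (\<forall>A' B'. T A' B' \<longrightarrow> P B' \<longrightarrow> card B' \<le> card B)"
    if "T A0 B0" "P B0" for P A0 B0
  proof -
    let ?Q = "\<lambda>m. \<exists>A B. T A B \<and> P B \<and> card B = m"
    have "?Q (card B0)" using that by blast
    moreover have "\<And>m. ?Q m \<Longrightarrow> m \<le> card V" using bd by blast
    ultimately have q: "?Q (GREATEST m. ?Q m)" and gr: "\<And>m. ?Q m \<Longrightarrow> m \<le> (GREATEST m. ?Q m)"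
      using GreatestI_nat[of ?Q _ "card V"] Greatest_le_nat[of ?Q _ "card V"] by blast+
    from q obtain A B where "T A B" "P B" "card B = (GREATEST m. ?Q m)" by blast
    then show ?thesis using gr by metis
  qed
  have sub: "D \<subseteq> B" if "card (B \<union> D) \<le> card B" "finite B" "finite D" for B D :: "'a set"
    using that card_seteq[of "B \<union> D" B] by auto
  \<comment> \<open>At most \<open>k\<close> arcs cross a tight rectangle, so the two maximal head
    sides found below account for 2k arcs in all.\<close>
  have num: "card {x \<in> X. tgt x \<in> B} \<le> k" if "T A B" for A B
  proof -
    have "card {x \<in> X. tgt x \<in> B} \<le> card {e \<in> E. src e \<in> A \<and> tgt e \<in> B}"
      using finE that X unfolding T_def by (intro card_mono) auto
    also have "\<dots> \<le> k" using that unfolding T_def cut_size_def by linarith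
    finally show ?thesis .
  qed
  have hd: "\<exists>A B. T A B \<and> tgt x \<in> B" if "x \<in> X" for x
    using X[OF that] unfolding T_def by auto
  show ?thesis
  proof (cases "X = {}")
    case False
    then obtain A0 B0 where "T A0 B0" using hd by blast
    from ex_max[of A0 B0 "\<lambda>_. True", OF this] obtain A1 B1 where
      1: "T A1 B1" "\<And>A' B'. T A' B' \<Longrightarrow> card B' \<le> card B1" by blast
    have s1: "D \<subseteq> B1 \<or> D \<inter> B1 = {}" if "T C D" for C D
      using un[OF 1(1) that] 1(2) sub fin that 1(1) by (metis inf_commute)
    show ?thesis
    proof (cases "\<exists>C D. T C D \<and> D \<inter> B1 = {}")
      case False
      have "tgt x \<in> B1" if x: "x \<in> X" for x
      proof -
        obtain A B where AB: "T A B" "tgt x \<in> B" using hd[OF x] by blast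
        from s1[OF AB(1)] False AB show ?thesis by blast
      qed
      hence "{x \<in> X. tgt x \<in> B1} = X" by blast
      with num[OF 1(1)] have "card X \<le> k" by simp
      thus ?thesis by linarith
    next
      case True
      then obtain C0 D0 where "T C0 D0" "D0 \<inter> B1 = {}" by blast
      from ex_max[of C0 D0 "\<lambda>D. D \<inter> B1 = {}", OF this] obtain A2 B2 where
        2: "T A2 B2" "B2 \<inter> B1 = {}" "\<And>A' B'. T A' B' \<Longrightarrow> B' \<inter> B1 = {} \<Longrightarrow> card B' \<le> card B2"
        by blast
      have s2: "D \<subseteq> B1 \<or> D \<subseteq> B2" if "T C D" for C D
      proof (rule ccontr)
        assume a: "\<not> ?thesis"
        hence d1: "D \<inter> B1 = {}" using s1 that by blast
        show False
        proof (cases "B2 \<inter> D = {}")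
          case True
          have "card (B1 \<union> B2 \<union> D) = card B1 + card B2 + card D"
          proof -
            have "card (B1 \<union> B2) = card B1 + card B2"
              by (rule card_Un_disjoint[OF fin(2)[OF 1(1)] fin(2)[OF 2(1)]]) (use 2(2) in blast)
            moreover have "card (B1 \<union> B2 \<union> D) = card (B1 \<union> B2) + card D"
              by (rule card_Un_disjoint) (use True d1 fin(2)[OF 1(1)] fin(2)[OF 2(1)] fin(2)[OF that] in \<open>blast+\<close>)
            ultimately show ?thesis by simp
          qed
          moreover have "card (B1 \<union> B2 \<union> D) \<le> card V"
            using 1 2 that finV unfolding T_def rect_def by (intro card_mono) auto
          ultimately show False using 1(1) 2(1) that unfolding T_def by linarith
        next
          case False
          from un[OF 2(1) that this] obtain A' where "T A' (B2 \<union> D)" by blast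
          moreover have "(B2 \<union> D) \<inter> B1 = {}" using d1 2 by blast
          ultimately have "card (B2 \<union> D) \<le> card B2" using 2(3) by blast
          thus False using sub fin 2(1) that a by metis
        qed
      qed
      hence "tgt x \<in> B1 \<or> tgt x \<in> B2" if "x \<in> X" for x using hd[OF that] by blast
      hence "X = {x \<in> X. tgt x \<in> B1} \<union> {x \<in> X. tgt x \<in> B2}" by blast
      hence "card X = card ({x \<in> X. tgt x \<in> B1} \<union> {x \<in> X. tgt x \<in> B2})" by simp
      also have "\<dots> \<le> card {x \<in> X. tgt x \<in> B1} + card {x \<in> X. tgt x \<in> B2}" by (rule card_Un_le)
      finally show ?thesis using num[OF 1(1)] num[OF 2(1)] by linarith
    qed
  qed simp
qed

section \<open>Number of arcs in tight rectangles with a large side\<close>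

lemma card_le_by_fibre:
  assumes "finite U" "finite X" "g ` X \<subseteq> U" "\<And>u. u \<in> U \<Longrightarrow> card {x \<in> X. g x = u} \<le> m"
  shows "card X \<le> m * card U"
proof -
  have "X = (\<Union>u\<in>U. {x \<in> X. g x = u})" using assms(3) by auto
  hence "card X \<le> (\<Sum>u\<in>U. card {x \<in> X. g x = u})"
    using card_UN_le[OF assms(1), of "\<lambda>u. {x \<in> X. g x = u}"] by simp
  also have "\<dots> \<le> (\<Sum>u\<in>U. m)" using assms(4) by (intro sum_mono) auto
  finally show ?thesis by (simp add: mult.commute)
qed

lemma tight_arcs_tails:
  assumes "conn k E" "finite U"
    and X: "\<And>x. x \<in> X \<Longrightarrow> x \<in> E \<and> src x \<in> U \<and> (\<exists>A B. rc A B \<and> src x \<in> A \<and> tgt x \<in> B \<and>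
             ct E A B = k \<and> card V < 3 * card B)"
  shows "card X \<le> 2 * k * card U"
proof -
  have "finite X" using X finE by (meson finite_subset subsetI)
  then show ?thesis
    using X assms by (intro card_le_by_fibre[where g = src] tight_heads_at_tail) auto
qed

end

text \<open>Arcs with a large head side are grouped by their tail in \<open>U\<close>, at most 2k
  for each; the others have a large tail side and are grouped by their head, by reversal. Hence 4k
  per vertex of \<open>U\<close>.\<close>

lemma (in arc_graph) tight_arcs:
  assumes "conn k E" "finite U"
    and X: "\<And>x. x \<in> X \<Longrightarrow> x \<in> E \<and> (\<exists>A B. rc A B \<and> src x \<in> A \<and> tgt x \<in> B \<and> ct E A B = k \<and>
       (card V < 3 * card B \<and> src x \<in> U \<or> card V < 3 * card A \<and> tgt x \<in> U))"
  shows "card X \<le> 4 * k * card U"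
proof -
  interpret r: arc_graph V E tgt src vm by (rule rev_graph)
  define X1 where "X1 = {x \<in> X. src x \<in> U \<and> (\<exists>A B. rc A B \<and> src x \<in> A \<and> tgt x \<in> B \<and>
             ct E A B = k \<and> card V < 3 * card B)}"
  have "card X1 \<le> 2 * k * card U"
    using X by (intro tight_arcs_tails assms) (auto simp: X1_def)
  moreover have "card (X - X1) \<le> 2 * k * card U"
  proof (rule r.tight_arcs_tails)
    show "r.conn k E" using assms(1) conn_rev by simp
    fix x assume x: "x \<in> X - X1"
    then obtain A B where AB: "rc A B" "src x \<in> A" "tgt x \<in> B" "ct E A B = k"
       "card V < 3 * card B \<and> src x \<in> U \<or> card V < 3 * card A \<and> tgt x \<in> U"
      using X[of x] by blast
    hence "card V < 3 * card A" "tgt x \<in> U" using x unfolding X1_def by blast+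
    moreover have "x \<in> E" using x X by auto
    moreover have "rc B A" "cut_size V tgt src E B A = k" using AB rect_sym cut_size_rev by metis+
    ultimately show "x \<in> E \<and> tgt x \<in> U \<and> (\<exists>A B. rc A B \<and> tgt x \<in> A \<and> src x \<in> B \<and>
        cut_size V tgt src E A B = k \<and> card V < 3 * card B)" using AB by blast
  qed (use assms in auto)
  moreover have "card X \<le> card X1 + card (X - X1)"
  proof -
    have "X1 \<subseteq> X" "finite X" using X finE by (auto simp: X1_def intro: finite_subset)
    thus ?thesis using card_Diff_subset[of X1 X] card_mono[of X X1] finite_subset by fastforce
  qed
  ultimately show ?thesis by linarith
qed

text \<open>Removing \<open>x\<close> from a minimal \<open>H\<close> violates some rectangle. It is
  tight for \<open>H\<close> and, as \<open>K\<close> is contained in \<open>H - {x}\<close>,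
  violated by \<open>K\<close>. So knowing the rectangles violated by \<open>K\<close> restricts
  those that hold the additional arcs, which are then counted by \<open>tight_arcs\<close>.\<close>

lemma (in arc_graph) minimal_conn:
  assumes "conn k E" "K \<subseteq> E"
  obtains H where "K \<subseteq> H" "H \<subseteq> E" "conn k H"
    "\<And>x. x \<in> H - K \<Longrightarrow> \<exists>A B. rc A B \<and> src x \<in> A \<and> tgt x \<in> B \<and> ct H A B = k \<and> ct K A B < k"
proof -
  define \<H> where "\<H> = {H. K \<subseteq> H \<and> H \<subseteq> E \<and> conn k H}"
  have "finite \<H>" unfolding \<H>_def using finE by (auto intro: finite_subset[of _ "Pow E"])
  moreover have "E \<in> \<H>" using assms unfolding \<H>_def by auto
  ultimately obtain H where H: "H \<in> \<H>" and min: "\<And>H'. H' \<in> \<H> \<Longrightarrow> H' \<subseteq> H \<Longrightarrow> H' = H"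
    using finite_has_minimal[of \<H>] by blast
  have finH: "finite H" using H finE finite_subset unfolding \<H>_def by auto
  show ?thesis
  proof (rule that)
    fix x assume x: "x \<in> H - K"
    hence "H - {x} \<notin> \<H>" using min by blast
    hence "\<not> conn k (H - {x})" using x H unfolding \<H>_def by auto
    then obtain A B where AB: "rc A B" "A \<noteq> {}" "B \<noteq> {}" "ct (H - {x}) A B < k"
      unfolding conn_def by fastforce
    have k: "k \<le> ct H A B" using AB H unfolding \<H>_def conn_def by auto
    note ins = cut_size_remove(1)[OF finH, of V src tgt A B x]
      cut_size_remove(2)[OF finH, of src x A tgt B V]
    have in': "src x \<in> A" "tgt x \<in> B" using ins(2) k AB(4) by (metis not_le)+
    have "ct K A B \<le> ct (H - {x}) A B"
      using x H finH unfolding \<H>_def by (intro cut_size_mono) auto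
    thus "\<exists>A B. rc A B \<and> src x \<in> A \<and> tgt x \<in> B \<and> ct H A B = k \<and> ct K A B < k"
      using AB in' ins(1) k by (intro exI[of _ A] exI[of _ B]) auto
  qed (use H in \<open>auto simp: \<H>_def\<close>)
qed

section \<open>Minimal systems of paths\<close>

text \<open>The cut side of Menger's theorem: \<open>F\<close> contains \<open>k\<close> paths from
  \<open>Y\<close> to \<open>X\<close>, vertex-disjoint for \<open>vm\<close> and arc-disjoint
  otherwise. For \<open>vm\<close>, a vertex common to \<open>Y\<close> and \<open>X\<close> lies on
  neither side and counts as a path of length zero; without \<open>vm\<close> no rectangle is
  admissible once \<open>Y\<close> and \<open>X\<close> meet.\<close>

definition link_cover :: "'a set \<Rightarrow> ('b \<Rightarrow> 'a) \<Rightarrow> ('b \<Rightarrow> 'a) \<Rightarrow> bool \<Rightarrow> nat \<Rightarrow> 'a set \<Rightarrow> 'a set \<Rightarrow> 'b set \<Rightarrow> bool"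
  where "link_cover V s t vm k Y X F \<longleftrightarrow>
    (\<forall>A B. rect vm V A B \<longrightarrow> Y \<inter> B = {} \<longrightarrow> X \<inter> A = {} \<longrightarrow> k \<le> cut_size V s t F A B)"

lemma link_cover_rev: "link_cover V t s vm k X Y F \<longleftrightarrow> link_cover V s t vm k Y X F"
  unfolding link_cover_def using cut_size_rev rect_sym by metis

text \<open>Minimum cardinality, not only minimality under inclusion: \<open>induced\<close>
  replaces a path segment by an arc outside \<open>P\<close>.\<close>

locale linkage = arc_graph V E src tgt vm
  for V :: "'a set" and E :: "'b set" and src tgt :: "'b \<Rightarrow> 'a" and vm :: bool +
  fixes k :: nat and Y X :: "'a set" and P :: "'b set"
  assumes PE: "P \<subseteq> E" and cov: "link_cover V src tgt vm k Y X P"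
    and least: "P' \<subseteq> E \<Longrightarrow> link_cover V src tgt vm k Y X P' \<Longrightarrow> card P \<le> card P'"

lemma (in arc_graph) linkage_exists:
  assumes "conn k E" "Y \<subseteq> V" "X \<subseteq> V" "Y \<noteq> {}" "X \<noteq> {}" "k \<le> card Y" "k \<le> card X"
  obtains P where "linkage V E src tgt vm k Y X P"
proof -
  have E: "link_cover V src tgt vm k Y X E"
    unfolding link_cover_def
  proof (intro allI impI)
    fix A B assume r: "rc A B" and d: "Y \<inter> B = {}" "X \<inter> A = {}"
    show "k \<le> ct E A B"
    proof (cases "A = {} \<or> B = {}")
      case False
      thus ?thesis using assms(1) r unfolding conn_def by blast
    next
      case True
      hence "Y \<subseteq> V - (A \<union> B) \<or> X \<subseteq> V - (A \<union> B)" using d assms by blast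
      hence "card Y \<le> card (V - (A \<union> B)) \<or> card X \<le> card (V - (A \<union> B))"
        using finV card_mono by blast
      thus ?thesis using assms unfolding cut_size_def by linarith
    qed
  qed
  let ?Q = "\<lambda>P. P \<subseteq> E \<and> link_cover V src tgt vm k Y X P"
  obtain P where "?Q P" "\<And>P'. ?Q P' \<Longrightarrow> card P \<le> card P'"
    using ex_has_least_nat[of ?Q E card] E by blast
  hence "linkage V E src tgt vm k Y X P" by unfold_locales auto
  thus ?thesis by (rule that)
qed

context linkage
begin

lemma finP: "finite P" using PE finE finite_subset by auto

lemma rev_linkage: "linkage V E tgt src vm k X Y P"
proof -
  interpret r: arc_graph V E tgt src vm by (rule rev_graph)
  show ?thesis using PE cov least by unfold_locales (auto simp: link_cover_rev)
qed

definition tight :: "'a set \<Rightarrow> 'a set \<Rightarrow> bool" where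
  "tight A B \<longleftrightarrow> rc A B \<and> Y \<inter> B = {} \<and> X \<inter> A = {} \<and> ct P A B = k"

definition outd :: "'a \<Rightarrow> nat" where "outd v = card {e \<in> P. src e = v}"
definition ind :: "'a \<Rightarrow> nat" where "ind v = card {e \<in> P. tgt e = v}"

lemma outd_rev: "linkage.outd tgt P v = ind v" and ind_rev: "linkage.ind src P v = outd v"
  unfolding linkage.outd_def[OF rev_linkage] linkage.ind_def[OF rev_linkage] ind_def outd_def
  by simp_all

lemma tight_ex:
  assumes "e \<in> P" obtains A B where "tight A B" "src e \<in> A" "tgt e \<in> B"
proof -
  have "card (P - {e}) < card P" using assms finP by (meson card_Diff1_less)
  hence "\<not> link_cover V src tgt vm k Y X (P - {e})" using least[of "P - {e}"] PE by auto
  then obtain A B where AB: "rc A B" "Y \<inter> B = {}" "X \<inter> A = {}" "ct (P - {e}) A B < k"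
    unfolding link_cover_def by fastforce
  have k: "k \<le> ct P A B" using cov AB unfolding link_cover_def by auto
  note ins = cut_size_remove(1)[OF finP, of V src tgt A B e]
      cut_size_remove(2)[OF finP, of src e A tgt B V]
  have "src e \<in> A" "tgt e \<in> B" using ins(2) k AB(4) by (metis not_le)+
  moreover have "tight A B" using ins(1) k AB unfolding tight_def by auto
  ultimately show ?thesis using that by blast
qed

lemma tight_uncross:
  assumes "tight A B" "tight C D"
  shows "tight (A \<inter> C) (B \<union> D)"
    and "e \<in> P \<Longrightarrow> src e \<in> C - A \<Longrightarrow> tgt e \<in> D - B \<Longrightarrow> False"
proof -
  have r: "rc (A \<inter> C) (B \<union> D)" "rc (A \<union> C) (B \<inter> D)"
    using assms rect_uncross unfolding tight_def by blast+
  have y: "Y \<inter> (B \<union> D) = {}" "X \<inter> (A \<inter> C) = {}" "Y \<inter> (B \<inter> D) = {}" "X \<inter> (A \<union> C) = {}"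
    using assms unfolding tight_def by blast+
  have "ct P (A \<inter> C) (B \<union> D) + ct P (A \<union> C) (B \<inter> D)
     + card {e \<in> P. src e \<in> A - C \<and> tgt e \<in> B - D} + card {e \<in> P. src e \<in> C - A \<and> tgt e \<in> D - B} = k + k"
    using cut_size_uncross[OF finP finV, of vm A B C D src tgt] assms unfolding tight_def by simp
  moreover have "k \<le> ct P (A \<inter> C) (B \<union> D)" "k \<le> ct P (A \<union> C) (B \<inter> D)"
    using cov r y unfolding link_cover_def by blast+
  ultimately have eq: "ct P (A \<inter> C) (B \<union> D) = k" "card {e \<in> P. src e \<in> C - A \<and> tgt e \<in> D - B} = 0"
    by linarith+
  show "tight (A \<inter> C) (B \<union> D)" unfolding tight_def using eq r y by simp
  show "e \<in> P \<Longrightarrow> src e \<in> C - A \<Longrightarrow> tgt e \<in> D - B \<Longrightarrow> False" using eq(2) finP by auto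
qed

text \<open>The paths cross a tight rectangle in one direction: an arc of \<open>P\<close> starting
  outside \<open>A\<close> ends in \<open>B\<close>, so whatever has reached \<open>B\<close> stays
  there. An exception would be slack when uncrossing with a tight rectangle that holds the arc.
  \<open>acyclic_Pr\<close> rests on this.\<close>

lemma tight_arc_side:
  assumes "tight A B" "e \<in> P" shows "src e \<in> A \<or> tgt e \<in> B"
proof -
  obtain C D where "tight C D" "src e \<in> C" "tgt e \<in> D" using tight_ex[OF assms(2)] by blast
  thus ?thesis using tight_uncross(2)[OF assms(1) _ assms(2)] by blast
qed

text \<open>Head sides of tight rectangles through \<open>v\<close> can be united, so a largest one
  catches all arcs leaving \<open>v\<close>. In \<open>outd_le1\<close> and
  \<open>outd_le_ind\<close>, \<open>v\<close> is then moved out of \<open>A\<close> and the result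
  is compared with the lower bound \<open>k\<close>.\<close>

lemma tight_out:
  assumes "outd v \<noteq> 0"
  obtains A B where "tight A B" "v \<in> A" "\<And>e. e \<in> P \<Longrightarrow> src e = v \<Longrightarrow> tgt e \<in> B"
proof -
  have "\<exists>e. e \<in> P \<and> src e = v"
  proof (rule ccontr)
    assume "\<not> ?thesis" hence "{e \<in> P. src e = v} = {}" by blast
    thus False using assms unfolding outd_def by (simp only: card.empty)
  qed
  then obtain e where e: "e \<in> P" "src e = v" by blast
  obtain A0 B0 where "tight A0 B0" "v \<in> A0" using tight_ex[OF e(1)] e(2) by blast
  let ?Q = "\<lambda>m. \<exists>A B. tight A B \<and> v \<in> A \<and> card B = m"
  have q: "?Q (card B0)" using \<open>tight A0 B0\<close> \<open>v \<in> A0\<close> by blast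
  have "\<And>m. ?Q m \<Longrightarrow> m \<le> card V" using finV unfolding tight_def rect_def by (auto intro: card_mono)
  then obtain m where "?Q m" and gr: "\<And>m'. ?Q m' \<Longrightarrow> m' \<le> m"
    using GreatestI_nat[of ?Q, OF q] Greatest_le_nat[of ?Q _ "card V"] by blast
  then obtain A B where AB: "tight A B" "v \<in> A" "card B = m" by blast
  show ?thesis
  proof (rule that[OF AB(1,2)])
    fix e assume e: "e \<in> P" "src e = v"
    obtain C D where CD: "tight C D" "v \<in> C" "tgt e \<in> D" using tight_ex[OF e(1)] e(2) by blast
    have "?Q (card (B \<union> D))" using tight_uncross(1)[OF AB(1) CD(1)] AB(2) CD(2) by blast
    hence "card (B \<union> D) \<le> card B" using gr AB(3) by blast
    moreover have "finite (B \<union> D)"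
      using AB CD finV finite_subset unfolding tight_def rect_def by (meson Un_least)
    ultimately have "D \<subseteq> B" using card_seteq[of "B \<union> D" B] by auto
    thus "tgt e \<in> B" using CD by blast
  qed
qed

lemma outd_le: "outd v \<le> k"
proof (cases "outd v = 0")
  case False
  then obtain A B where AB: "tight A B" "v \<in> A" "\<And>e. e \<in> P \<Longrightarrow> src e = v \<Longrightarrow> tgt e \<in> B"
    by (rule tight_out) blast
  have "outd v \<le> card {e \<in> P. src e \<in> A \<and> tgt e \<in> B}"
    unfolding outd_def using AB finP by (intro card_mono) auto
  thus ?thesis using AB(1) unfolding tight_def cut_size_def by linarith
qed simp

lemma cut_move:
  assumes "tight A B" "v \<in> A" "\<And>e. e \<in> P \<Longrightarrow> src e = v \<Longrightarrow> tgt e \<in> B"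
  shows "card {e \<in> P. src e \<in> A \<and> tgt e \<in> B} = card {e \<in> P. src e \<in> A - {v} \<and> tgt e \<in> B} + outd v"
proof -
  have "{e \<in> P. src e \<in> A \<and> tgt e \<in> B} = {e \<in> P. src e \<in> A - {v} \<and> tgt e \<in> B} \<union> {e \<in> P. src e = v}"
    using assms by auto
  moreover have "{e \<in> P. src e \<in> A - {v} \<and> tgt e \<in> B} \<inter> {e \<in> P. src e = v} = {}" by auto
  ultimately show ?thesis unfolding outd_def using finP by (simp add: card_Un_disjoint)
qed

text \<open>Taking \<open>v\<close> out of both sides loses \<open>outd v\<close> arcs and gains one
  uncovered vertex.\<close>

lemma outd_le1:
  assumes vm shows "outd v \<le> 1"
proof (cases "outd v = 0")
  case False
  then obtain A B where AB: "tight A B" "v \<in> A" "\<And>e. e \<in> P \<Longrightarrow> src e = v \<Longrightarrow> tgt e \<in> B"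
    by (rule tight_out) blast
  have "rc (A - {v}) B" "X \<inter> (A - {v}) = {}" "Y \<inter> B = {}"
    using AB(1) assms unfolding tight_def rect_def by blast+
  then have "k \<le> ct P (A - {v}) B" using cov unfolding link_cover_def by blast
  moreover have "V - (A - {v} \<union> B) = insert v (V - (A \<union> B))"
    using AB(1,2) unfolding tight_def rect_def by auto
  moreover have "card (insert v (V - (A \<union> B))) \<le> card (V - (A \<union> B)) + 1"
    by (simp add: card_insert_le_m1 card_insert_if finV)
  ultimately show ?thesis
    using cut_move[OF AB] AB(1) unfolding tight_def cut_size_def by simp
qed simp

text \<open>Half of flow conservation: moving \<open>v\<close> from \<open>A\<close> to
  \<open>B\<close> loses \<open>outd v\<close> arcs and gains at most the \<open>ind v\<close> arcs
  entering \<open>v\<close>. The new head side must avoid \<open>Y\<close>, hence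
  \<open>v \<notin> Y\<close>. Together with reversal, both degrees agree outside
  \<open>X \<union> Y\<close>.\<close>

lemma outd_le_ind:
  assumes "v \<notin> Y" shows "outd v \<le> ind v"
proof (cases "outd v = 0")
  case False
  then obtain A B where AB: "tight A B" "v \<in> A" "\<And>e. e \<in> P \<Longrightarrow> src e = v \<Longrightarrow> tgt e \<in> B"
    by (rule tight_out) blast
  have r: "rc (A - {v}) (insert v B)" using AB(1,2) unfolding tight_def rect_def by blast
  have "k \<le> ct P (A - {v}) (insert v B)"
    using cov AB(1) assms r unfolding link_cover_def tight_def by blast
  moreover have "V - (A - {v} \<union> insert v B) = V - (A \<union> B)" using AB(2) by auto
  moreover have "card {e \<in> P. src e \<in> A - {v} \<and> tgt e \<in> insert v B}
      \<le> card ({e \<in> P. src e \<in> A - {v} \<and> tgt e \<in> B} \<union> {e \<in> P. tgt e = v})"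
    using finP by (intro card_mono) auto
  moreover have "\<dots> \<le> card {e \<in> P. src e \<in> A - {v} \<and> tgt e \<in> B} + ind v"
    unfolding ind_def by (rule card_Un_le)
  ultimately show ?thesis
    using cut_move[OF AB] AB(1) unfolding tight_def cut_size_def by simp
qed simp

lemma ind_le: "ind v \<le> k" using linkage.outd_le[OF rev_linkage] outd_rev by simp
lemma ind_le1: "vm \<Longrightarrow> ind v \<le> 1" using linkage.outd_le1[OF rev_linkage] outd_rev by simp
lemma ind_le_outd: "v \<notin> X \<Longrightarrow> ind v \<le> outd v"
  using linkage.outd_le_ind[OF rev_linkage] outd_rev ind_rev by simp

section \<open>Order along the paths: acyclicity, shortcuts and exits\<close>

definition Pr :: "('a \<times> 'a) set" where "Pr = (\<lambda>e. (src e, tgt e)) ` P"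

lemma acyclic_Pr: "acyclic Pr"
proof (rule acyclicI, rule allI, rule notI)
  fix v assume "(v, v) \<in> Pr\<^sup>+"
  then obtain w where w: "(v, w) \<in> Pr" "(w, v) \<in> Pr\<^sup>*" by (meson tranclD)
  then obtain e where e: "e \<in> P" "src e = v" "tgt e = w" unfolding Pr_def by auto
  obtain A B where AB: "tight A B" "v \<in> A" "w \<in> B" using tight_ex[OF e(1)] e by blast
  from w(2) AB(3) have "v \<in> B"
  proof (induction rule: rtrancl_induct)
    case (step x y)
    then obtain e' where "e' \<in> P" "src e' = x" "tgt e' = y" unfolding Pr_def by auto
    moreover have "x \<notin> A" using step AB(1) unfolding tight_def rect_def by auto
    ultimately show ?case using tight_arc_side[OF AB(1)] by blast
  qed
  thus False using AB unfolding tight_def rect_def by auto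
qed

lemma out_unique:
  assumes vm "e \<in> P" "e' \<in> P" "src e = src e'" shows "e = e'"
  using outd_le1[OF assms(1), of "src e"] assms card_le_Suc0_iff_eq[of "{x \<in> P. src x = src e}"] finP
  unfolding outd_def by auto

lemma in_unique:
  assumes vm "e \<in> P" "e' \<in> P" "tgt e = tgt e'" shows "e = e'"
  using linkage.out_unique[OF rev_linkage assms] .

lemma src_notin_X: "e \<in> P \<Longrightarrow> src e \<notin> X"
  by (erule tight_ex) (auto simp: tight_def)

lemma tgt_notin_Y: "e \<in> P \<Longrightarrow> tgt e \<notin> Y"
  by (erule tight_ex) (auto simp: tight_def)

text \<open>An arc of \<open>E - P\<close> from a vertex to a later one on the same path would shorten that path.\<close>

lemma induced:
  assumes vm "e \<in> E" "e \<notin> P" "(src e, tgt e) \<in> Pr\<^sup>+" shows False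
proof -
  define a q where "a = src e" and "q = tgt e"
  \<comment> \<open>The vertices strictly between the two ends of \<open>e\<close> on their
    path.\<close>
  define M where "M = {v. (a, v) \<in> Pr\<^sup>+ \<and> (v, q) \<in> Pr\<^sup>+}"
  have src_M: "tgt x \<in> M \<or> tgt x = q" if x: "x \<in> P" "src x \<in> M" for x
  proof -
    obtain w where w: "(src x, w) \<in> Pr" "(w, q) \<in> Pr\<^sup>*"
      using x(2) unfolding M_def by (blast dest: tranclD)
    then obtain x' where "x' \<in> P" "src x' = src x" "tgt x' = w" unfolding Pr_def by auto
    hence "tgt x = w" using out_unique[OF assms(1)] x by blast
    moreover have "(a, w) \<in> Pr\<^sup>+" using x(2) w(1) unfolding M_def by auto
    ultimately show ?thesis using w(2) unfolding M_def by (auto simp: rtrancl_eq_or_trancl)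
  qed
  have tgt_M: "src x \<in> M \<or> src x = a" if x: "x \<in> P" "tgt x \<in> M" for x
  proof -
    obtain w where w: "(w, tgt x) \<in> Pr" "(a, w) \<in> Pr\<^sup>*"
      using x(2) unfolding M_def by (blast dest: tranclD2)
    then obtain x' where "x' \<in> P" "tgt x' = tgt x" "src x' = w" unfolding Pr_def by auto
    hence "src x = w" using in_unique[OF assms(1)] x by blast
    moreover have "(w, q) \<in> Pr\<^sup>+" using x(2) w(1) unfolding M_def by auto
    ultimately show ?thesis using w(2) unfolding M_def by (auto simp: rtrancl_eq_or_trancl)
  qed
  have M_out: "\<exists>x\<in>P. src x = m" and M_in: "\<exists>x\<in>P. tgt x = m" if mM: "m \<in> M" for m
  proof -
    obtain u w where "(u, m) \<in> Pr" "(m, w) \<in> Pr"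
      using mM unfolding M_def by (blast dest: tranclD tranclD2)
    thus "\<exists>x\<in>P. src x = m" "\<exists>x\<in>P. tgt x = m" unfolding Pr_def by auto
  qed
  have MY: "M \<inter> Y = {}" and MX: "M \<inter> X = {}"
    using M_in M_out tgt_notin_Y src_notin_X by blast+
  have MV: "M \<subseteq> V" using M_out PE src_V by blast
  have aq: "a \<notin> M" "q \<notin> M" using acyclic_Pr unfolding M_def acyclic_def by auto
  show False
  proof (cases "M = {}")
    case True
    from assms(4) have "(a, q) \<in> Pr"
    proof (cases rule: trancl.cases)
      case (trancl_into_trancl b)
      thus ?thesis using True unfolding M_def a_def q_def by blast
    qed (simp add: a_def q_def)
    then obtain x where "x \<in> P" "src x = a" "tgt x = q" unfolding Pr_def by auto
    thus False using simple[OF assms(1)] assms(2,3) PE unfolding a_def q_def by blast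
  next
    case False
    \<comment> \<open>The arc \<open>e\<close> replaces all arcs at \<open>M\<close>. A vertex of
      \<open>M\<close> has an arc of \<open>P\<close> on either side, so at least one arc is saved
      and only the covering property has to be shown.\<close>
    define P' where "P' = {x \<in> P. src x \<notin> M \<and> tgt x \<notin> M}"
    have finP': "finite P'" unfolding P'_def using finP by simp
    have "link_cover V src tgt vm k Y X (insert e P')"
      unfolding link_cover_def
    proof (intro allI impI)
      fix A B assume r: "rc A B" and YX: "Y \<inter> B = {}" "X \<inter> A = {}"
      let ?N = "{x \<in> insert e P'. src x \<in> A \<and> tgt x \<in> B}"
      have fN: "finite ?N" using finP' by simp
      show "k \<le> ct (insert e P') A B"
      \<comment> \<open>\<open>M\<close> is moved into \<open>A\<close> if \<open>a \<in> A\<close>,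
        and into \<open>B\<close> otherwise. In the first case \<open>e\<close> stands in for the
        single arc of \<open>P\<close> from \<open>M\<close> to \<open>q\<close>; in the second no
        arc of \<open>P\<close> enters \<open>M\<close> from \<open>A - M\<close>, since only
        \<open>a\<close> precedes \<open>M\<close>.\<close>
      proof (cases "a \<in> A")
        case True
        have r': "rc (A \<union> M) (B - M)" using r MV assms(1) unfolding rect_def by blast
        have k: "k \<le> ct P (A \<union> M) (B - M)"
          using cov r' YX MX unfolding link_cover_def by blast
        let ?L = "{x \<in> P. src x \<in> A \<union> M \<and> tgt x \<in> B - M}"
        have "card ?L \<le> card ?N"
        proof (rule card_inj_on_le[OF _ _ fN])
          let ?g = "\<lambda>x. if src x \<in> M then e else x"
          show "inj_on ?g ?L"
          proof (rule inj_onI)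
            fix x y assume xy: "x \<in> ?L" "y \<in> ?L" "?g x = ?g y"
            show "x = y"
            proof (cases "src x \<in> M \<and> src y \<in> M")
              case True
              thus ?thesis using in_unique[OF assms(1), of x y] src_M[of x] src_M[of y] xy by auto
            qed (use xy assms(3) in \<open>auto split: if_splits\<close>)
          qed
          show "?g ` ?L \<subseteq> ?N"
          proof
            fix y assume "y \<in> ?g ` ?L"
            then obtain x where x: "x \<in> ?L" "y = ?g x" by blast
            show "y \<in> ?N"
            proof (cases "src x \<in> M")
              case True': True
              hence "tgt e \<in> B" using src_M[of x] x(1) unfolding q_def by auto
              thus ?thesis using True True' x(2) unfolding a_def by simp
            qed (use x in \<open>auto simp: P'_def\<close>)
          qed
        qed
        moreover have "card (V - (A \<union> M \<union> (B - M))) \<le> card (V - (A \<union> B))"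
          using finV by (intro card_mono) auto
        ultimately show ?thesis using k unfolding cut_size_def by linarith
      next
        case False
        have r': "rc (A - M) (B \<union> M)" using r MV assms(1) unfolding rect_def by blast
        have k: "k \<le> ct P (A - M) (B \<union> M)"
          using cov r' YX MY unfolding link_cover_def by blast
        have "card {x \<in> P. src x \<in> A - M \<and> tgt x \<in> B \<union> M} \<le> card ?N"
          using tgt_M False by (intro card_mono fN) (auto simp: P'_def)
        moreover have "card (V - (A - M \<union> (B \<union> M))) \<le> card (V - (A \<union> B))"
          using finV by (intro card_mono) auto
        ultimately show ?thesis using k unfolding cut_size_def by linarith
      qed
    qed
    moreover have "insert e P' \<subseteq> E" using PE assms(2) unfolding P'_def by auto
    ultimately have "card P \<le> card (insert e P')" using least by blast
    also have "\<dots> \<le> card P' + 1" using finP' by (simp add: card_insert_if)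
    finally have le: "card P \<le> card P' + 1" .
    from False obtain m where m: "m \<in> M" by blast
    obtain x y where xy: "x \<in> P" "src x = m" "y \<in> P" "tgt y = m" using M_in[OF m] M_out[OF m] by blast
    have "x \<noteq> y" using xy loopfree[of y] PE by auto
    have "P' \<union> {x, y} \<subseteq> P" using xy unfolding P'_def by blast
    hence "card (P' \<union> {x, y}) \<le> card P" using finP card_mono by blast
    moreover have "P' \<inter> {x, y} = {}" using xy m unfolding P'_def by auto
    hence "card (P' \<union> {x, y}) = card P' + card {x, y}" by (intro card_Un_disjoint finP') auto
    moreover have "card {x, y} = 2" using \<open>x \<noteq> y\<close> by simp
    ultimately show False using le by linarith
  qed
qed

text \<open>A flow unit entering \<open>a\<close> must leave \<open>A\<close> later on, since it cannot stop before \<open>X\<close>.\<close>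

lemma exits:
  assumes "X \<inter> A = {}" "a \<in> A" "finite A"
  shows "ind a \<le> card {e \<in> P. src e \<in> A \<and> (a, src e) \<in> Pr\<^sup>* \<and> tgt e \<notin> A}"
proof -
  define Z where "Z = {z. (a, z) \<in> (Pr \<inter> A \<times> A)\<^sup>*}"
  have ZA: "Z \<subseteq> A"
  proof
    fix z assume "z \<in> Z"
    hence "(a, z) \<in> (Pr \<inter> A \<times> A)\<^sup>*" unfolding Z_def by simp
    thus "z \<in> A" using assms(2) by (induction rule: rtrancl_induct) auto
  qed
  hence finZ: "finite Z" using assms(3) finite_subset by auto
  have aZ: "a \<in> Z" unfolding Z_def by simp
  have Zr: "(a, z) \<in> Pr\<^sup>*" if "z \<in> Z" for z
    using that rtrancl_mono[of "Pr \<inter> A \<times> A" Pr] unfolding Z_def by auto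
  have step: "tgt e \<in> Z" if "e \<in> P" "src e \<in> Z" "tgt e \<in> A" for e
  proof -
    have "(src e, tgt e) \<in> Pr \<inter> A \<times> A" using that ZA unfolding Pr_def by auto
    thus ?thesis using that(2) unfolding Z_def by (simp only: mem_Collect_eq rtrancl.rtrancl_into_rtrancl)
  qed
  let ?I = "{e \<in> P. src e \<in> Z \<and> tgt e \<in> Z}"
  let ?L = "{e \<in> P. src e \<in> Z \<and> tgt e \<notin> A}"
  have so: "(\<Sum>z\<in>Z. outd z) = card {e \<in> P. src e \<in> Z}"
  proof -
    have "{e \<in> P. src e \<in> Z} = (\<Union>z\<in>Z. {e \<in> P. src e = z})" by auto
    thus ?thesis unfolding outd_def using finZ finP by (subst card_UN_disjoint[symmetric]) auto
  qed
  have si: "(\<Sum>z\<in>Z. ind z) = card {e \<in> P. tgt e \<in> Z}"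
  proof -
    have "{e \<in> P. tgt e \<in> Z} = (\<Union>z\<in>Z. {e \<in> P. tgt e = z})" by auto
    thus ?thesis unfolding ind_def using finZ finP by (subst card_UN_disjoint[symmetric]) auto
  qed
  have "{e \<in> P. src e \<in> Z} = ?I \<union> ?L" using step ZA by auto
  moreover have "?I \<inter> ?L = {}" using ZA by auto
  ultimately have o: "card {e \<in> P. src e \<in> Z} = card ?I + card ?L"
    using finP by (simp add: card_Un_disjoint)
  have "src e \<notin> Z" if "e \<in> P" "tgt e = a" for e
  proof
    assume "src e \<in> Z"
    hence "(a, src e) \<in> Pr\<^sup>*" by (rule Zr)
    moreover have "(src e, a) \<in> Pr" using that unfolding Pr_def by auto
    ultimately have "(a, a) \<in> Pr\<^sup>+" by simp
    thus False using acyclic_Pr unfolding acyclic_def by simp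
  qed
  hence "?I \<inter> {e \<in> P. tgt e = a} = {}" by auto
  hence "card ?I + ind a = card (?I \<union> {e \<in> P. tgt e = a})"
    unfolding ind_def using finP by (simp add: card_Un_disjoint)
  also have "\<dots> \<le> card {e \<in> P. tgt e \<in> Z}" using finP aZ by (intro card_mono) auto
  also have "\<dots> = (\<Sum>z\<in>Z. ind z)" by (rule si[symmetric])
  also have "\<dots> \<le> (\<Sum>z\<in>Z. outd z)" using assms(1) ZA by (intro sum_mono ind_le_outd) auto
  finally have "ind a \<le> card ?L" using so o by linarith
  also have "\<dots> \<le> card {e \<in> P. src e \<in> A \<and> (a, src e) \<in> Pr\<^sup>* \<and> tgt e \<notin> A}"
    using ZA Zr finP by (intro card_mono) auto
  finally show ?thesis .
qed

text \<open>The arcs of \<open>S\<close> leave \<open>A\<close> at once, and by \<open>exits\<close>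
  the \<open>ind a\<close> flow units through \<open>a\<close> leave it later. An arc into
  \<open>B\<close> counts as an arc, an arc that ends outside both sides counts as its head, so for
  \<open>vm\<close> the heads must differ: at most one path passes through \<open>a\<close>, and a
  head common to \<open>S\<close> and that path would make a shortcut, excluded by
  \<open>induced\<close>. With \<open>card S = k - ind a\<close> the rectangle cannot be
  violated.\<close>

lemma stuck_vertex:
  assumes r: "rc A B" and XA: "X \<inter> A = {}" and a: "a \<in> A"
    and S: "S \<subseteq> E - P" "\<And>e. e \<in> S \<Longrightarrow> src e = a \<and> tgt e \<notin> A" "inj_on tgt S"
  shows "card S + ind a \<le> ct (S \<union> P) A B"
proof -
  define L where "L = {e \<in> P. src e \<in> A \<and> (a, src e) \<in> Pr\<^sup>* \<and> tgt e \<notin> A}"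
  have fA: "finite A" using r finV finite_subset unfolding rect_def by auto
  have fS: "finite S" using S(1) finE finite_subset by auto
  have fL: "finite L" unfolding L_def using finP by auto
  have L: "ind a \<le> card L" unfolding L_def by (rule exits[OF XA a fA])
  have SL: "S \<inter> L = {}" using S(1) unfolding L_def by auto
  let ?N = "{e \<in> S \<union> P. src e \<in> A \<and> tgt e \<in> B}"
  have fN: "finite ?N" using fS finP by auto
  have tV: "tgt e \<in> V" if "e \<in> S \<union> L" for e using that S PE tgt_V unfolding L_def by auto
  show ?thesis
  proof (cases vm)
    case False
    have "S \<union> L \<subseteq> ?N"
      using S a r False tV unfolding L_def rect_def by auto
    hence "card (S \<union> L) \<le> card ?N" using fN by (intro card_mono) auto
    thus ?thesis using SL fS fL L unfolding cut_size_def by (simp add: card_Un_disjoint)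
  next
    case True
    obtain L' where L': "L' \<subseteq> L" "card L' = ind a" using L by (meson obtain_subset_with_card_n)
    have "finite L'" using L' fL finite_subset by auto
    have "card (S \<union> L') = card S + ind a"
      using SL L' fS \<open>finite L'\<close> by (subst card_Un_disjoint) auto
    moreover have "card (S \<union> L') \<le> card (?N <+> (V - (A \<union> B)))"
    proof (rule card_inj_on_le)
      let ?g = "\<lambda>e. if tgt e \<in> B then Inl e else Inr (tgt e)"
      have inj: "inj_on tgt (S \<union> L')"
        unfolding inj_on_Un
      proof (intro conjI S(3))
        have "card L' \<le> 1" using L' ind_le1[OF True] by simp
        thus "inj_on tgt L'" using card_le_Suc0_iff_eq[OF \<open>finite L'\<close>] by (auto intro!: inj_onI)
        have False if "x \<in> S" "y \<in> L" "tgt x = tgt y" for x y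
        proof -
          have "(a, tgt y) \<in> Pr\<^sup>+" using that(2) unfolding L_def Pr_def
            by (auto intro: rtrancl_into_trancl1)
          thus False using induced[OF True, of x] S that by auto
        qed
        thus "tgt ` (S - L') \<inter> tgt ` (L' - S) = {}" using L' by blast
      qed
      show "inj_on ?g (S \<union> L')" using inj by (auto simp: inj_on_def split: if_splits)
      show "?g ` (S \<union> L') \<subseteq> ?N <+> (V - (A \<union> B))"
        using S a tV L' unfolding L_def by auto
      show "finite (?N <+> (V - (A \<union> B)))" using fN finV by simp
    qed
    ultimately show ?thesis using fN finV unfolding cut_size_def by (simp add: card_Plus)
  qed
qed

end

section \<open>Hubs of low out-degree\<close>

text \<open>\<open>R\<close> keeps one direction per adjacent pair. In- and out-neighbourhoods are
  then disjoint, and averaging works as in tournaments with an error of \<open>D\<close> per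
  vertex.\<close>

locale oriented = arc_graph V E src tgt vm
  for V :: "'a set" and E :: "'b set" and src tgt :: "'b \<Rightarrow> 'a" and vm :: bool +
  fixes D :: nat and R :: "'a \<Rightarrow> 'a \<Rightarrow> bool"
  assumes R_arc: "R u v \<Longrightarrow> \<exists>e\<in>E. src e = u \<and> tgt e = v"
    and R_asym: "R u v \<Longrightarrow> \<not> R v u"
    and R_total: "e \<in> E \<Longrightarrow> R (src e) (tgt e) \<or> R (tgt e) (src e)"
    and nonadj: "v \<in> V \<Longrightarrow> card {w \<in> V - {v}. \<not> R v w \<and> \<not> R w v} \<le> D"

lemma (in arc_graph) orientation_exists:
  assumes "\<And>v. v \<in> V \<Longrightarrow> card {w \<in> V - {v}. \<not> (\<exists>e\<in>E. src e = v \<and> tgt e = w) \<and>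
      \<not> (\<exists>e\<in>E. src e = w \<and> tgt e = v)} \<le> D"
  obtains R where "oriented V E src tgt vm D R"
proof -
  define adj where "adj u v \<longleftrightarrow> (\<exists>e\<in>E. src e = u \<and> tgt e = v)" for u v
  obtain g :: "'a \<Rightarrow> nat" where g: "inj_on g V"
    using finite_imp_inj_to_nat_seg[OF finV] by blast
  have aV: "u \<in> V \<and> v \<in> V \<and> u \<noteq> v" if "adj u v" for u v
    using that src_V tgt_V loopfree unfolding adj_def by metis
  define R where "R u v \<longleftrightarrow> adj u v \<and> (adj v u \<longrightarrow> g u < g v)" for u v
  have tot: "R u v \<or> R v u" if "adj u v" for u v
    using aV[OF that] that g unfolding R_def inj_on_def by (metis linorder_neqE_nat)
  have eq: "{w \<in> V - {v}. \<not> R v w \<and> \<not> R w v} = {w \<in> V - {v}. \<not> adj v w \<and> \<not> adj w v}" for v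
    using tot unfolding R_def by auto
  have "oriented V E src tgt vm D R"
  proof
    show "\<exists>e\<in>E. src e = u \<and> tgt e = v" if "R u v" for u v
      using that unfolding R_def adj_def by blast
    show "\<not> R v u" if "R u v" for u v using that unfolding R_def by auto
    show "R (src e) (tgt e) \<or> R (tgt e) (src e)" if "e \<in> E" for e
      using that by (intro tot) (auto simp: adj_def)
    show "card {w \<in> V - {v}. \<not> R v w \<and> \<not> R w v} \<le> D" if "v \<in> V" for v
      using assms[OF that] unfolding eq adj_def .
  qed
  thus ?thesis by (rule that)
qed

lemma low_subset:
  fixes g :: "'a \<Rightarrow> nat"
  assumes "finite V" "m \<le> card V"
  obtains I where "I \<subseteq> V" "card I = m" "\<And>i v. i \<in> I \<Longrightarrow> v \<in> V - I \<Longrightarrow> g i \<le> g v"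
proof -
  have "\<exists>I\<subseteq>V. card I = m \<and> (\<forall>i\<in>I. \<forall>v\<in>V - I. g i \<le> g v)"
    using assms(2)
  proof (induction m)
    case 0
    show ?case by (rule exI[of _ "{}"]) simp
  next
    case (Suc m)
    then obtain I where I: "I \<subseteq> V" "card I = m" "\<forall>i\<in>I. \<forall>v\<in>V - I. g i \<le> g v" by auto
    have "V - I \<noteq> {}" using I Suc.prems by auto
    then obtain x where x: "x \<in> V - I" "\<And>v. v \<in> V - I \<Longrightarrow> g x \<le> g v"
      using ex_min_if_finite[of "g ` (V - I)"] assms(1) by (metis (no_types, lifting)
        arg_min_if_finite(1) arg_min_least finite_Diff)
    have "finite I" using I assms finite_subset by auto
    thus ?case using I x by (intro exI[of _ "insert x I"]) auto
  qed
  thus ?thesis using that by blast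
qed

context oriented
begin

definition deg :: "'a set \<Rightarrow> 'a \<Rightarrow> nat" where "deg Z v = card {w \<in> Z. R v w}"

lemma rev_oriented: "oriented V E tgt src vm D (\<lambda>u v. R v u)"
proof -
  interpret r: arc_graph V E tgt src vm by (rule rev_graph)
  show ?thesis
  proof
    show "\<exists>e\<in>E. tgt e = u \<and> src e = v" if "R v u" for u v using R_arc[OF that] by blast
    show "card {w \<in> V - {v}. \<not> R w v \<and> \<not> R v w} \<le> D" if "v \<in> V" for v
      using nonadj[OF that] by (simp add: conj_commute)
  qed (use R_asym R_total in auto)
qed

lemma R_V: "R u v \<Longrightarrow> u \<in> V \<and> v \<in> V"
  using R_arc src_V tgt_V by metis

lemma sum_deg: "finite Z \<Longrightarrow> (\<Sum>z\<in>Z. deg Z z) = (\<Sum>z\<in>Z. card {w \<in> Z. R w z})"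
  unfolding deg_def card_filter_sum by (rule sum.swap)

lemma low_deg_member:
  assumes "finite Z" "Z \<noteq> {}" obtains z where "z \<in> Z" "2 * deg Z z + 1 \<le> card Z"
proof (rule ccontr)
  assume "\<not> thesis"
  hence a: "card Z \<le> 2 * deg Z z" if "z \<in> Z" for z using that \<open>\<And>z. _ \<Longrightarrow> _ \<Longrightarrow> thesis\<close> by fastforce
  have b: "deg Z z + card {w \<in> Z. R w z} \<le> card Z - 1" if "z \<in> Z" for z
  proof -
    have "{w \<in> Z. R z w} \<inter> {w \<in> Z. R w z} = {}" using R_asym by blast
    hence "deg Z z + card {w \<in> Z. R w z} = card ({w \<in> Z. R z w} \<union> {w \<in> Z. R w z})"
      unfolding deg_def using assms(1) by (simp add: card_Un_disjoint)
    also have "\<dots> \<le> card (Z - {z})" using assms(1) R_asym by (intro card_mono) auto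
    finally show ?thesis using that assms(1) by simp
  qed
  have "card Z * card Z = (\<Sum>z\<in>Z. card Z)" by simp
  also have "\<dots> \<le> (\<Sum>z\<in>Z. 2 * deg Z z)" using a by (intro sum_mono) auto
  also have "\<dots> = (\<Sum>z\<in>Z. deg Z z) + (\<Sum>z\<in>Z. card {w \<in> Z. R w z})"
    using sum_deg[OF assms(1)] by (simp add: sum_distrib_left[symmetric])
  also have "\<dots> = (\<Sum>z\<in>Z. deg Z z + card {w \<in> Z. R w z})" by (rule sum.distrib[symmetric])
  also have "\<dots> \<le> (\<Sum>z\<in>Z. card Z - 1)" using b by (intro sum_mono) auto
  also have "\<dots> = card Z * (card Z - 1)" by simp
  also have "\<dots> < card Z * card Z" using assms by (intro mult_strict_left_mono) (auto simp: card_gt_0_iff)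
  finally show False by simp
qed

text \<open>Inside \<open>Z\<close> every vertex has at least \<open>card Z - D - 1\<close>
  neighbours, and on average half of them are out-neighbours.\<close>

lemma card_low_deg:
  assumes "Z \<subseteq> V" "\<And>z. z \<in> Z \<Longrightarrow> deg Z z \<le> c" shows "card Z \<le> 2 * c + D + 1"
proof (cases "Z = {}")
  case False
  have f: "finite Z" using assms finV finite_subset by auto
  have b: "card Z \<le> deg Z z + card {w \<in> Z. R w z} + (D + 1)" if "z \<in> Z" for z
  proof -
    have "Z \<subseteq> ({w \<in> Z. R z w} \<union> {w \<in> Z. R w z}) \<union> insert z {w \<in> V - {z}. \<not> R z w \<and> \<not> R w z}"
      using assms(1) by auto
    hence "card Z \<le> card (({w \<in> Z. R z w} \<union> {w \<in> Z. R w z}) \<union> insert z {w \<in> V - {z}. \<not> R z w \<and> \<not> R w z})"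
      by (intro card_mono) (use f finV in auto)
    also have "\<dots> \<le> (deg Z z + card {w \<in> Z. R w z}) + card (insert z {w \<in> V - {z}. \<not> R z w \<and> \<not> R w z})"
      unfolding deg_def by (intro order_trans[OF card_Un_le] add_mono card_Un_le order_refl)
    also have "card (insert z {w \<in> V - {z}. \<not> R z w \<and> \<not> R w z}) \<le> D + 1"
      using nonadj[of z] that assms(1) finV by (auto simp: card_insert_if)
    finally show ?thesis by simp
  qed
  have "card Z * card Z = (\<Sum>z\<in>Z. card Z)" by simp
  also have "\<dots> \<le> (\<Sum>z\<in>Z. deg Z z + card {w \<in> Z. R w z} + (D + 1))" using b by (intro sum_mono) auto
  also have "\<dots> = (\<Sum>z\<in>Z. deg Z z) + (\<Sum>z\<in>Z. deg Z z) + card Z * (D + 1)"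
    unfolding sum.distrib using sum_deg[OF f] by simp
  also have "(\<Sum>z\<in>Z. deg Z z) \<le> card Z * c" using sum_mono[of Z "deg Z" "\<lambda>_. c"] assms(2) by simp
  finally have "card Z * card Z \<le> card Z * (2 * c + D + 1)" by (simp add: algebra_simps)
  moreover have "0 < card Z" using False f by (simp add: card_gt_0_iff)
  ultimately show ?thesis by (meson mult_le_cancel1)
qed simp

lemma dominates_non_in_nbrs:
  assumes "v \<in> V" "W \<subseteq> V - {v}" "\<And>w. w \<in> W \<Longrightarrow> \<not> (R w v)"
  shows "card W \<le> card {w \<in> W. R v w} + D"
proof -
  have "W \<subseteq> {w \<in> W. R v w} \<union> {w \<in> V - {v}. \<not> R v w \<and> \<not> R w v}" using assms by auto
  hence "card W \<le> card ({w \<in> W. R v w} \<union> {w \<in> V - {v}. \<not> R v w \<and> \<not> R w v})"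
    by (intro card_mono) (use finV finite_subset[OF assms(2)] in auto)
  also have "\<dots> \<le> card {w \<in> W. R v w} + card {w \<in> V - {v}. \<not> R v w \<and> \<not> R w v}" by (rule card_Un_le)
  finally show ?thesis using nonadj[OF assms(1)] by linarith
qed

text \<open>Suppose \<open>y \<in> Y\<close> lies in \<open>B\<close>. Inside \<open>I\<close>, a
  vertex of \<open>A\<close> has all but fewer than \<open>k\<close> of its out-neighbours in
  \<open>A\<close>. Starting from \<open>i\<close>, this makes \<open>A\<close> large, and some
  \<open>a \<in> A\<close> outside \<open>Y\<close> has only about half of it as out-neighbours. But
  \<open>y\<close> receives fewer than \<open>k\<close> arcs from \<open>A \<inter> I\<close>, hence
  dominates nearly all of it and has larger degree in \<open>I\<close> than \<open>a\<close>,
  contrary to the choice of \<open>Y\<close>.\<close>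

lemma hub:
  assumes I: "I \<subseteq> V" "Y \<subseteq> I" "card Y = k" "\<And>y v. y \<in> Y \<Longrightarrow> v \<in> I - Y \<Longrightarrow> deg I y \<le> deg I v"
    and i: "i \<in> I" "i \<in> A" "6 * k + 2 * D \<le> deg I i"
    and r: "rc A B" and c: "ct {e \<in> E. src e \<in> I \<and> tgt e \<in> I} A B < k"
  shows "B \<inter> Y = {}"
proof (rule ccontr)
  assume "B \<inter> Y \<noteq> {}"
  then obtain y where y: "y \<in> B" "y \<in> Y" by blast
  define N where "N = {e \<in> {e \<in> E. src e \<in> I \<and> tgt e \<in> I}. src e \<in> A \<and> tgt e \<in> B}"
  define S where "S = V - (A \<union> B)"
  define A' where "A' = A \<inter> (I - Y)"
  have NS: "card N + card S < k" using c unfolding cut_size_def N_def S_def .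
  have fin: "finite I" "finite N" "finite S" "finite A'" "finite A" "finite Y"
    using I(1,2) finV finE r finite_subset[of _ V]
    unfolding N_def S_def A'_def rect_def by (auto intro: finite_subset)
  have NSt: "card (S \<union> tgt ` N) < k"
    using card_Un_le[of S "tgt ` N"] card_image_le[OF fin(2), of tgt] NS by linarith
  have Nt: "w \<in> tgt ` N" if "R a w" "a \<in> A" "a \<in> I" "w \<in> I" "w \<in> B" for a w
    using R_arc[OF that(1)] that(2-) unfolding N_def by auto
  have out: "deg I a \<le> card Z + (k - 1)" if a: "a \<in> A" "a \<in> I" and Z: "finite Z" "{w \<in> I \<inter> A. R a w} \<subseteq> Z" for a Z
  proof -
    have "{w \<in> I. R a w} \<subseteq> Z \<union> (S \<union> tgt ` N)" using Nt[OF _ a] Z I(1) unfolding S_def by auto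
    hence "deg I a \<le> card (Z \<union> (S \<union> tgt ` N))"
      unfolding deg_def using fin Z by (intro card_mono) auto
    thus ?thesis using card_Un_le[of Z "S \<union> tgt ` N"] NSt by linarith
  qed
  have "deg I i \<le> card (A' \<union> Y) + (k - 1)"
    using i fin by (intro out) (auto simp: A'_def)
  \<comment> \<open>The degree \<open>6 * k + 2 * D\<close> of \<open>i\<close> pays 2k for
    \<open>Y\<close> and the cut; the rest has to exceed twice the loss
    \<open>D + 2 * (k - 1)\<close> in the comparison of \<open>y\<close> with
    \<open>a\<close>.\<close>
  hence A': "4 * k + 2 * D + 1 \<le> card A'"
    using card_Un_le[of A' Y] I(3) i(3) NS by linarith
  hence "A' \<noteq> {}" by auto
  then obtain a where a: "a \<in> A'" "2 * deg A' a + 1 \<le> card A'"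
    using low_deg_member[OF fin(4)] by blast
  have "deg I a \<le> card ({w \<in> A'. R a w} \<union> (A \<inter> Y)) + (k - 1)"
    using a(1) fin by (intro out) (auto simp: A'_def)
  hence ub: "deg I a \<le> deg A' a + card (A \<inter> Y) + (k - 1)"
    using card_Un_le[of "{w \<in> A'. R a w}" "A \<inter> Y"] unfolding deg_def by linarith
  have "A \<inter> I = A' \<union> (A \<inter> Y)" "A' \<inter> (A \<inter> Y) = {}" using I(2) unfolding A'_def by auto
  hence AI: "card (A \<inter> I) = card A' + card (A \<inter> Y)" using fin by (simp add: card_Un_disjoint)
  have yA: "y \<notin> A" using y r unfolding rect_def by auto
  have yV: "y \<in> V" "y \<in> I" using y I by auto
  define W where "W = {w \<in> A \<inter> I. \<not> R w y}"
  have "card W \<le> card {w \<in> W. R y w} + D"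
    using yV yA I(1) by (intro dominates_non_in_nbrs) (auto simp: W_def)
  also have "card {w \<in> W. R y w} \<le> deg I y"
    unfolding deg_def W_def using fin by (intro card_mono) auto
  finally have W: "card W \<le> deg I y + D" by simp
  have "A \<inter> I \<subseteq> W \<union> src ` N"
  proof
    fix w assume w: "w \<in> A \<inter> I"
    show "w \<in> W \<union> src ` N"
    proof (cases "R w y")
      case True
      then obtain e where "e \<in> E" "src e = w" "tgt e = y" using R_arc by blast
      hence "e \<in> N" using w y yV unfolding N_def by auto
      thus ?thesis using \<open>src e = w\<close> by auto
    qed (use w in \<open>auto simp: W_def\<close>)
  qed
  hence "card (A \<inter> I) \<le> card (W \<union> src ` N)" using fin by (intro card_mono) (auto simp: W_def)
  also have "\<dots> \<le> card W + card N"
    using card_Un_le[of W "src ` N"] card_image_le[OF fin(2), of src] by linarith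
  finally have "card (A \<inter> I) \<le> deg I y + D + (k - 1)" using W NS by linarith
  moreover have "deg I y \<le> deg I a" using I(4)[OF y(2)] a(1) unfolding A'_def by auto
  ultimately show False using AI ub a(2) A' NS by linarith
qed

text \<open>The lists omit the common start \<open>z\<close>, so they can be disjoint. If
  \<open>A\<close> avoids \<open>T\<close>, each path leaves \<open>A\<close> into a vertex of its
  own, which is the head of an arc into \<open>B\<close> or lies outside both sides.\<close>

lemma fan_of_paths:
  assumes z: "z \<in> V" and fam: "finite F" "card F = k" "pairwise (\<lambda>p q. set p \<inter> set q = {}) F"
    and ok: "\<And>p. p \<in> F \<Longrightarrow> p \<noteq> [] \<and> length p \<le> l \<and>
      successively (\<lambda>u v. \<exists>e\<in>E. src e = u \<and> tgt e = v) (z # p) \<and> last p \<in> T"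
  obtains N where "N \<subseteq> E" "card N \<le> l * k"
    "\<And>A B. rc A B \<Longrightarrow> z \<in> A \<Longrightarrow> ct N A B < k \<Longrightarrow> A \<inter> T \<noteq> {}"
proof -
  let ?adj = "\<lambda>u v. \<exists>e\<in>E. src e = u \<and> tgt e = v"
  define ea where "ea = (\<lambda>(u, v). SOME e. e \<in> E \<and> src e = u \<and> tgt e = v)"
  have ea: "ea (u, v) \<in> E \<and> src (ea (u, v)) = u \<and> tgt (ea (u, v)) = v" if "?adj u v" for u v
    unfolding ea_def using that by (auto intro: someI2)
  have zipadj: "?adj u v" if "successively ?adj (x # p)" "(u, v) \<in> set (zip (x # p) p)" for x p u v
    using that by (induction p arbitrary: x) auto
  define N where "N = (\<Union>p\<in>F. ea ` set (zip (z # p) p))"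
  have NE: "N \<subseteq> E" unfolding N_def using ok zipadj ea by fast
  have fN: "finite N" using NE finE finite_subset by auto
  have "card N \<le> (\<Sum>p\<in>F. card (ea ` set (zip (z # p) p)))"
    unfolding N_def by (rule card_UN_le[OF fam(1)])
  also have "\<dots> \<le> (\<Sum>p\<in>F. l)"
  proof (rule sum_mono)
    fix p assume "p \<in> F"
    have "card (ea ` set (zip (z # p) p)) \<le> length (zip (z # p) p)"
      by (metis card_image_le card_length finite_set order_trans)
    thus "card (ea ` set (zip (z # p) p)) \<le> l" using ok[OF \<open>p \<in> F\<close>] by simp
  qed
  finally have cN: "card N \<le> l * k" using fam(2) by (simp add: mult.commute)
  have exit: "\<exists>u v. (u, v) \<in> set (zip (x # p) p) \<and> u \<in> A \<and> v \<notin> A"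
    if "x \<in> A" "p \<noteq> []" "last p \<notin> A" for x p and A :: "'a set"
    using that
  proof (induction p arbitrary: x)
    case (Cons a p)
    show ?case
    proof (cases "a \<in> A")
      case True
      hence "p \<noteq> []" using Cons.prems by auto
      thus ?thesis using Cons.IH[OF True] Cons.prems by auto
    qed (use Cons.prems in auto)
  qed simp
  show ?thesis
  proof (rule that[OF NE cN])
    fix A B assume r: "rc A B" and zA: "z \<in> A" and c: "ct N A B < k"
    show "A \<inter> T \<noteq> {}"
    proof
      assume AT: "A \<inter> T = {}"
      have "\<exists>u v. (u, v) \<in> set (zip (z # p) p) \<and> u \<in> A \<and> v \<notin> A" if "p \<in> F" for p
        using exit[OF zA, of p] ok[OF that] AT by blast
      then obtain u v where uv: "\<And>p. p \<in> F \<Longrightarrow> (u p, v p) \<in> set (zip (z # p) p) \<and> u p \<in> A \<and> v p \<notin> A"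
        by metis
      have vp: "v p \<in> set p" if "p \<in> F" for p using uv[OF that] by (meson set_zip_rightD)
      have inj: "inj_on v F"
        using vp fam(3) unfolding pairwise_def inj_on_def by (metis disjoint_iff)
      let ?M = "{e \<in> N. src e \<in> A \<and> tgt e \<in> B}"
      have "v ` F \<subseteq> (V - (A \<union> B)) \<union> tgt ` ?M"
      proof
        fix w assume "w \<in> v ` F"
        then obtain p where p: "p \<in> F" "w = v p" by blast
        have e: "ea (u p, v p) \<in> E" "src (ea (u p, v p)) = u p" "tgt (ea (u p, v p)) = v p"
          using ea zipadj[of z p] ok uv p by blast+
        moreover have "ea (u p, v p) \<in> N" unfolding N_def using uv p by blast
        moreover have "w \<in> V" using e tgt_V p by metis
        ultimately show "w \<in> (V - (A \<union> B)) \<union> tgt ` ?M" using uv[OF p(1)] p(2) by (auto simp: image_iff)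
      qed
      hence "card (v ` F) \<le> card ((V - (A \<union> B)) \<union> tgt ` ?M)"
        using finV fN by (intro card_mono) auto
      also have "\<dots> \<le> card (V - (A \<union> B)) + card ?M"
        using card_Un_le[of "V - (A \<union> B)" "tgt ` ?M"] card_image_le[of ?M tgt] fN by fastforce
      finally show False using c card_image[OF inj] fam(2) unfolding cut_size_def by linarith
    qed
  qed
qed

text \<open>Otherwise delete a maximal family of short disjoint paths. A vertex \<open>i \<in> I1\<close> that is left
  dominates almost everything but its in-neighbours, and no out-neighbour of \<open>z\<close> can leave that
  set; so some out-neighbour outside \<open>I\<close> has smaller out-degree than \<open>i\<close>.\<close>

lemma fan:
  assumes I: "I \<subseteq> V" "card I \<le> 15 * k + 5 * D" "\<And>i v. i \<in> I \<Longrightarrow> v \<in> V - I \<Longrightarrow> deg V i \<le> deg V v"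
    and I1: "I1 \<subseteq> I" "3 * k \<le> card I1"
    and z: "z \<in> V" "24 * k + 7 * D \<le> deg V z" and k: "1 \<le> k"
  obtains N where "N \<subseteq> E" "card N \<le> 3 * k"
    "\<And>A B. rc A B \<Longrightarrow> z \<in> A \<Longrightarrow> ct N A B < k \<Longrightarrow> A \<inter> I1 \<noteq> {}"
proof -
  let ?adj = "\<lambda>u v. \<exists>e\<in>E. src e = u \<and> tgt e = v"
  define ok where "ok = {p. set p \<subseteq> V \<and> length p \<le> 3 \<and> p \<noteq> [] \<and>
      successively ?adj (z # p) \<and> last p \<in> I1}"
  have fok: "finite ok"
    unfolding ok_def by (rule finite_subset[OF _ finite_lists_length_le[OF finV, of 3]]) auto
  let ?Q = "\<lambda>F. F \<subseteq> ok \<and> pairwise (\<lambda>p q. set p \<inter> set q = {}) F"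
  have "\<exists>F. ?Q F \<and> (\<forall>F'. ?Q F' \<longrightarrow> card F' \<le> card F)"
  proof (rule ex_has_greatest_nat[where k = "{}" and b = "card ok + 1"])
    show "?Q {}" by simp
    show "\<forall>F. ?Q F \<longrightarrow> card F < card ok + 1" using card_mono[OF fok] by (auto simp: less_Suc_eq_le)
  qed
  then obtain F where F: "?Q F" and max: "\<And>F'. ?Q F' \<Longrightarrow> card F' \<le> card F" by blast
  have fF: "finite F" using F fok finite_subset by blast
  show ?thesis
  proof (cases "k \<le> card F")
    case True
    then obtain F' where F': "F' \<subseteq> F" "card F' = k" by (meson obtain_subset_with_card_n)
    show ?thesis
    proof (rule fan_of_paths[of z F' k 3 I1])
      show "pairwise (\<lambda>p q. set p \<inter> set q = {}) F'" using F F' pairwise_subset by blast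
      show "finite F'" using F' fF finite_subset by blast
    qed (use z F F' in \<open>auto simp: ok_def intro: that\<close>)
  next
    case False
    define del where "del = (\<Union>p\<in>F. set p)"
    have "card del \<le> (\<Sum>p\<in>F. card (set p))" unfolding del_def by (rule card_UN_le[OF fF])
    also have "\<dots> \<le> (\<Sum>p\<in>F. 3)"
    proof (rule sum_mono)
      fix p assume "p \<in> F"
      hence "length p \<le> 3" using F unfolding ok_def by auto
      thus "card (set p) \<le> 3" using card_length[of p] by linarith
    qed
    finally have cdel: "card del \<le> 3 * (k - 1)" using False by simp
    have fdel: "finite del" unfolding del_def using fF by simp
    have no: False if p: "p \<in> ok" "set p \<inter> del = {}" for p
    proof -
      have pF: "p \<notin> F"
      proof
        assume "p \<in> F"
        hence "set p \<subseteq> del" unfolding del_def by (rule UN_upper)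
        hence "set p = {}" using p(2) by (simp add: Int_absorb2)
        thus False using p(1) unfolding ok_def by simp
      qed
      have disj: "set p \<inter> set q = {}" if "q \<in> F" for q 
        using p(2) UN_upper[OF that, of set] unfolding del_def by (metis Int_mono subset_empty subset_refl)
      have "pairwise (\<lambda>p q. set p \<inter> set q = {}) (insert p F)"
        unfolding pairwise_insert using F disj by (simp add: Int_commute)
      moreover have "insert p F \<subseteq> ok" using F p(1) by simp
      ultimately have "card (insert p F) \<le> card F" using max by simp
      thus False using pF fF by simp
    qed
    \<comment> \<open>Fewer than \<open>k\<close> paths with at most three vertices each cannot use
      up \<open>3 * k\<close> vertices.\<close>
    have "\<not> I1 \<subseteq> del"
    proof
      assume "I1 \<subseteq> del"
      hence "card I1 \<le> card del" by (rule card_mono[OF fdel])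
      thus False using cdel I1(2) k by linarith
    qed
    then obtain i where i: "i \<in> I1" "i \<notin> del" by blast
    have iV: "i \<in> V" using i I1 I by auto
    define O1 where "O1 = {w \<in> V - del. R z w}"
    define W where "W = {w \<in> V - del - {i}. \<not> ?adj w i}"
    have fW: "finite W" "finite O1" unfolding W_def O1_def using finV by auto
    have zi: "\<not> ?adj z i" using no[of "[i]"] i iV unfolding ok_def by auto
    have adj: "?adj u v \<Longrightarrow> u \<in> V \<and> v \<in> V" for u v using src_V tgt_V by blast
    have Oi: "\<not> ?adj w i \<and> w \<noteq> i" if w: "w \<in> O1" for w
    proof
      show "\<not> ?adj w i"
      proof
        assume "?adj w i"
        hence "[w, i] \<in> ok" using R_arc[of z w] w i iV unfolding O1_def ok_def by auto
        thus False using no[of "[w, i]"] w i unfolding O1_def by auto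
      qed
      show "w \<noteq> i" using zi R_arc w unfolding O1_def by blast
    qed
    have OW: "O1 \<subseteq> W" using Oi unfolding O1_def W_def by auto
    \<comment> \<open>Otherwise \<open>w\<close> is an in-neighbour of \<open>i\<close>, and
      \<open>[x, w, i]\<close> extends the maximal family; this is the case that calls for paths of
      length three.\<close>
    have OO: "w \<in> W \<union> del" if o: "x \<in> O1" and "R x w" for x w
    proof (rule ccontr)
      assume c: "w \<notin> W \<union> del"
      have w: "w \<in> V" "w \<noteq> i" using R_V[OF that(2)] Oi[OF o] R_arc[OF that(2)] by blast+
      hence wi: "?adj w i" using c unfolding W_def by auto
      have "[x, w, i] \<in> ok" using R_arc[of z x] R_arc[OF that(2)] wi o w i iV unfolding O1_def ok_def by auto
      thus False using no[of "[x, w, i]"] o c i unfolding O1_def by auto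
    qed
    have "card W \<le> card {w \<in> W. R i w} + D"
      using iV R_arc by (intro dominates_non_in_nbrs) (auto simp: W_def)
    also have "card {w \<in> W. R i w} \<le> deg V i"
      unfolding deg_def W_def using finV by (intro card_mono) auto
    finally have Wi: "card W \<le> deg V i + D" by simp
    have "deg V z \<le> card (O1 \<union> del)"
      unfolding deg_def O1_def using fdel finV by (intro card_mono) auto
    hence O1: "deg V z \<le> card O1 + card del" using card_Un_le[of O1 del] by linarith
    define O2 where "O2 = O1 - I"
    have fO2: "finite O2" unfolding O2_def using fW by simp
    have "card O1 \<le> card (O2 \<union> I)" using fO2 I(1) finV finite_subset unfolding O2_def by (intro card_mono) auto
    \<comment> \<open>The degree \<open>24 * k + 7 * D\<close> of \<open>z\<close> pays for
      \<open>del\<close> and for the \<open>15 * k + 5 * D\<close> vertices of \<open>I\<close>; the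
      rest exceeds twice the loss \<open>D + 3 * (k - 1)\<close> in the comparison of
      \<open>x\<close> with \<open>i\<close>.\<close>
    hence O2: "6 * k + 2 * D + 3 \<le> card O2" using card_Un_le[of O2 I] O1 I(2) z(2) cdel k by linarith
    hence "O2 \<noteq> {}" by auto
    then obtain x where x: "x \<in> O2" "2 * deg O2 x + 1 \<le> card O2" using low_deg_member[OF fO2] by blast
    have "{w \<in> V. R x w} \<subseteq> {w \<in> O2. R x w} \<union> (W - O2) \<union> del"
      using OO x(1) unfolding O2_def by auto
    hence "deg V x \<le> card ({w \<in> O2. R x w} \<union> (W - O2) \<union> del)"
      unfolding deg_def using fO2 fW fdel by (intro card_mono) auto
    also have "\<dots> \<le> deg O2 x + card (W - O2) + card del"
      unfolding deg_def by (intro order_trans[OF card_Un_le] add_mono card_Un_le order_refl)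
    finally have "deg V x \<le> deg O2 x + card (W - O2) + card del" .
    moreover have "card (W - O2) + card O2 = card W"
      using OW fW fO2 unfolding O2_def by (metis Diff_subset card_Diff_subset card_mono le_add_diff_inverse2 order_trans)
    moreover have "deg V i \<le> deg V x" using I(3)[of i x] i I1 x unfolding O2_def O1_def by auto
    ultimately show ?thesis using Wi x(2) O2 cdel k by linarith
  qed
qed

end

section \<open>Weighted median orders\<close>

fun forward_weight :: "('a \<Rightarrow> 'a \<Rightarrow> bool) \<Rightarrow> ('a \<Rightarrow> nat) \<Rightarrow> 'a list \<Rightarrow> nat" where
  "forward_weight G f [] = 0"
| "forward_weight G f (x # xs) = f x * sum f {v \<in> set xs. G x v} + forward_weight G f xs"

definition median_order :: "('a \<Rightarrow> 'a \<Rightarrow> bool) \<Rightarrow> ('a \<Rightarrow> nat) \<Rightarrow> 'a set \<Rightarrow> 'a list \<Rightarrow> bool" where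
  "median_order G f U L \<longleftrightarrow> distinct L \<and> set L = U \<and>
     (\<forall>L'. distinct L' \<longrightarrow> set L' = U \<longrightarrow> forward_weight G f L' \<le> forward_weight G f L)"

definition before :: "'a list \<Rightarrow> 'a \<Rightarrow> 'a \<Rightarrow> bool" where
  "before L u v \<longleftrightarrow> (\<exists>xs ys zs. L = xs @ u # ys @ v # zs)"

lemma before_rev: "before (rev L) u v \<longleftrightarrow> before L v u"
proof -
  have *: "before (rev L) u v" if "before L v u" for L :: "'a list" and u v
  proof -
    obtain xs ys zs where "L = xs @ v # ys @ u # zs" using \<open>before L v u\<close> unfolding before_def by blast
    hence "rev L = rev zs @ u # rev ys @ v # rev xs" by simp
    thus ?thesis unfolding before_def by blast
  qed
  show ?thesis using *[of L v u] *[of "rev L" u v] by auto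
qed

lemma before_append: "distinct (xs @ u # zs) \<Longrightarrow> before (xs @ u # zs) u v \<longleftrightarrow> v \<in> set zs"
proof
  assume d: "distinct (xs @ u # zs)" and "before (xs @ u # zs) u v"
  then obtain xs' ys' zs' where eq: "xs @ u # zs = xs' @ u # ys' @ v # zs'" unfolding before_def by blast
  have "zs = ys' @ v # zs'"
    using d eq by (metis append_Cons_eq_iff distinct.simps(2) distinct_append not_distinct_conv_prefix
      distinct_append insert_iff list.set(2) disjoint_iff)
  thus "v \<in> set zs" by simp
next
  assume "v \<in> set zs"
  thus "before (xs @ u # zs) u v" unfolding before_def using split_list by fastforce
qed

lemma before_set: "before L u v \<Longrightarrow> u \<in> set L \<and> v \<in> set L"
  unfolding before_def by auto

lemma last_in_order:
  assumes "distinct L" "A \<subseteq> set L" "A \<noteq> {}"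
  obtains a where "a \<in> A" "\<And>v. before L a v \<Longrightarrow> v \<notin> A"
proof -
  have "\<exists>x\<in>set L. x \<in> A" using assms by auto
  then obtain ys a zs where "L = ys @ a # zs" "a \<in> A" "\<forall>z\<in>set zs. z \<notin> A"
    by (rule split_list_last_propE) blast
  thus ?thesis using assms(1) before_append[of ys a zs] that by blast
qed

lemma forward_weight_append:
  assumes "distinct (xs @ ys)"
  shows "forward_weight G f (xs @ ys) = forward_weight G f xs + forward_weight G f ys
     + (\<Sum>x\<in>set xs. f x * sum f {v \<in> set ys. G x v})"
  using assms
proof (induction xs)
  case (Cons a xs)
  have "{v \<in> set (xs @ ys). G a v} = {v \<in> set xs. G a v} \<union> {v \<in> set ys. G a v}" by auto
  moreover have "{v \<in> set xs. G a v} \<inter> {v \<in> set ys. G a v} = {}" using Cons.prems by auto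
  ultimately have "sum f {v \<in> set (xs @ ys). G a v} = sum f {v \<in> set xs. G a v} + sum f {v \<in> set ys. G a v}"
    by (simp add: sum.union_disjoint)
  thus ?case using Cons by (simp add: algebra_simps)
qed simp

lemma weighted_column: 
  assumes "finite S" shows "(\<Sum>x\<in>S. f x * sum f {v \<in> {u}. G x v}) = (f u :: nat) * sum f {x \<in> S. G x u}"
proof -
  have "(\<Sum>x\<in>S. f x * sum f {v \<in> {u}. G x v}) = (\<Sum>x\<in>S. if G x u then f u * f x else 0)"
  proof (rule sum.cong[OF refl])
    fix x
    have "{v \<in> {u}. G x v} = (if G x u then {u} else {})" by auto
    thus "f x * sum f {v \<in> {u}. G x v} = (if G x u then f u * f x else 0)" by simp
  qed
  also have "\<dots> = f u * sum f {x \<in> S. G x u}"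
    using assms by (simp add: sum.inter_filter[symmetric] sum_distrib_left)
  finally show ?thesis .
qed

lemma forward_weight_rev: "distinct L \<Longrightarrow> forward_weight (\<lambda>u v. G v u) f (rev L) = forward_weight G f L"
proof (induction L)
  case (Cons a L)
  have "forward_weight (\<lambda>u v. G v u) f (rev L @ [a]) = forward_weight (\<lambda>u v. G v u) f (rev L)
     + (\<Sum>x\<in>set L. f x * sum f {v \<in> {a}. G v x})"
    using Cons.prems by (subst forward_weight_append) auto
  thus ?case using Cons weighted_column[of "set L" f a "\<lambda>x v. G v x"] by simp
qed simp

lemma median_order_rev:
  assumes "median_order G f U L" shows "median_order (\<lambda>u v. G v u) f U (rev L)"
  unfolding median_order_def
proof (intro conjI allI impI)
  fix L' assume L': "distinct L'" "set L' = U"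
  have "forward_weight (\<lambda>u v. G v u) f L' = forward_weight G f (rev L')"
    using forward_weight_rev[of "rev L'" G f] L' by simp
  also have "\<dots> \<le> forward_weight G f L" using assms L' unfolding median_order_def by simp
  also have "\<dots> = forward_weight (\<lambda>u v. G v u) f (rev L)"
    using forward_weight_rev[of L G f] assms unfolding median_order_def by simp
  finally show "forward_weight (\<lambda>u v. G v u) f L' \<le> forward_weight (\<lambda>u v. G v u) f (rev L)" .
qed (use assms in \<open>auto simp: median_order_def\<close>)

lemma median_order_exists:
  assumes "finite U" obtains L where "median_order G f U L"
proof -
  define \<L> where "\<L> = {L. distinct L \<and> set L = U}"
  have "\<L> \<subseteq> {L. set L \<subseteq> U \<and> length L \<le> card U}" unfolding \<L>_def by (auto simp: distinct_card[symmetric])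
  hence fin: "finite (forward_weight G f ` \<L>)"
    using finite_lists_length_le[OF assms] finite_subset by blast
  have "\<L> \<noteq> {}" using finite_distinct_list[OF assms] unfolding \<L>_def by blast
  then obtain L where "L \<in> \<L>" "forward_weight G f L = Max (forward_weight G f ` \<L>)"
    using Max_in[OF fin] by (metis (mono_tags, lifting) image_iff image_is_empty)
  hence "median_order G f U L"
    using Max_ge[OF fin] unfolding median_order_def \<L>_def by auto
  thus ?thesis by (rule that)
qed

text \<open>Moving \<open>u\<close> behind the block \<open>ys\<close> affects only the pairs of
  \<open>u\<close> with \<open>ys\<close>, and all of these carry the factor \<open>f u\<close>,
  which cancels.\<close>

lemma median_out:
  assumes "median_order G f U (xs @ u # ys @ zs)" "0 < f u"
  shows "sum f {v \<in> set ys. G v u} \<le> sum f {v \<in> set ys. G u v}"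
proof -
  have d: "distinct (xs @ u # ys @ zs)" and s: "set (xs @ u # ys @ zs) = U"
    using assms unfolding median_order_def by auto
  have "forward_weight G f (xs @ (ys @ [u]) @ zs) \<le> forward_weight G f (xs @ (u # ys) @ zs)"
    using assms(1) unfolding median_order_def by (auto simp: Un_commute)
  moreover have "forward_weight G f (xs @ (ys @ [u]) @ zs) = forward_weight G f xs
      + (forward_weight G f (ys @ [u]) + forward_weight G f zs
        + (\<Sum>x\<in>insert u (set ys). f x * sum f {v \<in> set zs. G x v}))
      + (\<Sum>x\<in>set xs. f x * sum f {v \<in> insert u (set ys) \<union> set zs. G x v})"
    using d by (subst forward_weight_append, force, subst forward_weight_append, force) simp
  moreover have "forward_weight G f (xs @ (u # ys) @ zs) = forward_weight G f xs
      + (forward_weight G f (u # ys) + forward_weight G f zs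
        + (\<Sum>x\<in>insert u (set ys). f x * sum f {v \<in> set zs. G x v}))
      + (\<Sum>x\<in>set xs. f x * sum f {v \<in> insert u (set ys) \<union> set zs. G x v})"
    using d by (subst forward_weight_append, force, subst forward_weight_append, force) simp
  ultimately have "forward_weight G f (ys @ [u]) \<le> forward_weight G f (u # ys)" by linarith
  moreover have "forward_weight G f (ys @ [u]) = forward_weight G f ys + f u * sum f {x \<in> set ys. G x u}"
    using d weighted_column[of "set ys" f u G] by (subst forward_weight_append) auto
  ultimately have "f u * sum f {x \<in> set ys. G x u} \<le> f u * sum f {v \<in> set ys. G u v}" by simp
  thus ?thesis using assms(2) by simp
qed

lemma median_in:
  assumes "median_order G f U (xs @ ys @ u # zs)" "0 < f u"
  shows "sum f {v \<in> set ys. G u v} \<le> sum f {v \<in> set ys. G v u}"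
  using median_out[of "\<lambda>u v. G v u" f U "rev zs" u "rev ys" "rev xs"] median_order_rev[OF assms(1)] assms(2)
  by simp

text \<open>The min-cut condition for a subset of \<open>F\<close> with at least
  \<open>sum f U - \<delta>\<close> elements and out- and in-degrees at most \<open>f\<close>. In
  the bipartite network of tails and heads, whose source and sink arcs have capacity
  \<open>f\<close>, the cut given by \<open>X\<close> and \<open>Y\<close> has capacity
  \<open>sum f (U - X) + sum f (U - Y)\<close> plus the number of arcs from \<open>X\<close> to
  \<open>Y\<close>.\<close>

definition demand_cover ::
  "('e \<Rightarrow> 'a) \<Rightarrow> ('e \<Rightarrow> 'a) \<Rightarrow> ('a \<Rightarrow> nat) \<Rightarrow> 'a set \<Rightarrow> nat \<Rightarrow> 'e set \<Rightarrow> bool" where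
  "demand_cover s t f U \<delta> F \<longleftrightarrow>
    (\<forall>X\<subseteq>U. \<forall>Y\<subseteq>U. sum f X + sum f Y \<le> sum f U + \<delta> + card {e \<in> F. s e \<in> X \<and> t e \<in> Y})"

lemma demand_cover_swap: "demand_cover s t f U \<delta> F \<Longrightarrow> demand_cover t s f U \<delta> F"
  unfolding demand_cover_def
proof (intro allI impI)
  fix X Y assume a: "\<forall>X\<subseteq>U. \<forall>Y\<subseteq>U. sum f X + sum f Y \<le> sum f U + \<delta> + card {e \<in> F. s e \<in> X \<and> t e \<in> Y}"
    and "X \<subseteq> U" "Y \<subseteq> U"
  hence "sum f Y + sum f X \<le> sum f U + \<delta> + card {e \<in> F. s e \<in> Y \<and> t e \<in> X}" by blast
  thus "sum f X + sum f Y \<le> sum f U + \<delta> + card {e \<in> F. t e \<in> X \<and> s e \<in> Y}"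
    by (simp add: conj_commute add.commute)
qed

text \<open>Same uncrossing as for rectangles; removing \<open>u\<close> from a tight pair containing all arcs
  leaving \<open>u\<close> lowers the demand by \<open>f u\<close> only.\<close>

lemma minimal_cover_degree:
  assumes F: "finite F" "demand_cover s t f U \<delta> F" "\<And>e. e \<in> F \<Longrightarrow> \<not> demand_cover s t f U \<delta> (F - {e})"
    and U: "finite U"
  shows "card {e \<in> F. s e = u} \<le> f u"
proof (cases "{e \<in> F. s e = u} = {}")
  case False
  define T where "T X Y \<longleftrightarrow> X \<subseteq> U \<and> Y \<subseteq> U \<and> u \<in> X \<and>
     sum f X + sum f Y = sum f U + \<delta> + card {e \<in> F. s e \<in> X \<and> t e \<in> Y}" for X Y
  have ex: "\<exists>X Y. T X Y \<and> t e \<in> Y" if e: "e \<in> F" "s e = u" for e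
  proof -
    obtain X Y where XY: "X \<subseteq> U" "Y \<subseteq> U"
      "sum f U + \<delta> + card {x \<in> F - {e}. s x \<in> X \<and> t x \<in> Y} < sum f X + sum f Y"
      using F(3)[OF e(1)] unfolding demand_cover_def by (auto simp: not_le)
    have ge: "sum f X + sum f Y \<le> sum f U + \<delta> + card {x \<in> F. s x \<in> X \<and> t x \<in> Y}"
      using F(2) XY unfolding demand_cover_def by blast
    have "s e \<in> X \<and> t e \<in> Y"
    proof (rule ccontr)
      assume "\<not> ?thesis"
      hence "{x \<in> F - {e}. s x \<in> X \<and> t x \<in> Y} = {x \<in> F. s x \<in> X \<and> t x \<in> Y}" by auto
      thus False using ge XY(3) by simp
    qed
    moreover have "card {x \<in> F. s x \<in> X \<and> t x \<in> Y} \<le> card (insert e {x \<in> F - {e}. s x \<in> X \<and> t x \<in> Y})"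
      using F(1) by (intro card_mono) auto
    hence "card {x \<in> F. s x \<in> X \<and> t x \<in> Y} \<le> card {x \<in> F - {e}. s x \<in> X \<and> t x \<in> Y} + 1"
      using F(1) by (simp add: card_insert_if)
    ultimately show ?thesis unfolding T_def using XY ge e by (intro exI[of _ X] exI[of _ Y]) auto
  qed
  have un: "T (X \<inter> X') (Y \<union> Y')" if a: "T X Y" "T X' Y'" for X Y X' Y'
  proof -
    have fin: "finite X" "finite Y" "finite X'" "finite Y'"
      using a U finite_subset unfolding T_def by auto
    have s: "sum f (X \<union> X') + sum f (X \<inter> X') = sum f X + sum f X'"
      "sum f (Y \<union> Y') + sum f (Y \<inter> Y') = sum f Y + sum f Y'"
      using fin by (simp_all add: sum.union_inter)
    have c: "sum f (X \<inter> X') + sum f (Y \<union> Y') \<le> sum f U + \<delta> + card {e \<in> F. s e \<in> X \<inter> X' \<and> t e \<in> Y \<union> Y'}"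
      "sum f (X \<union> X') + sum f (Y \<inter> Y') \<le> sum f U + \<delta> + card {e \<in> F. s e \<in> X \<union> X' \<and> t e \<in> Y \<inter> Y'}"
      using F(2) a unfolding demand_cover_def T_def by (meson Int_lower1 Un_least order_trans)+
    show ?thesis
      using a s c card_arcs_uncross[OF F(1), of s X X' t Y Y'] unfolding T_def by auto
  qed
  from False obtain e0 where "e0 \<in> F" "s e0 = u" by blast
  from ex[OF this] obtain X0 Y0 where "T X0 Y0" by blast
  define S where "S = {(X, Y). T X Y}"
  have "S \<subseteq> Pow U \<times> Pow U" unfolding S_def T_def by auto
  hence fS: "finite S" using U by (meson finite_Pow_iff finite_SigmaI finite_subset)
  have "card ` snd ` S \<noteq> {}" "finite (card ` snd ` S)" using \<open>T X0 Y0\<close> fS unfolding S_def by auto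
  then have "Max (card ` snd ` S) \<in> card ` snd ` S" by (intro Max_in)
  then obtain p where "p \<in> S" "card (snd p) = Max (card ` snd ` S)" by auto
  then obtain X Y where XY: "T X Y" and m: "card Y = Max (card ` snd ` S)"
    unfolding S_def by (cases p) auto
  have mx: "card Y' \<le> card Y" if "T X' Y'" for X' Y'
    unfolding m using that fS unfolding S_def by (intro Max_ge) force+
  have all: "t e \<in> Y" if "e \<in> F" "s e = u" for e
  proof -
    obtain X' Y' where X': "T X' Y'" "t e \<in> Y'" using ex[OF \<open>e \<in> F\<close> \<open>s e = u\<close>] by blast
    have "card (Y \<union> Y') \<le> card Y" by (rule mx[OF un[OF XY X'(1)]])
    moreover have "finite (Y \<union> Y')" using XY X' U finite_subset unfolding T_def by auto
    ultimately show ?thesis using X'(2) card_seteq[of "Y \<union> Y'" Y] by auto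
  qed
  have "{e \<in> F. s e \<in> X \<and> t e \<in> Y} = {e \<in> F. s e \<in> X - {u} \<and> t e \<in> Y} \<union> {e \<in> F. s e = u}"
    using all XY unfolding T_def by auto
  moreover have "{e \<in> F. s e \<in> X - {u} \<and> t e \<in> Y} \<inter> {e \<in> F. s e = u} = {}" by auto
  ultimately have c: "card {e \<in> F. s e \<in> X \<and> t e \<in> Y}
      = card {e \<in> F. s e \<in> X - {u} \<and> t e \<in> Y} + card {e \<in> F. s e = u}"
    using F(1) by (simp add: card_Un_disjoint)
  have "X - {u} \<subseteq> U" "Y \<subseteq> U" using XY unfolding T_def by auto
  hence "sum f (X - {u}) + sum f Y \<le> sum f U + \<delta> + card {e \<in> F. s e \<in> X - {u} \<and> t e \<in> Y}"
    using F(2) unfolding demand_cover_def by blast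
  moreover have "sum f X = f u + sum f (X - {u})"
    using XY U finite_subset unfolding T_def by (intro sum.remove) auto
  ultimately show ?thesis using c XY unfolding T_def by linarith
qed (simp only: card.empty le0)

text \<open>Inclusion-minimality takes the place of max-flow min-cut: a minimal covering set has
  degrees at most \<open>f\<close>, and the pair \<open>X = Y = U\<close> gives its size.\<close>

lemma near_factor:
  assumes "finite E" "finite U" "demand_cover s t f U \<delta> E" "\<And>e. e \<in> E \<Longrightarrow> s e \<in> U \<and> t e \<in> U"
  obtains F where "F \<subseteq> E" "\<And>u. card {e \<in> F. s e = u} \<le> f u" "\<And>u. card {e \<in> F. t e = u} \<le> f u"
    "sum f U \<le> card F + \<delta>"
proof -
  define \<F> where "\<F> = {F. F \<subseteq> E \<and> demand_cover s t f U \<delta> F}"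
  have "finite \<F>" "\<F> \<noteq> {}" using assms unfolding \<F>_def by auto
  then obtain F where F: "F \<in> \<F>" and min: "\<And>F'. F' \<in> \<F> \<Longrightarrow> F' \<subseteq> F \<Longrightarrow> F' = F"
    using finite_has_minimal[of \<F>] by blast
  have fin: "finite F" and cov: "demand_cover s t f U \<delta> F" and FE: "F \<subseteq> E"
    using F assms(1) finite_subset unfolding \<F>_def by auto
  have crit: "\<not> demand_cover s t f U \<delta> (F - {e})" if "e \<in> F" for e
  proof
    assume "demand_cover s t f U \<delta> (F - {e})"
    hence "F - {e} \<in> \<F>" using FE unfolding \<F>_def by auto
    from min[OF this] show False using that by auto
  qed
  have "sum f U + sum f U \<le> sum f U + \<delta> + card {e \<in> F. s e \<in> U \<and> t e \<in> U}"
    using cov unfolding demand_cover_def by blast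
  moreover have "{e \<in> F. s e \<in> U \<and> t e \<in> U} = F" using assms(4) FE by auto
  ultimately have "sum f U \<le> card F + \<delta>" by simp
  moreover have "card {e \<in> F. t e = u} \<le> f u" for u
    by (rule minimal_cover_degree[OF fin demand_cover_swap[OF cov] _ assms(2)])
      (use crit demand_cover_swap in blast)
  ultimately show ?thesis
    using that[of F] FE minimal_cover_degree[OF fin cov crit assms(2)] by blast
qed

lemma sum_Un_nat_le:
  fixes f :: "'a \<Rightarrow> nat"
  assumes "finite A" "finite B" shows "sum f (A \<union> B) \<le> sum f A + sum f B"
  using sum.union_inter[OF assms, of f] by linarith

text \<open>For \<open>W = X \<inter> Y\<close> the inequality says that the weight of \<open>W\<close> is at most that of the
  complement of \<open>X \<union> Y\<close> up to the number of arcs and an error. Vertices of \<open>W\<close> incident with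
  many of the counted arcs pay for themselves; the median property is applied to the interval
  between the first and the last of the others.\<close>

lemma median_demand:
  fixes f :: "'a \<Rightarrow> nat"
  assumes L: "median_order G f U L"
    and f: "\<And>v. v \<in> U \<Longrightarrow> 0 < f v \<and> f v \<le> k"
    and D: "\<And>v. v \<in> U \<Longrightarrow> card {w \<in> U - {v}. \<not> G v w \<and> \<not> G w v} \<le> D"
  shows "demand_cover fst snd f U (k * D + 4 * k * k) {(u, v). before L u v \<and> G u v}"
  unfolding demand_cover_def
proof (intro allI impI)
  fix X Y assume XU: "X \<subseteq> U" and YU: "Y \<subseteq> U"
  define H where "H = {(u, v). before L u v \<and> G u v}"
  have dL: "distinct L" and sL: "set L = U" using L unfolding median_order_def by auto
  have fU: "finite U" using sL by auto
  have HU: "H \<subseteq> U \<times> U" unfolding H_def using before_set sL by fast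
  have fH: "finite H" using HU fU finite_subset by blast
  have fin: "finite A" if "A \<subseteq> U" for A using that fU finite_subset by blast
  define e where "e = card {p \<in> H. fst p \<in> X \<and> snd p \<in> Y}"
  define eo where "eo w = card {p \<in> H. fst p = w \<and> snd p \<in> Y}" for w
  define ei where "ei w = card {p \<in> H. snd p = w \<and> fst p \<in> X}" for w
  define W where "W = X \<inter> Y"
  define Z where "Z = U - (X \<union> Y)"
  have WU: "W \<subseteq> U" using XU unfolding W_def by auto
  have so: "sum eo A \<le> e" if "A \<subseteq> W" for A
  proof -
    have "sum eo A = card (\<Union>w\<in>A. {p \<in> H. fst p = w \<and> snd p \<in> Y})"
      unfolding eo_def using that WU fin[of A] fH by (subst card_UN_disjoint) auto
    also have "\<dots> \<le> e" unfolding e_def using that fH by (intro card_mono) (auto simp: W_def)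
    finally show ?thesis .
  qed
  have si: "sum ei A \<le> e" if "A \<subseteq> W" for A
  proof -
    have "sum ei A = card (\<Union>w\<in>A. {p \<in> H. snd p = w \<and> fst p \<in> X})"
      unfolding ei_def using that WU fin[of A] fH by (subst card_UN_disjoint) auto
    also have "\<dots> \<le> e" unfolding e_def using that fH by (intro card_mono) (auto simp: W_def)
    finally show ?thesis .
  qed
  \<comment> \<open>An arc contributes at most once to the sum of \<open>eo\<close> and at most once
    to that of \<open>ei\<close>. So the excluded vertices, with
    \<open>eo w + ei w \<ge> 2 * f w\<close>, have total weight at most \<open>e\<close>.\<close>
  define W' where "W' = {w \<in> W. eo w < 2 * f w \<and> ei w < 2 * f w}"
  have pay: "sum f A \<le> e" if "A \<subseteq> W - W'" for A
  proof -
    have "2 * sum f A = (\<Sum>w\<in>A. 2 * f w)" by (simp add: sum_distrib_left)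
    also have "\<dots> \<le> (\<Sum>w\<in>A. eo w + ei w)" using that unfolding W'_def by (intro sum_mono) fastforce
    also have "\<dots> = sum eo A + sum ei A" by (rule sum.distrib)
    finally have "2 * sum f A \<le> sum eo A + sum ei A" .
    moreover have "A \<subseteq> W" using that by blast
    ultimately show ?thesis using so[of A] si[of A] by linarith
  qed
  have main: "sum f W \<le> sum f Z + e + (k * D + 4 * k * k)"
  proof (cases "W' = {}")
    case True
    thus ?thesis using pay[of W] by simp
  next
    case False
    hence "\<exists>x\<in>set L. x \<in> W'" using WU sL unfolding W'_def by auto
    then obtain xs w1 r where L1: "L = xs @ w1 # r" "w1 \<in> W'" "\<forall>x\<in>set xs. x \<notin> W'"
      by (rule split_list_first_propE) blast
    have w1: "w1 \<in> W" "w1 \<in> U" "0 < f w1" "f w1 \<le> k" "eo w1 < 2 * f w1"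
      using L1(2) WU f unfolding W'_def by auto
    show ?thesis
    proof (cases "\<exists>x\<in>set r. x \<in> W'")
      case False
      have "W' \<subseteq> {w1}"
      proof
        fix x assume x: "x \<in> W'"
        hence "x \<in> set L" using WU sL unfolding W'_def by auto
        thus "x \<in> {w1}" using L1 False x by auto
      qed
      hence "W - {w1} \<subseteq> W - W'" by blast
      hence "sum f (W - {w1}) \<le> e" by (rule pay)
      moreover have "sum f W = f w1 + sum f (W - {w1})"
        using w1 fin[OF WU] by (intro sum.remove) auto
      moreover have "k \<le> k * k" by simp
      ultimately show ?thesis using w1 by linarith
    next
      case True
      then obtain ys w2 zs where L2: "r = ys @ w2 # zs" "w2 \<in> W'" "\<forall>x\<in>set zs. x \<notin> W'"
        by (rule split_list_last_propE) blast
      have w2: "w2 \<in> W" "w2 \<in> U" "0 < f w2" "f w2 \<le> k" "ei w2 < 2 * f w2"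
        using L2(2) WU f unfolding W'_def by auto
      define M where "M = set ys"
      have MU: "M \<subseteq> U" using sL L1 L2 unfolding M_def by auto
      have dist: "w1 \<notin> M" "w2 \<notin> M" "w1 \<noteq> w2" using dL L1 L2 unfolding M_def by auto
      have Lw: "L = xs @ w1 # (ys @ [w2]) @ zs" "L = xs @ (w1 # ys) @ w2 # zs" using L1 L2 by auto
      have bef: "before L w1 v" if "v \<in> insert w2 M" for v
        using that before_append[of xs w1 "(ys @ [w2]) @ zs" v] dL Lw(1) unfolding M_def by auto
      have bef': "before L v w2" if "v \<in> insert w1 M" for v
      proof -
        from that have "v \<in> set (w1 # ys)" unfolding M_def by auto
        then obtain a b where "w1 # ys = a @ v # b" using split_list by fast
        hence "L = (xs @ a) @ v # b @ w2 # zs" using Lw(2) by simp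
        thus ?thesis unfolding before_def by blast
      qed
      have non: "sum f A \<le> sum f {v \<in> A. G w v} + sum f {v \<in> A. G v w} + k * D"
        if A: "A \<subseteq> U - {w}" "w \<in> U" for A w
      proof -
        let ?N = "{v \<in> A. \<not> G w v \<and> \<not> G v w}"
        have fA: "finite A" using A fin[of A] by auto
        have "sum f A \<le> sum f ({v \<in> A. G w v} \<union> {v \<in> A. G v w} \<union> ?N)"
          using fA by (intro sum_mono2) auto
        also have "\<dots> \<le> sum f {v \<in> A. G w v} + sum f {v \<in> A. G v w} + sum f ?N"
          using fA by (intro order_trans[OF sum_Un_nat_le] add_mono order_refl) auto
        also have "sum f ?N \<le> card ?N * k"
          using f A sum_bounded_above[of ?N f k] by auto
        also have "card ?N \<le> D"
          using card_mono[of "{v \<in> U - {w}. \<not> G w v \<and> \<not> G v w}" ?N] D[OF A(2)] fU A(1) by fastforce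
        finally show ?thesis by (simp add: mult.commute)
      qed
      have part: "sum f {v \<in> A. Q v} \<le> sum f (A - T) + c * k"
        if "finite A" "A \<subseteq> U" "card {v \<in> A. Q v \<and> v \<in> T} \<le> c" for A Q T c
      proof -
        have "sum f {v \<in> A. Q v} \<le> sum f ((A - T) \<union> {v \<in> A. Q v \<and> v \<in> T})"
          using that by (intro sum_mono2) auto
        also have "\<dots> \<le> sum f (A - T) + sum f {v \<in> A. Q v \<and> v \<in> T}"
          using that by (intro sum_Un_nat_le) auto
        also have "sum f {v \<in> A. Q v \<and> v \<in> T} \<le> card {v \<in> A. Q v \<and> v \<in> T} * k"
          using f that(2) sum_bounded_above[of "{v \<in> A. Q v \<and> v \<in> T}" f k] by auto
        also have "\<dots> \<le> c * k" using that(3) by simp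
        finally show ?thesis by simp
      qed
      \<comment> \<open>By the median property at \<open>w1\<close>, half the weight of the block,
        up to the non-neighbours, lies on out-neighbours of \<open>w1\<close>, and fewer than 2k of
        these are in \<open>Y\<close> because \<open>w1 \<in> W'\<close>. The bound
        \<open>2 * k - 1\<close> leaves a spare 2k on the left, which later covers \<open>w1\<close>
        and \<open>w2\<close> themselves.\<close>
      have s1: "sum f M + f w2 + 2 * k \<le> 2 * sum f (M - Y) + k * D + 4 * k * k"
      proof -
        let ?A = "insert w2 M"
        have A: "?A \<subseteq> U - {w1}" "finite ?A" using MU w2 dist fin[of M] by auto
        have "sum f {v \<in> ?A. G v w1} \<le> sum f {v \<in> ?A. G w1 v}"
          using median_out[of G f U xs w1 "ys @ [w2]" zs] L Lw(1) w1 unfolding M_def by simp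
        with non[OF A(1) w1(2)] have 1: "sum f ?A \<le> 2 * sum f {v \<in> ?A. G w1 v} + k * D" by simp
        have "card {v \<in> ?A. G w1 v \<and> v \<in> Y} \<le> eo w1"
        proof -
          have "inj_on (Pair w1) {v \<in> ?A. G w1 v \<and> v \<in> Y}" by (auto simp: inj_on_def)
          moreover have "Pair w1 ` {v \<in> ?A. G w1 v \<and> v \<in> Y} \<subseteq> {p \<in> H. fst p = w1 \<and> snd p \<in> Y}"
            using bef unfolding H_def by auto
          ultimately show ?thesis unfolding eo_def using fH by (intro card_inj_on_le) auto
        qed
        hence "card {v \<in> ?A. G w1 v \<and> v \<in> Y} \<le> 2 * k - 1" using w1 by linarith
        with part[of ?A "G w1" Y "2 * k - 1"] A
        have "sum f {v \<in> ?A. G w1 v} \<le> sum f (?A - Y) + (2 * k - 1) * k" by blast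
        moreover have "?A - Y = M - Y" using w2(1) unfolding W_def by auto
        moreover have "(2 * k - 1) * k + k = 2 * k * k" using w1 by (cases k) (auto simp: algebra_simps)
        moreover have "sum f ?A = f w2 + sum f M" using dist fin[OF MU] by simp
        ultimately show ?thesis using 1 by simp
      qed
      have s2: "sum f M + f w1 + 2 * k \<le> 2 * sum f (M - X) + k * D + 4 * k * k"
      proof -
        let ?A = "insert w1 M"
        have A: "?A \<subseteq> U - {w2}" "finite ?A" using MU w1 dist fin[of M] by auto
        have "sum f {v \<in> ?A. G w2 v} \<le> sum f {v \<in> ?A. G v w2}"
          using median_in[of G f U xs "w1 # ys" w2 zs] L Lw(2) w2 unfolding M_def by simp
        with non[OF A(1) w2(2)] have 1: "sum f ?A \<le> 2 * sum f {v \<in> ?A. G v w2} + k * D" by simp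
        have "card {v \<in> ?A. G v w2 \<and> v \<in> X} \<le> ei w2"
        proof -
          have "inj_on (\<lambda>v. (v, w2)) {v \<in> ?A. G v w2 \<and> v \<in> X}" by (auto simp: inj_on_def)
          moreover have "(\<lambda>v. (v, w2)) ` {v \<in> ?A. G v w2 \<and> v \<in> X} \<subseteq> {p \<in> H. snd p = w2 \<and> fst p \<in> X}"
            using bef' unfolding H_def by auto
          ultimately show ?thesis unfolding ei_def using fH by (intro card_inj_on_le) auto
        qed
        hence "card {v \<in> ?A. G v w2 \<and> v \<in> X} \<le> 2 * k - 1" using w2 by linarith
        with part[of ?A "\<lambda>v. G v w2" X "2 * k - 1"] A
        have "sum f {v \<in> ?A. G v w2} \<le> sum f (?A - X) + (2 * k - 1) * k" by blast
        moreover have "?A - X = M - X" using w1(1) unfolding W_def by auto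
        moreover have "(2 * k - 1) * k + k = 2 * k * k" using w1 by (cases k) (auto simp: algebra_simps)
        moreover have "sum f ?A = f w1 + sum f M" using dist fin[OF MU] by simp
        ultimately show ?thesis using 1 by simp
      qed
      have fM: "finite M" using fin[OF MU] .
      have "sum f (M - Y) + sum f (M - X) + sum f (M \<inter> W) = sum f M + sum f (M - (X \<union> Y))"
      proof -
        have "sum f M = sum f (M \<inter> Y) + sum f (M - Y)" using fM by (rule sum.Int_Diff)
        moreover have "sum f (M \<inter> Y) = sum f (M \<inter> Y \<inter> X) + sum f (M \<inter> Y - X)"
          using fM by (intro sum.Int_Diff) auto
        moreover have "sum f (M - X) = sum f ((M - X) \<inter> Y) + sum f (M - X - Y)"
          using fM by (intro sum.Int_Diff) auto
        moreover have "M \<inter> Y \<inter> X = M \<inter> W" "M \<inter> Y - X = (M - X) \<inter> Y" "M - X - Y = M - (X \<union> Y)"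
          unfolding W_def by auto
        ultimately show ?thesis by simp
      qed
      moreover have "sum f (M - (X \<union> Y)) \<le> sum f Z"
        using MU fU unfolding Z_def by (intro sum_mono2) auto
      moreover have "sum f W \<le> sum f (M \<inter> W) + f w1 + f w2 + e"
      proof -
        have sub: "W - (M \<union> {w1, w2}) \<subseteq> W - W'"
        proof
          fix x assume x: "x \<in> W - (M \<union> {w1, w2})"
          hence "x \<in> set xs \<or> x \<in> set zs" using WU sL Lw(1) unfolding M_def by auto
          thus "x \<in> W - W'" using x L1(3) L2(3) by auto
        qed
        have "sum f W \<le> sum f ((M \<inter> W) \<union> {w1, w2} \<union> (W - (M \<union> {w1, w2})))"
          using fM fin[OF WU] by (intro sum_mono2) auto
        also have "\<dots> \<le> sum f (M \<inter> W) + sum f {w1, w2} + sum f (W - (M \<union> {w1, w2}))"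
          using fM fin[OF WU] by (intro order_trans[OF sum_Un_nat_le] add_mono order_refl) auto
        finally show ?thesis using pay[OF sub] dist(3) by simp
      qed
      ultimately show ?thesis using s1 s2 w1 w2 by linarith
    qed
  qed
  have "sum f X + sum f Y = sum f (X \<union> Y) + sum f W"
    unfolding W_def using fin[OF XU] fin[OF YU] by (rule sum.union_inter[symmetric])
  moreover have "sum f U = sum f (X \<union> Y) + sum f Z"
    unfolding Z_def using XU YU fU sum.subset_diff[of "X \<union> Y" U f] by simp
  ultimately show "sum f X + sum f Y \<le> sum f U + (k * D + 4 * k * k)
      + card {e \<in> {(u, v). before L u v \<and> G u v}. fst e \<in> X \<and> snd e \<in> Y}"
    using main unfolding e_def H_def by linarith
qed

section \<open>The skeleton\<close>

lemma before_Cons: "before (a # L) u v \<longleftrightarrow> a = u \<and> v \<in> set L \<or> before L u v"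
proof
  assume "before (a # L) u v"
  then obtain xs ys zs where eq: "a # L = xs @ u # ys @ v # zs" unfolding before_def by blast
  show "a = u \<and> v \<in> set L \<or> before L u v"
  proof (cases xs)
    case Nil
    thus ?thesis using eq by auto
  next
    case (Cons b xs')
    hence "L = xs' @ u # ys @ v # zs" using eq by simp
    thus ?thesis unfolding before_def by blast
  qed
next
  assume r: "a = u \<and> v \<in> set L \<or> before L u v"
  show "before (a # L) u v"
  proof (cases "before L u v")
    case True
    then obtain xs ys zs where "L = xs @ u # ys @ v # zs" unfolding before_def by blast
    hence "a # L = (a # xs) @ u # ys @ v # zs" by simp
    thus ?thesis unfolding before_def by blast
  next
    case False
    then obtain ys zs where "L = ys @ v # zs" "a = u" using r split_list by metis
    hence "a # L = [] @ u # ys @ v # zs" by simp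
    thus ?thesis unfolding before_def by blast
  qed
qed

lemma before_filter: "before (filter p L) u v \<Longrightarrow> before L u v"
  by (induction L) (auto simp: before_Cons split: if_splits)

lemma before_appendI: "u \<in> set xs \<Longrightarrow> v \<in> set ys \<Longrightarrow> before (xs @ ys) u v"
  by (induction xs) (auto simp: before_Cons)

lemma subset_between:
  assumes "A \<subseteq> B" "finite B" "card A \<le> n" "n \<le> card B"
  obtains C where "A \<subseteq> C" "C \<subseteq> B" "card C = n"
proof -
  have fA: "finite A" using assms finite_subset by auto
  have "n - card A \<le> card (B - A)" using assms fA by (simp add: card_Diff_subset)
  then obtain C where C: "C \<subseteq> B - A" "card C = n - card A" by (meson obtain_subset_with_card_n)
  have "finite C" using C assms(2) finite_subset by auto
  hence "card (A \<union> C) = n" using C fA assms(3) by (subst card_Un_disjoint) auto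
  thus ?thesis using that[of "A \<union> C"] C assms(1) by auto
qed

locale oriented_linkage = oriented V E src tgt vm D R + linkage V E src tgt vm k Y X P
  for V :: "'a set" and E :: "'b set" and src tgt :: "'b \<Rightarrow> 'a" and vm D R k Y X P
begin

lemma rev_oriented_linkage: "oriented_linkage V E tgt src vm D (\<lambda>u v. R v u) k X Y P"
  by (intro oriented_linkage.intro rev_oriented rev_linkage)

text \<open>Arcs of \<open>P\<close> are left out because \<open>stuck_vertex\<close> counts them
  separately. Unlike in \<open>R\<close>, both directions of a pair may be present.\<close>

definition G :: "'a \<Rightarrow> 'a \<Rightarrow> bool" where "G u v \<longleftrightarrow> (\<exists>e\<in>E - P. src e = u \<and> tgt e = v)"

lemma G_nonadj:
  assumes "v \<in> V" "W \<subseteq> V - {v}"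
  shows "card {w \<in> W. \<not> G v w \<and> \<not> G w v} \<le> D + 2 * k"
proof -
  have fP: "finite P" by (rule finP)
  have "{w \<in> W. \<not> G v w \<and> \<not> G w v} \<subseteq> {w \<in> V - {v}. \<not> R v w \<and> \<not> R w v} \<union>
      (tgt ` {e \<in> P. src e = v} \<union> src ` {e \<in> P. tgt e = v})"
  proof
    fix w assume w: "w \<in> {w \<in> W. \<not> G v w \<and> \<not> G w v}"
    show "w \<in> {w \<in> V - {v}. \<not> R v w \<and> \<not> R w v} \<union> (tgt ` {e \<in> P. src e = v} \<union> src ` {e \<in> P. tgt e = v})"
    proof (cases "R v w \<or> R w v")
      case True
      then obtain e where "e \<in> E" "src e = v \<and> tgt e = w \<or> src e = w \<and> tgt e = v" using R_arc by blast
      moreover have "e \<in> P" using calculation w unfolding G_def by blast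
      ultimately show ?thesis by auto
    qed (use w assms in auto)
  qed
  hence "card {w \<in> W. \<not> G v w \<and> \<not> G w v} \<le> card ({w \<in> V - {v}. \<not> R v w \<and> \<not> R w v} \<union>
      (tgt ` {e \<in> P. src e = v} \<union> src ` {e \<in> P. tgt e = v}))"
    using finV fP by (intro card_mono) auto
  also have "\<dots> \<le> card {w \<in> V - {v}. \<not> R v w \<and> \<not> R w v} +
      (card (tgt ` {e \<in> P. src e = v}) + card (src ` {e \<in> P. tgt e = v}))"
    by (intro order_trans[OF card_Un_le] add_mono card_Un_le order_refl)
  also have "\<dots> \<le> D + (k + k)"
  proof (intro add_mono)
    show "card (tgt ` {e \<in> P. src e = v}) \<le> k"
      using outd_le[of v] card_image_le[of "{e \<in> P. src e = v}" tgt] fP unfolding outd_def by fastforce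
    show "card (src ` {e \<in> P. tgt e = v}) \<le> k"
      using ind_le[of v] card_image_le[of "{e \<in> P. tgt e = v}" src] fP unfolding ind_def by fastforce
  qed (rule nonadj[OF assms(1)])
  finally show ?thesis by simp
qed

text \<open>Each vertex outside \<open>Q\<close> that lies on fewer than \<open>k\<close> paths gets enough arcs to later
  vertices. Where the order offers too few of them (the set \<open>Bad\<close>), the first \<open>6k + 2D\<close>
  vertices \<open>J\<close> of \<open>Bad\<close> are joined to \<open>T\<close> by fans; as few arcs lead forward from \<open>J\<close>, nearly all
  other bad vertices have \<open>k\<close> out-neighbours in \<open>J\<close>.\<close>

lemma forward_structure:
  assumes Q: "Q \<subseteq> V" and U: "U = {v \<in> V - Q. ind v < k}"
    and fans: "\<And>z. z \<in> U \<Longrightarrow> \<exists>N\<subseteq>E. card N \<le> 3 * k \<and>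
        (\<forall>A B. rc A B \<longrightarrow> z \<in> A \<longrightarrow> ct N A B < k \<longrightarrow> A \<inter> T \<noteq> {})"
    and L: "distinct L" "set L = U"
    and F: "F \<subseteq> E - P" "\<And>e. e \<in> F \<Longrightarrow> before L (src e) (tgt e)"
      "\<And>e e'. e \<in> F \<Longrightarrow> e' \<in> F \<Longrightarrow> src e = src e' \<Longrightarrow> tgt e = tgt e' \<Longrightarrow> e = e'"
      "\<And>u. u \<in> U \<Longrightarrow> card {e \<in> F. src e = u} \<le> k - ind u"
      "(\<Sum>u\<in>U. k - ind u) \<le> card F + \<delta>"
  obtains K where "K \<subseteq> E" "card K \<le> \<delta> + 24 * k * k + 6 * k * D"
    "\<And>A B. rc A B \<Longrightarrow> ct (P \<union> F \<union> K) A B < k \<Longrightarrow> A - Q \<noteq> {} \<Longrightarrow> A \<inter> T \<noteq> {} \<or> A \<inter> X \<noteq> {}"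
proof -
  have UV: "U \<subseteq> V" unfolding U by auto
  have fU: "finite U" using UV finV finite_subset by auto
  have fF: "finite F" using F(1) finE finite_subset by auto
  define f where "f u = k - ind u" for u
  have f: "0 < f u" "f u \<le> k" if "u \<in> U" for u using that unfolding f_def U by auto
  define fw where "fw u = {v \<in> U. before L u v \<and> G u v}" for u
  have ffw: "finite (fw u)" for u unfolding fw_def using fU by simp
  define Bad where "Bad = {u \<in> U. card (fw u) < f u}"
  define BL where "BL = filter (\<lambda>u. u \<in> Bad) L"
  have BL: "distinct BL" "set BL = Bad" using L unfolding BL_def Bad_def by auto
  define l where "l = 6 * k + 2 * D"
  define J where "J = set (take l BL)"
  define B2 where "B2 = set (drop l BL)"
  have Bad_split: "Bad = J \<union> B2" unfolding J_def B2_def BL(2)[symmetric] set_append[symmetric] by simp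
  have JU: "J \<subseteq> U" "B2 \<subseteq> U" using Bad_split unfolding Bad_def by auto
  have fJ: "finite J" unfolding J_def by simp
  have bef: "before L j u" if "j \<in> J" "u \<in> B2" for j u
    using before_filter[of "\<lambda>u. u \<in> Bad" L j u] before_appendI[of j "take l BL" u "drop l BL"] that
    unfolding J_def B2_def BL_def by simp
  have cJ: "card J \<le> l" unfolding J_def using card_length[of "take l BL"] by simp
  have cJ': "card J = l" if "B2 \<noteq> {}"
  proof -
    have "l < length BL" using that unfolding B2_def by auto
    thus ?thesis unfolding J_def using BL(1) by (simp add: distinct_card)
  qed
  have JB: "J \<inter> B2 = {}"
    using BL(1) set_take_disj_set_drop_if_distinct[of BL l l] unfolding J_def B2_def by auto
  \<comment> \<open>The choice \<open>l = 2 * (3 * k + D)\<close> matters here: every vertex of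
    \<open>Q1\<close> receives at least \<open>3 * k + D\<close> arcs from \<open>J\<close>, while
    each vertex of \<open>J\<close> sends fewer than \<open>k\<close> arcs forward. Double counting
    gives \<open>card Q1 \<le> 2 * k\<close>.\<close>
  define Q1 where "Q1 = {u \<in> B2. card {w \<in> J. G u w} < k}"
  have Q1U: "Q1 \<subseteq> U" using JU unfolding Q1_def by auto
  hence Q1U: "Q1 \<subseteq> U" "finite Q1" using fU finite_subset by auto
  have cQ1: "card Q1 \<le> 2 * k"
  proof (cases "Q1 = {}")
    case False
    hence "B2 \<noteq> {}" unfolding Q1_def by auto
    hence l: "card J = l" by (rule cJ')
    define S where "S = {(j, u). j \<in> J \<and> u \<in> Q1 \<and> G j u}"
    have S: "S = (SIGMA j:J. {u \<in> Q1. G j u})" "S = prod.swap ` (SIGMA u:Q1. {j \<in> J. G j u})"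
      unfolding S_def by auto
    have "card S = (\<Sum>j\<in>J. card {u \<in> Q1. G j u})" unfolding S(1) using fJ Q1U by simp
    also have "\<dots> \<le> (\<Sum>j\<in>J. k)"
    proof (rule sum_mono)
      fix j assume j: "j \<in> J"
      have "card {u \<in> Q1. G j u} \<le> card (fw j)"
        using bef j Q1U(1) unfolding fw_def Q1_def by (intro card_mono) (use fU in auto)
      also have "\<dots> < f j" using j Bad_split unfolding Bad_def by auto
      finally show "card {u \<in> Q1. G j u} \<le> k" using f(2)[of j] j JU by fastforce
    qed
    finally have up: "card S \<le> l * k" using l by simp
    have "card S = card (SIGMA u:Q1. {j \<in> J. G j u})"
      unfolding S(2) by (rule card_image) (auto simp: inj_on_def)
    also have "\<dots> = (\<Sum>u\<in>Q1. card {j \<in> J. G j u})" using fJ Q1U by simp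
    also have "\<dots> \<ge> (\<Sum>u\<in>Q1. 3 * k + D)"
    proof (rule sum_mono)
      fix u assume u: "u \<in> Q1"
      hence uV: "u \<in> V" "u \<notin> J" using Q1U UV JB unfolding Q1_def by auto
      have "J \<subseteq> {w \<in> J. G u w} \<union> ({j \<in> J. G j u} \<union> {w \<in> J. \<not> G u w \<and> \<not> G w u})" by auto
      hence "card J \<le> card ({w \<in> J. G u w} \<union> ({j \<in> J. G j u} \<union> {w \<in> J. \<not> G u w \<and> \<not> G w u}))"
        using fJ by (intro card_mono) auto
      also have "\<dots> \<le> card {w \<in> J. G u w} + (card {j \<in> J. G j u} + card {w \<in> J. \<not> G u w \<and> \<not> G w u})"
        by (intro order_trans[OF card_Un_le] add_mono card_Un_le order_refl)
      finally have "card J \<le> card {w \<in> J. G u w} +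
        (card {j \<in> J. G j u} + card {w \<in> J. \<not> G u w \<and> \<not> G w u})" .
      moreover have "J \<subseteq> V - {u}" using uV JU UV by auto
      hence "card {w \<in> J. \<not> G u w \<and> \<not> G w u} \<le> D + 2 * k" by (rule G_nonadj[OF uV(1)])
      moreover have "card {w \<in> J. G u w} < k" using u unfolding Q1_def by auto
      ultimately show "3 * k + D \<le> card {j \<in> J. G j u}" using l unfolding l_def by linarith
    qed
    finally have "card Q1 * (3 * k + D) \<le> l * k" using up by simp
    hence "card Q1 * (3 * k + D) \<le> (2 * k) * (3 * k + D)" unfolding l_def by (simp add: algebra_simps)
    moreover have "0 < 3 * k + D"
    proof -
      obtain u where "u \<in> U" using False Q1U by auto
      thus ?thesis using f[of u] by linarith
    qed
    ultimately show ?thesis by (meson mult_le_cancel2)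
  qed simp
  obtain N where N: "\<And>z. z \<in> U \<Longrightarrow> N z \<subseteq> E \<and> card (N z) \<le> 3 * k \<and>
        (\<forall>A B. rc A B \<longrightarrow> z \<in> A \<longrightarrow> ct (N z) A B < k \<longrightarrow> A \<inter> T \<noteq> {})"
    using fans by metis
  define NN where "NN = (\<Union>z\<in>J \<union> Q1. N z)"
  have NNE: "NN \<subseteq> E" unfolding NN_def using N JU Q1U by blast
  have cNN: "card NN \<le> 24 * k * k + 6 * k * D"
  proof -
    have "card NN \<le> (\<Sum>z\<in>J \<union> Q1. card (N z))" unfolding NN_def using fJ Q1U by (intro card_UN_le) auto
    also have "\<dots> \<le> (\<Sum>z\<in>J \<union> Q1. 3 * k)" using N JU Q1U by (intro sum_mono) auto
    also have "\<dots> = card (J \<union> Q1) * (3 * k)" by simp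
    also have "\<dots> \<le> (l + 2 * k) * (3 * k)"
      using card_Un_le[of J Q1] cJ cQ1 by (intro mult_le_mono1) linarith
    also have "\<dots> = 24 * k * k + 6 * k * D" unfolding l_def by (simp add: algebra_simps)
    finally show ?thesis .
  qed
  define U' where "U' = U - (J \<union> Q1)"
  \<comment> \<open>The arcs of \<open>F\<close> at \<open>u\<close> are completed to
    \<open>f u\<close> arcs with distinct heads. Only the completion is new, so over all
    \<open>u\<close> it costs at most the deficit \<open>\<delta>\<close> of
    \<open>F\<close>.\<close>
  have ex: "\<exists>S. S \<subseteq> E - P \<and> (\<forall>e\<in>S. src e = u \<and> (tgt e \<in> fw u \<or> tgt e \<in> J)) \<and> inj_on tgt S \<and>
      card S = f u \<and> card (S - F) \<le> f u - card {e \<in> F. src e = u}" if u: "u \<in> U'" for u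
  proof -
    have uU: "u \<in> U" using u unfolding U'_def by auto
    define H where "H = fw u \<union> {w \<in> J. G u w}"
    have fH: "finite H" unfolding H_def using ffw fJ by auto
    have cH: "f u \<le> card H"
    proof (cases "u \<in> Bad")
      case True
      hence "k \<le> card {w \<in> J. G u w}" using u Bad_split unfolding U'_def Q1_def by auto
      also have "\<dots> \<le> card H" using fH by (intro card_mono) (auto simp: H_def)
      finally show ?thesis using f(2)[OF uU] by linarith
    next
      case False
      hence "f u \<le> card (fw u)" using uU unfolding Bad_def by auto
      also have "\<dots> \<le> card H" using fH by (intro card_mono) (auto simp: H_def)
      finally show ?thesis .
    qed
    define Fu where "Fu = {e \<in> F. src e = u}"
    have fFu: "finite Fu" unfolding Fu_def using fF by simp
    have injF: "inj_on tgt Fu" using F(3) unfolding Fu_def inj_on_def by auto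
    have FH: "tgt ` Fu \<subseteq> H"
      using F(1,2) before_set L(2) unfolding Fu_def H_def fw_def G_def by fast
    have cF: "card (tgt ` Fu) \<le> f u" using F(4)[OF uU] card_image[OF injF] unfolding Fu_def f_def by simp
    obtain H' where H': "tgt ` Fu \<subseteq> H'" "H' \<subseteq> H" "card H' = f u"
      using subset_between[OF FH fH cF cH] by blast
    define ea where "ea w = (SOME e. e \<in> E - P \<and> src e = u \<and> tgt e = w)" for w
    have ea: "ea w \<in> E - P \<and> src (ea w) = u \<and> tgt (ea w) = w" if "w \<in> H" for w
    proof -
      have "\<exists>e. e \<in> E - P \<and> src e = u \<and> tgt e = w" using that unfolding H_def fw_def G_def by auto
      thus ?thesis unfolding ea_def by (rule someI_ex)
    qed
    define S where "S = Fu \<union> ea ` (H' - tgt ` Fu)"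
    have eaH: "ea w \<in> E - P" "src (ea w) = u" "tgt (ea w) = w" if "w \<in> H' - tgt ` Fu" for w
      using ea[of w] that H'(2) by auto
    have FuE: "Fu \<subseteq> E - P" "\<And>e. e \<in> Fu \<Longrightarrow> src e = u" using F(1) unfolding Fu_def by auto
    have S: "S \<subseteq> E - P" "\<forall>e\<in>S. src e = u \<and> tgt e \<in> H"
    proof -
      show "S \<subseteq> E - P" using FuE(1) eaH(1) unfolding S_def by (simp add: image_subset_iff)
      show "\<forall>e\<in>S. src e = u \<and> tgt e \<in> H"
      proof
        fix e assume "e \<in> S"
        then consider "e \<in> Fu" | w where "w \<in> H' - tgt ` Fu" "e = ea w" unfolding S_def by blast
        thus "src e = u \<and> tgt e \<in> H"
        proof cases
          case 1 thus ?thesis using FuE(2) FH by blast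
        next
          case 2 thus ?thesis using eaH(2,3) H'(2) by auto
        qed
      qed
    qed
    have inj: "inj_on tgt S"
      unfolding S_def inj_on_Un
    proof (intro conjI injF)
      show "inj_on tgt (ea ` (H' - tgt ` Fu))" using eaH(3) by (intro inj_onI) auto
      show "tgt ` (Fu - ea ` (H' - tgt ` Fu)) \<inter> tgt ` (ea ` (H' - tgt ` Fu) - Fu) = {}"
        using eaH(3) by auto
    qed
    have "tgt ` ea ` (H' - tgt ` Fu) = H' - tgt ` Fu"
      unfolding image_image using eaH(3) by (simp cong: image_cong_simp)
    hence "tgt ` S = H'" using H'(1) unfolding S_def image_Un by auto
    hence cS: "card S = f u" using card_image[OF inj] H' by simp
    have fS: "finite S" using finite_subset[OF S(1)] finE by blast
    have "card (S - F) \<le> card (S - Fu)" using fS unfolding Fu_def by (intro card_mono) auto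
    also have "\<dots> = f u - card Fu" using fFu cS unfolding S_def by (subst card_Diff_subset) auto
    finally have cd: "card (S - F) \<le> f u - card {e \<in> F. src e = u}" unfolding Fu_def .
    have "src e = u \<and> (tgt e \<in> fw u \<or> tgt e \<in> J)" if "e \<in> S" for e
      using S(2) that unfolding H_def by auto
    thus ?thesis using S(1) inj cS cd by blast
  qed
  then have "\<forall>u\<in>U'. \<exists>S. S \<subseteq> E - P \<and> (\<forall>e\<in>S. src e = u \<and> (tgt e \<in> fw u \<or> tgt e \<in> J)) \<and>
      inj_on tgt S \<and> card S = f u \<and> card (S - F) \<le> f u - card {e \<in> F. src e = u}" by (rule ballI)
  from bchoice[OF this] obtain S where S: "\<forall>u\<in>U'. S u \<subseteq> E - P \<and>
     (\<forall>e\<in>S u. src e = u \<and> (tgt e \<in> fw u \<or> tgt e \<in> J)) \<and>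
     inj_on tgt (S u) \<and> card (S u) = f u \<and> card (S u - F) \<le> f u - card {e \<in> F. src e = u}" ..
  have SE: "S u \<subseteq> E - P" and Ssrc: "\<And>e. e \<in> S u \<Longrightarrow> src e = u \<and> (tgt e \<in> fw u \<or> tgt e \<in> J)"
    and Sinj: "inj_on tgt (S u)" and Scard: "card (S u) = f u" "card (S u - F) \<le> f u - card {e \<in> F. src e = u}"
    if "u \<in> U'" for u using bspec[OF S that] by simp_all
  define C where "C = (\<Union>u\<in>U'. S u - F)"
  have CE: "C \<subseteq> E"
  proof
    fix e assume "e \<in> C"
    then obtain u where "u \<in> U'" "e \<in> S u" unfolding C_def by blast
    with SE[of u] show "e \<in> E" by blast
  qed
  have fU': "finite U'" "U' \<subseteq> U" unfolding U'_def using fU by auto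
  have cC: "card C \<le> \<delta>"
  proof -
    have "card C \<le> (\<Sum>u\<in>U'. card (S u - F))" unfolding C_def using fU' by (intro card_UN_le) auto
    also have "\<dots> \<le> (\<Sum>u\<in>U'. f u - card {e \<in> F. src e = u})" using Scard(2) by (intro sum_mono)
    also have "\<dots> \<le> (\<Sum>u\<in>U. f u - card {e \<in> F. src e = u})" using fU fU' by (intro sum_mono2) auto
    also have "\<dots> = (\<Sum>u\<in>U. f u) - (\<Sum>u\<in>U. card {e \<in> F. src e = u})"
      using F(4) unfolding f_def by (intro sum_subtractf_nat) auto
    also have "(\<Sum>u\<in>U. card {e \<in> F. src e = u}) = card F"
    proof -
      have "F = (\<Union>u\<in>U. {e \<in> F. src e = u})" using F(2) before_set L(2) by fastforce
      moreover have "card (\<Union>u\<in>U. {e \<in> F. src e = u}) = (\<Sum>u\<in>U. card {e \<in> F. src e = u})"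
        using fU fF by (intro card_UN_disjoint) auto
      ultimately show ?thesis by simp
    qed
    finally show ?thesis using F(5) unfolding f_def by linarith
  qed
  show ?thesis
  proof (rule that[of "C \<union> NN"])
    show "C \<union> NN \<subseteq> E" using CE NNE by auto
    show "card (C \<union> NN) \<le> \<delta> + 24 * k * k + 6 * k * D" using card_Un_le[of C NN] cC cNN by linarith
    fix A B assume r: "rc A B" and viol: "ct (P \<union> F \<union> (C \<union> NN)) A B < k" and AQ: "A - Q \<noteq> {}"
    have AV: "A \<subseteq> V" using r unfolding rect_def by auto
    have fK: "finite (P \<union> F \<union> (C \<union> NN))" using finP fF CE NNE finE finite_subset by blast
    have sub: "ct K' A B < k" if "K' \<subseteq> P \<union> F \<union> (C \<union> NN)" for K'
      using cut_size_mono[OF that fK, of V src tgt A B] viol by linarith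
    show "A \<inter> T \<noteq> {} \<or> A \<inter> X \<noteq> {}"
    proof (rule ccontr)
      assume "\<not> ?thesis"
      hence AT: "A \<inter> T = {}" and XA: "X \<inter> A = {}" by auto
      have AJ: "z \<notin> A" if z: "z \<in> J \<union> Q1" for z
      proof
        assume "z \<in> A"
        moreover have "ct (N z) A B < k" using z by (intro sub) (auto simp: NN_def)
        ultimately show False using N[of z] z JU Q1U r AT by blast
      qed
      show False
      proof (cases "A \<inter> U = {}")
        case True
        obtain a where a: "a \<in> A" "a \<notin> Q" using AQ by auto
        hence "k \<le> ind a" using True AV unfolding U by auto
        moreover have "card ({} :: 'b set) + ind a \<le> ct ({} \<union> P) A B"
          by (rule stuck_vertex[OF r XA a(1)]) auto
        moreover have "ct P A B < k" by (rule sub) blast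
        ultimately show False by simp
      next
        case False
        \<comment> \<open>At the last vertex of \<open>A \<inter> U\<close> in the order, all chosen
          arcs lead to later vertices of \<open>U\<close> or into \<open>J\<close>, hence out of
          \<open>A\<close>, and \<open>stuck_vertex\<close> applies.\<close>
        then obtain a where a: "a \<in> A \<inter> U" and last: "\<And>v. before L a v \<Longrightarrow> v \<notin> A \<inter> U"
          using last_in_order[of L "A \<inter> U"] L by auto
        have aU: "a \<in> U'" using a AJ unfolding U'_def by auto
        have "card (S a) + ind a \<le> ct (S a \<union> P) A B"
        proof (rule stuck_vertex[OF r XA])
          show "src e = a \<and> tgt e \<notin> A" if "e \<in> S a" for e
            using Ssrc[OF aU that] last AJ unfolding fw_def by blast
          show "a \<in> A" using a by blast
        qed (fact SE[OF aU] Sinj[OF aU])+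
        also have "\<dots> < k" using aU by (intro sub) (auto simp: C_def)
        finally show False using Scard(1)[OF aU] unfolding f_def by linarith
      qed
    qed
  qed
qed

end

section \<open>Assembling a sparse subgraph\<close>

definition (in arc_graph) fanned :: "nat \<Rightarrow> 'a set \<Rightarrow> 'a \<Rightarrow> bool" where
  "fanned k T z \<longleftrightarrow> (\<exists>N\<subseteq>E. card N \<le> 3 * k \<and>
     (\<forall>A B. rc A B \<longrightarrow> z \<in> A \<longrightarrow> ct N A B < k \<longrightarrow> A \<inter> T \<noteq> {}))"

context oriented
begin

lemma deg_mono: "Z \<subseteq> Z' \<Longrightarrow> finite Z' \<Longrightarrow> deg Z v \<le> deg Z' v"
  unfolding deg_def by (intro card_mono) auto

text \<open>Fewer than \<open>12 * k + 5 * D\<close> vertices of \<open>I\<close> have degree below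
  \<open>6 * k + 2 * D\<close> inside \<open>I\<close>; with \<open>15 * k + 5 * D\<close> vertices
  in \<open>I\<close>, the \<open>3 * k\<close> that \<open>fan\<close> asks for remain in
  \<open>T\<close>. \<open>W\<close> adds the vertices whose degree is too low for a fan. As
  \<open>I\<close> is lowest in degree, the two sets are nested, so their sizes do not add
  up.\<close>

lemma sink_hub:
  assumes k: "1 \<le> k" and n: "15 * k + 5 * D \<le> card V"
  obtains I Y T W where "I \<subseteq> W" "W \<subseteq> V" "card I = 15 * k + 5 * D" "card W \<le> 48 * k + 15 * D"
    "Y \<subseteq> I" "card Y = k" "T \<subseteq> I" "3 * k \<le> card T"
    "\<And>A B. rc A B \<Longrightarrow> ct {e \<in> E. src e \<in> I \<and> tgt e \<in> I} A B < k \<Longrightarrow> A \<inter> T \<noteq> {} \<Longrightarrow> B \<inter> Y = {}"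
    "\<And>z. z \<in> V \<Longrightarrow> 24 * k + 7 * D \<le> deg V z \<Longrightarrow> fanned k T z"
    "\<And>z. z \<in> V - W \<Longrightarrow> 24 * k + 7 * D \<le> deg V z"
    "\<And>i v. i \<in> I \<Longrightarrow> v \<in> V - I \<Longrightarrow> deg V i \<le> deg V v"
proof -
  obtain I where I: "I \<subseteq> V" "card I = 15 * k + 5 * D"
      "\<And>i v. i \<in> I \<Longrightarrow> v \<in> V - I \<Longrightarrow> deg V i \<le> deg V v"
    using low_subset[OF finV n, of "deg V"] by blast
  have fI: "finite I" using I(1) finV finite_subset by auto
  have "k \<le> card I" using I(2) by simp
  then obtain Y where Y: "Y \<subseteq> I" "card Y = k" "\<And>i v. i \<in> Y \<Longrightarrow> v \<in> I - Y \<Longrightarrow> deg I i \<le> deg I v"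
    using low_subset[OF fI, of k "deg I"] by blast
  define T where "T = {i \<in> I. 6 * k + 2 * D \<le> deg I i}"
  have TI: "T \<subseteq> I" unfolding T_def by auto
  have "card (I - T) \<le> 2 * (6 * k + 2 * D - 1) + D + 1"
  proof (rule card_low_deg)
    fix z assume "z \<in> I - T"
    hence "deg I z < 6 * k + 2 * D" unfolding T_def by auto
    thus "deg (I - T) z \<le> 6 * k + 2 * D - 1" using deg_mono[of "I - T" I z] fI by fastforce
  qed (use I in auto)
  moreover have "card (I - T) = card I - card T" "card T \<le> card I"
    using TI fI by (auto intro: card_Diff_subset card_mono finite_subset)
  ultimately have T: "3 * k \<le> card T" using I(2) k by linarith
  define W where "W = I \<union> {v \<in> V. deg V v < 24 * k + 7 * D}"
  have low: "card {v \<in> V. deg V v < 24 * k + 7 * D} \<le> 48 * k + 15 * D"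
  proof -
    let ?Z = "{v \<in> V. deg V v < 24 * k + 7 * D}"
    have "card ?Z \<le> 2 * (24 * k + 7 * D - 1) + D + 1"
    proof (rule card_low_deg)
      fix z assume "z \<in> ?Z"
      thus "deg ?Z z \<le> 24 * k + 7 * D - 1" using deg_mono[of ?Z V z] finV by fastforce
    qed auto
    thus ?thesis using k by linarith
  qed
  have cW: "card W \<le> 48 * k + 15 * D"
  proof (cases "I \<subseteq> {v \<in> V. deg V v < 24 * k + 7 * D}")
    case True
    hence "W = {v \<in> V. deg V v < 24 * k + 7 * D}" unfolding W_def by auto
    thus ?thesis using low by simp
  next
    case False
    then obtain i where i: "i \<in> I" "\<not> deg V i < 24 * k + 7 * D" using I(1) by blast
    have "{v \<in> V. deg V v < 24 * k + 7 * D} \<subseteq> I"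
    proof (rule ccontr)
      assume "\<not> ?thesis"
      then obtain v where "v \<in> V - I" "deg V v < 24 * k + 7 * D" by blast
      with I(3)[OF i(1), of v] i(2) show False by linarith
    qed
    hence "W = I" unfolding W_def by auto
    thus ?thesis using I(2) by simp
  qed
  show ?thesis
  proof (rule that[of I W Y T])
    show "B \<inter> Y = {}" if r: "rc A B" and c: "ct {e \<in> E. src e \<in> I \<and> tgt e \<in> I} A B < k"
      and AT: "A \<inter> T \<noteq> {}" for A B
    proof -
      obtain i where "i \<in> A" "i \<in> I" "6 * k + 2 * D \<le> deg I i" using AT unfolding T_def by auto
      thus ?thesis using hub[OF I(1) Y _ _ _ r c] by blast
    qed
    show "fanned k T z" if z: "z \<in> V" "24 * k + 7 * D \<le> deg V z" for z
    proof -
      have cI: "card I \<le> 15 * k + 5 * D" using I(2) by simp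
      show ?thesis
      proof (rule fan[OF I(1) cI I(3) TI T z k])
        fix N assume N: "N \<subseteq> E" "card N \<le> 3 * k"
          "\<And>A B. rc A B \<Longrightarrow> z \<in> A \<Longrightarrow> ct N A B < k \<Longrightarrow> A \<inter> T \<noteq> {}"
        show "fanned k T z" unfolding fanned_def by (rule exI[of _ N]) (use N in simp)
      qed
    qed
    show "24 * k + 7 * D \<le> deg V z" if "z \<in> V - W" for z
      using that unfolding W_def by (auto simp: not_less)
  qed (use I Y TI T cW in \<open>auto simp: W_def\<close>)
qed

text \<open>Needed for the fans that link the in-hub to the out-hub. A \<open>z \<in> I\<close> of
  low out-degree would have in-degree close to \<open>card V\<close>; then so would all vertices
  outside \<open>I\<close>, whose out-degrees would be too small for their number.\<close>

lemma low_in_high_out: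
  assumes I: "I \<subseteq> V" "card I = 15 * k + 5 * D"
    "\<And>i v. i \<in> I \<Longrightarrow> v \<in> V - I \<Longrightarrow> card {w \<in> V. R w i} \<le> card {w \<in> V. R w v}"
    and n: "63 * k + 22 * D + 1 < card V" and z: "z \<in> I"
  shows "24 * k + 7 * D \<le> deg V z"
proof (rule ccontr)
  assume a: "\<not> ?thesis"
  have zV: "z \<in> V" using z I by auto
  have 1: "card V \<le> deg V z + card {w \<in> V. R w z} + (D + 1)"
  proof -
    have "V \<subseteq> ({w \<in> V. R z w} \<union> {w \<in> V. R w z}) \<union> insert z {w \<in> V - {z}. \<not> R z w \<and> \<not> R w z}" by auto
    hence "card V \<le> card (({w \<in> V. R z w} \<union> {w \<in> V. R w z}) \<union> insert z {w \<in> V - {z}. \<not> R z w \<and> \<not> R w z})"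
      by (intro card_mono) (use finV in auto)
    also have "\<dots> \<le> (deg V z + card {w \<in> V. R w z}) + card (insert z {w \<in> V - {z}. \<not> R z w \<and> \<not> R w z})"
      unfolding deg_def by (intro order_trans[OF card_Un_le] add_mono card_Un_le order_refl)
    also have "card (insert z {w \<in> V - {z}. \<not> R z w \<and> \<not> R w z}) \<le> D + 1"
      using nonadj[OF zV] finV by (auto simp: card_insert_if)
    finally show ?thesis by simp
  qed
  have 2: "deg V v + card {w \<in> V. R w v} \<le> card V" for v
  proof -
    have "{w \<in> V. R v w} \<inter> {w \<in> V. R w v} = {}" using R_asym by blast
    hence "deg V v + card {w \<in> V. R w v} = card ({w \<in> V. R v w} \<union> {w \<in> V. R w v})"
      unfolding deg_def using finV by (simp add: card_Un_disjoint)
    also have "\<dots> \<le> card V" using finV by (intro card_mono) auto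
    finally show ?thesis .
  qed
  have fI: "finite I" using I(1) finV finite_subset by auto
  have "card (V - I) \<le> 2 * (24 * k + 8 * D) + D + 1"
  proof (rule card_low_deg)
    fix v assume v: "v \<in> V - I"
    have "deg (V - I) v \<le> deg V v" using finV by (intro deg_mono) auto
    thus "deg (V - I) v \<le> 24 * k + 8 * D" using 1 2[of v] I(3)[OF z v] a by linarith
  qed auto
  moreover have "card (V - I) + card I = card V"
    using card_Diff_subset[OF fI I(1)] card_mono[OF finV I(1)] by simp
  ultimately show False using I(2) n by simp
qed

end

text \<open>\<open>tight_arcs\<close> with \<open>U = V\<close>. One side exceeds a third of
  \<open>V\<close> if fewer than \<open>k\<close> vertices lie outside both and
  \<open>3 * k \<le> card V\<close>; in the arc version nothing lies outside. For \<open>vm\<close>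
  and smaller \<open>V\<close>, all arcs together are few by simplicity.\<close>

lemma (in arc_graph) few_arcs_always:
  assumes "conn k E"
  obtains H where "H \<subseteq> E" "conn k H" "card H \<le> 4 * k * card V"
proof (cases "vm \<and> card V < 3 * k")
  case True
  have "inj_on (\<lambda>e. (src e, tgt e)) E" using True simple by (auto intro!: inj_onI)
  hence "card E \<le> card (V \<times> V)" by (rule card_inj_on_le) (use src_V tgt_V finV in auto)
  also have "\<dots> \<le> 3 * k * card V" using True by (simp add: card_cartesian_product)
  finally have "card E \<le> 4 * k * card V" by linarith
  thus ?thesis using that[of E] assms by auto
next
  case False
  obtain H where H: "H \<subseteq> E" "conn k H"
    "\<And>x. x \<in> H - {} \<Longrightarrow> \<exists>A B. rc A B \<and> src x \<in> A \<and> tgt x \<in> B \<and> ct H A B = k \<and> ct {} A B < k"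
    using minimal_conn[OF assms, of "{}"] by auto
  interpret h: arc_graph V H src tgt vm by (rule sub_graph[OF H(1)])
  have "card H \<le> 4 * k * card V"
  proof (rule h.tight_arcs[OF H(2) finV])
    fix x assume x: "x \<in> H"
    then obtain A B where AB: "rc A B" "src x \<in> A" "tgt x \<in> B" "ct H A B = k" "ct {} A B < k"
      using H(3) by blast
    have s: "card (V - (A \<union> B)) < k" using AB(5) unfolding cut_size_def by simp
    have "card V < 3 * card B \<or> card V < 3 * card A"
    proof (cases vm)
      case True
      thus ?thesis using False s rect_card[OF finV AB(1)] by linarith
    next
      case False
      hence "V - (A \<union> B) = {}" using AB(1) unfolding rect_def by auto
      hence "card (V - (A \<union> B)) = 0" by (simp only: card.empty)
      hence "card A + card B = card V" using rect_card[OF finV AB(1)] by linarith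
      moreover have "A \<subseteq> V" "A \<noteq> {}" using AB unfolding rect_def by auto
      hence "0 < card V" using finV by (metis card_gt_0_iff subset_empty)
      ultimately show ?thesis by linarith
    qed
    thus "x \<in> H \<and> (\<exists>A B. rc A B \<and> src x \<in> A \<and> tgt x \<in> B \<and> ct H A B = k \<and>
       (card V < 3 * card B \<and> src x \<in> V \<or> card V < 3 * card A \<and> tgt x \<in> V))"
      using x AB h.src_V h.tgt_V by blast
  qed
  thus ?thesis using that H by blast
qed

text \<open>The arcs outside the skeleton \<open>Ks\<close> are found by two minimisations: first \<open>E\<close> is
  reduced to \<open>Ks\<close>, the arcs \<open>C\<close> inside the core \<open>I\<close> and few arcs at \<open>Q\<close>; then the arcs
  inside the core are reduced.\<close>

lemma (in arc_graph) thin_out: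
  assumes E: "conn k E" and Ks: "Ks \<subseteq> E" and C: "C \<subseteq> E" "\<And>e. e \<in> C \<Longrightarrow> src e \<in> I \<and> tgt e \<in> I"
    and I: "I \<subseteq> V" and Q: "Q \<subseteq> V" "3 * card Q + 3 * k < 2 * card V" "3 * k < card V"
    and viol: "\<And>A B. rc A B \<Longrightarrow> ct (Ks \<union> C) A B < k \<Longrightarrow> A \<subseteq> Q \<or> B \<subseteq> Q"
  obtains H where "H \<subseteq> E" "conn k H" "card H \<le> card Ks + 4 * k * card Q + 4 * k * card I"
proof -
  obtain H0 where H0: "Ks \<union> C \<subseteq> H0" "H0 \<subseteq> E" "conn k H0"
    "\<And>x. x \<in> H0 - (Ks \<union> C) \<Longrightarrow> \<exists>A B. rc A B \<and> src x \<in> A \<and> tgt x \<in> B \<and> ct H0 A B = k \<and> ct (Ks \<union> C) A B < k"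
    by (rule minimal_conn[OF E, of "Ks \<union> C"]) (use Ks C(1) in auto)
  interpret h0: arc_graph V H0 src tgt vm by (rule sub_graph[OF H0(2)])
  have fQI: "finite Q" "finite I" using Q I finV finite_subset by auto
  have 1: "card (H0 - (Ks \<union> C)) \<le> 4 * k * card Q"
  proof (rule h0.tight_arcs[OF H0(3) fQI(1)])
    fix x assume x: "x \<in> H0 - (Ks \<union> C)"
    then obtain A B where AB: "rc A B" "src x \<in> A" "tgt x \<in> B" "ct H0 A B = k" "ct (Ks \<union> C) A B < k"
      using H0(4) by blast
    have s: "card (V - (A \<union> B)) < k" using AB(5) unfolding cut_size_def by linarith
    \<comment> \<open>The side not contained in \<open>Q\<close> has more than
      \<open>card V - card Q - k\<close> vertices, which exceeds a third of \<open>V\<close> by the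
      hypothesis on \<open>card Q\<close>.\<close>
    have "card V < 3 * card B \<and> src x \<in> Q \<or> card V < 3 * card A \<and> tgt x \<in> Q"
      using viol[OF AB(1,5)]
    proof
      assume "A \<subseteq> Q"
      moreover from this have "card A \<le> card Q" by (rule card_mono[OF fQI(1)])
      ultimately show ?thesis using rect_card[OF finV AB(1)] s Q(2) AB(2) by auto
    next
      assume "B \<subseteq> Q"
      moreover from this have "card B \<le> card Q" by (rule card_mono[OF fQI(1)])
      ultimately show ?thesis using rect_card[OF finV AB(1)] s Q(2) AB(3) by auto
    qed
    thus "x \<in> H0 \<and> (\<exists>A B. rc A B \<and> src x \<in> A \<and> tgt x \<in> B \<and> ct H0 A B = k \<and>
       (card V < 3 * card B \<and> src x \<in> Q \<or> card V < 3 * card A \<and> tgt x \<in> Q))"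
      using x AB by blast
  qed
  \<comment> \<open>\<open>C\<close> was kept whole so that \<open>hub\<close> could be applied, but
    it need not be linear in \<open>card I\<close>, and with parallel arcs it can be arbitrarily
    large. Its arcs have both ends in \<open>I\<close>, so either side may be the large one.\<close>
  obtain H where H: "H0 - C \<subseteq> H" "H \<subseteq> H0" "conn k H"
    "\<And>x. x \<in> H - (H0 - C) \<Longrightarrow> \<exists>A B. rc A B \<and> src x \<in> A \<and> tgt x \<in> B \<and> ct H A B = k \<and> ct (H0 - C) A B < k"
    by (rule h0.minimal_conn[OF H0(3), of "H0 - C"]) auto
  interpret h: arc_graph V H src tgt vm by (rule h0.sub_graph[OF H(2)])
  have 2: "card (H - (H0 - C)) \<le> 4 * k * card I"
  proof (rule h.tight_arcs[OF H(3) fQI(2)])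
    fix x assume x: "x \<in> H - (H0 - C)"
    then obtain A B where AB: "rc A B" "src x \<in> A" "tgt x \<in> B" "ct H A B = k" "ct (H0 - C) A B < k"
      using H(4) by blast
    have s: "card (V - (A \<union> B)) < k" using AB(5) unfolding cut_size_def by linarith
    have "card V < 3 * card B \<or> card V < 3 * card A"
      using rect_card[OF finV AB(1)] s Q(3) by linarith
    moreover have "src x \<in> I" "tgt x \<in> I" using x H(2) C(2) by auto
    ultimately show "x \<in> H \<and> (\<exists>A B. rc A B \<and> src x \<in> A \<and> tgt x \<in> B \<and> ct H A B = k \<and>
       (card V < 3 * card B \<and> src x \<in> I \<or> card V < 3 * card A \<and> tgt x \<in> I))"
      using x AB by blast
  qed
  have fin: "finite Ks" "finite H0" "finite H"
    using finite_subset[OF Ks finE] finite_subset[OF H0(2) finE] finite_subset[OF H(2)] by blast+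
  have "H \<subseteq> Ks \<union> (H0 - (Ks \<union> C)) \<union> (H - (H0 - C))" using H(2) by auto
  hence "card H \<le> card (Ks \<union> (H0 - (Ks \<union> C)) \<union> (H - (H0 - C)))"
    using fin by (intro card_mono) auto
  also have "\<dots> \<le> card Ks + card (H0 - (Ks \<union> C)) + card (H - (H0 - C))"
    by (intro order_trans[OF card_Un_le] add_mono card_Un_le order_refl)
  finally have "card H \<le> card Ks + 4 * k * card Q + 4 * k * card I" using 1 2 by linarith
  moreover have "H \<subseteq> E" using H(2) H0(2) by (rule order_trans)
  ultimately show ?thesis using that H(3) by blast
qed

text \<open>\<open>F\<close> is paid for once and used twice, with \<open>L\<close> and, in the
  reversed graph, with \<open>rev L\<close>. A vertex outside \<open>Q\<close> is charged
  \<open>ind v + f v = k\<close> for the arcs of \<open>P\<close> and \<open>F\<close>; the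
  corrections \<open>K1\<close> and \<open>K2\<close> go into the error term.\<close>

lemma (in oriented_linkage) skeleton:
  assumes Q: "Q \<subseteq> V" "X \<subseteq> Q" "Y \<subseteq> Q"
    and fan: "\<And>z. z \<in> V - Q \<Longrightarrow> fanned k T z"
    and fan': "\<And>z. z \<in> V - Q \<Longrightarrow> arc_graph.fanned V E tgt src vm k T' z"
  obtains K where "P \<subseteq> K" "K \<subseteq> E" "card K \<le> k * card V + 14 * k * D + 60 * k * k"
    "\<And>A B. rc A B \<Longrightarrow> ct K A B < k \<Longrightarrow> A - Q \<noteq> {} \<Longrightarrow> A \<inter> T \<noteq> {} \<or> A \<inter> X \<noteq> {}"
    "\<And>A B. rc A B \<Longrightarrow> ct K A B < k \<Longrightarrow> B - Q \<noteq> {} \<Longrightarrow> B \<inter> T' \<noteq> {} \<or> B \<inter> Y \<noteq> {}"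
proof -
  interpret r: oriented_linkage V E tgt src vm D "\<lambda>u v. R v u" k X Y P by (rule rev_oriented_linkage)
  \<comment> \<open>Flow conservation off \<open>X\<close> and \<open>Y\<close>, both of which lie
    in \<open>Q\<close>. It makes the out- and in-demands equal, so that one set \<open>F\<close>
    can serve both.\<close>
  have io: "ind v = outd v" if "v \<in> V - Q" for v
  proof -
    have "v \<notin> X" "v \<notin> Y" using that Q by blast+
    thus ?thesis using outd_le_ind[of v] ind_le_outd[of v] by simp
  qed
  have rind: "r.ind v = outd v" for v unfolding r.ind_def outd_def ..
  define U where "U = {v \<in> V - Q. ind v < k}"
  have UV: "U \<subseteq> V" unfolding U_def by auto
  have fU: "finite U" using UV finV finite_subset by auto
  define f where "f v = k - ind v" for v
  obtain L where L: "median_order G f U L" by (rule median_order_exists[OF fU])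
  have L': "distinct L" "set L = U" using L unfolding median_order_def by auto
  define W where "W = {(u, v). before L u v \<and> G u v}"
  have WU: "W \<subseteq> U \<times> U" unfolding W_def using before_set L'(2) by fast
  have fW: "finite W" using WU fU finite_subset by blast
  define \<delta> where "\<delta> = k * (D + 2 * k) + 4 * k * k"
  have "demand_cover fst snd f U \<delta> W"
    unfolding W_def \<delta>_def
  proof (rule median_demand[OF L])
    show "0 < f v \<and> f v \<le> k" if "v \<in> U" for v using that unfolding f_def U_def by auto
    show "card {w \<in> U - {v}. \<not> G v w \<and> \<not> G w v} \<le> D + 2 * k" if "v \<in> U" for v
      using that UV by (intro G_nonadj) auto
  qed
  then obtain F0 where F0: "F0 \<subseteq> W" "\<And>u. card {e \<in> F0. fst e = u} \<le> f u"
    "\<And>u. card {e \<in> F0. snd e = u} \<le> f u" "sum f U \<le> card F0 + \<delta>"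
    by (rule near_factor[OF fW fU]) (use WU in auto)
  define ea where "ea p = (SOME e. e \<in> E - P \<and> src e = fst p \<and> tgt e = snd p)" for p
  have ea: "ea p \<in> E - P \<and> src (ea p) = fst p \<and> tgt (ea p) = snd p" if "p \<in> F0" for p
  proof -
    have "p \<in> W" using that F0(1) by blast
    hence "\<exists>e. e \<in> E - P \<and> src e = fst p \<and> tgt e = snd p" unfolding W_def G_def by auto
    thus ?thesis unfolding ea_def by (rule someI_ex)
  qed
  have inj: "inj_on ea F0"
  proof (rule inj_onI)
    fix p q assume "p \<in> F0" "q \<in> F0" "ea p = ea q"
    thus "p = q" using ea[of p] ea[of q] by (auto simp: prod_eq_iff)
  qed
  define F where "F = ea ` F0"
  have cF: "card F = card F0" unfolding F_def by (rule card_image[OF inj])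
  have fF0: "finite F0" using F0(1) fW finite_subset by auto
  have FE: "F \<subseteq> E - P" unfolding F_def using ea by auto
  have Fb: "before L (src e) (tgt e)" if "e \<in> F" for e
  proof -
    obtain p where p: "p \<in> F0" "e = ea p" using \<open>e \<in> F\<close> unfolding F_def by blast
    thus ?thesis using ea[OF p(1)] F0(1) unfolding W_def by auto
  qed
  have Fu: "e = e'" if e: "e \<in> F" "e' \<in> F" and s: "src e = src e'" "tgt e = tgt e'" for e e'
  proof -
    obtain p q where p: "p \<in> F0" "e = ea p" "q \<in> F0" "e' = ea q" using e unfolding F_def by blast
    have "p = q" using ea[OF p(1)] ea[OF p(3)] s p(2,4) by (intro prod_eqI) auto
    thus ?thesis using p(2,4) by simp
  qed
  have Fo: "card {e \<in> F. src e = u} \<le> f u" for u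
  proof -
    have "{e \<in> F. src e = u} \<subseteq> ea ` {p \<in> F0. fst p = u}" unfolding F_def using ea by auto
    hence "card {e \<in> F. src e = u} \<le> card {p \<in> F0. fst p = u}"
      using surj_card_le[of "{p \<in> F0. fst p = u}"] fF0 by auto
    thus ?thesis using F0(2)[of u] by linarith
  qed
  have Fi: "card {e \<in> F. tgt e = u} \<le> f u" for u
  proof -
    have "{e \<in> F. tgt e = u} \<subseteq> ea ` {p \<in> F0. snd p = u}" unfolding F_def using ea by auto
    hence "card {e \<in> F. tgt e = u} \<le> card {p \<in> F0. snd p = u}"
      using surj_card_le[of "{p \<in> F0. snd p = u}"] fF0 by auto
    thus ?thesis using F0(3)[of u] by linarith
  qed
  have fF: "finite F" unfolding F_def using fF0 by simp
  have fanU: "\<exists>N\<subseteq>E. card N \<le> 3 * k \<and> (\<forall>A B. rc A B \<longrightarrow> z \<in> A \<longrightarrow> ct N A B < k \<longrightarrow> A \<inter> T \<noteq> {})"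
    if "z \<in> U" for z
    using fan[of z] that unfolding fanned_def U_def by auto
  have fanU': "\<exists>N\<subseteq>E. card N \<le> 3 * k \<and>
      (\<forall>A B. rc A B \<longrightarrow> z \<in> A \<longrightarrow> cut_size V tgt src N A B < k \<longrightarrow> A \<inter> T' \<noteq> {})" if "z \<in> U" for z
    using fan'[of z] that unfolding r.fanned_def U_def by auto
  have sF: "(\<Sum>u\<in>U. k - ind u) \<le> card F + \<delta>" using F0(4) cF unfolding f_def by simp
  obtain K1 where K1: "K1 \<subseteq> E" "card K1 \<le> \<delta> + 24 * k * k + 6 * k * D"
    "\<And>A B. rc A B \<Longrightarrow> ct (P \<union> F \<union> K1) A B < k \<Longrightarrow> A - Q \<noteq> {} \<Longrightarrow> A \<inter> T \<noteq> {} \<or> A \<inter> X \<noteq> {}"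
    by (rule forward_structure[OF Q(1) U_def fanU L' FE Fb Fu Fo[unfolded f_def] sF])
      ((rule that; assumption) | assumption)+
  have Ur: "U = {v \<in> V - Q. r.ind v < k}" using io rind unfolding U_def by auto
  have Lr: "distinct (rev L)" "set (rev L) = U" using L' by auto
  have Fbr: "before (rev L) (tgt e) (src e)" if "e \<in> F" for e using Fb[OF that] before_rev by metis
  have Fir: "card {e \<in> F. tgt e = u} \<le> k - r.ind u" if "u \<in> U" for u
    using Fi[of u] io[of u] that unfolding f_def rind U_def by auto
  have "(\<Sum>u\<in>U. k - r.ind u) = sum f U"
    using io unfolding f_def rind U_def by (intro sum.cong) auto
  hence sFr: "(\<Sum>u\<in>U. k - r.ind u) \<le> card F + \<delta>" using F0(4) cF by simp
  obtain K2 where K2: "K2 \<subseteq> E" "card K2 \<le> \<delta> + 24 * k * k + 6 * k * D"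
    "\<And>A B. rc A B \<Longrightarrow> cut_size V tgt src (P \<union> F \<union> K2) A B < k \<Longrightarrow> A - Q \<noteq> {} \<Longrightarrow> A \<inter> T' \<noteq> {} \<or> A \<inter> Y \<noteq> {}"
    by (rule r.forward_structure[OF Q(1) Ur fanU' Lr FE Fbr Fu Fir sFr])
      ((rule that; assumption) | assumption)+
  define K where "K = P \<union> F \<union> K1 \<union> K2"
  have fK: "finite K" unfolding K_def using finP fF K1(1) K2(1) finE finite_subset by blast
  have PF: "card P + card F \<le> k * card V"
  proof -
    have fQ: "finite Q" "finite (V - Q)" using Q(1) finV finite_subset by auto
    have "P = (\<Union>v\<in>V. {e \<in> P. tgt e = v})" using PE tgt_V by auto
    moreover have "card (\<Union>v\<in>V. {e \<in> P. tgt e = v}) = (\<Sum>v\<in>V. ind v)"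
      unfolding ind_def using finV finP by (intro card_UN_disjoint) auto
    ultimately have P: "card P = (\<Sum>v\<in>V. ind v)" by simp
    have "F = (\<Union>u\<in>U. {e \<in> F. src e = u})" using Fb before_set L'(2) by fastforce
    moreover have "card (\<Union>u\<in>U. {e \<in> F. src e = u}) = (\<Sum>u\<in>U. card {e \<in> F. src e = u})"
      using fU fF by (intro card_UN_disjoint) auto
    ultimately have "card F \<le> (\<Sum>u\<in>U. f u)" using sum_mono[of U, OF Fo] by simp
    also have "\<dots> \<le> (\<Sum>u\<in>V - Q. f u)" using fQ by (intro sum_mono2) (auto simp: U_def)
    finally have "card P + card F \<le> (\<Sum>v\<in>V. ind v) + (\<Sum>u\<in>V - Q. f u)" using P by simp
    also have "(\<Sum>v\<in>V. ind v) = (\<Sum>v\<in>V - Q. ind v) + (\<Sum>v\<in>Q. ind v)"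
      by (rule sum.subset_diff[OF Q(1) finV])
    also have "\<dots> + (\<Sum>u\<in>V - Q. f u) = (\<Sum>v\<in>V - Q. ind v + f v) + (\<Sum>v\<in>Q. ind v)"
      by (simp add: sum.distrib)
    also have "(\<Sum>v\<in>V - Q. ind v + f v) = card (V - Q) * k" using ind_le by (simp add: f_def)
    also have "(\<Sum>v\<in>Q. ind v) \<le> card Q * k" using sum_mono[of Q ind "\<lambda>_. k"] ind_le by simp
    finally have "card P + card F \<le> (card (V - Q) + card Q) * k" by (simp add: algebra_simps)
    also have "card (V - Q) + card Q = card V"
      using card_Diff_subset[OF fQ(1) Q(1)] card_mono[OF finV Q(1)] by simp
    finally show ?thesis by (simp add: mult.commute)
  qed
  have "card K \<le> card P + card F + card K1 + card K2"
    unfolding K_def by (intro order_trans[OF card_Un_le] add_mono card_Un_le order_refl)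
  also have "\<dots> \<le> k * card V + 2 * (\<delta> + 24 * k * k + 6 * k * D)"
    unfolding mult_2 using PF K1(2) K2(2) by linarith
  also have "\<dots> = k * card V + 14 * k * D + 60 * k * k" unfolding \<delta>_def by (simp add: algebra_simps)
  finally have cK: "card K \<le> k * card V + 14 * k * D + 60 * k * k" .
  show ?thesis
  proof (rule that[OF _ _ cK])
    show "P \<subseteq> K" unfolding K_def by auto
    show "K \<subseteq> E" unfolding K_def using PE FE K1(1) K2(1) by auto
    fix A B assume r: "rc A B" and c: "ct K A B < k"
    have "ct (P \<union> F \<union> K1) A B \<le> ct K A B" "ct (P \<union> F \<union> K2) A B \<le> ct K A B"
      using fK by (auto intro!: cut_size_mono simp: K_def)
    hence "ct (P \<union> F \<union> K1) A B < k" "cut_size V tgt src (P \<union> F \<union> K2) B A < k"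
      using c cut_size_rev[of V tgt src _ B A] by auto
    thus "A - Q \<noteq> {} \<Longrightarrow> A \<inter> T \<noteq> {} \<or> A \<inter> X \<noteq> {}" "B - Q \<noteq> {} \<Longrightarrow> B \<inter> T' \<noteq> {} \<or> B \<inter> Y \<noteq> {}"
      using K1(3)[OF r] K2(3)[of B A] r rect_sym by blast+
  qed
qed

text \<open>\<open>T\<close> and \<open>Y\<close> belong to the hub of low out-degrees, \<open>T'\<close> and \<open>X\<close> to that of low
  in-degrees. If a rectangle \<open>(A, B)\<close> is violated and neither side lies in \<open>Q\<close>, then either \<open>A\<close>
  contains what remains of \<open>Y\<close> and \<open>B\<close> what remains of \<open>X\<close>, contradicting the choice of the
  paths, or the links from \<open>T'\<close> to \<open>T\<close> are cut.\<close>

lemma (in oriented) few_arcs_dense: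
  assumes E: "conn k E" and k: "1 \<le> k" and n: "223 * (k + D) < card V"
  obtains H where "H \<subseteq> E" "conn k H" "card H \<le> k * card V + 174 * k * D + 567 * k * k"
proof -
  interpret r: oriented V E tgt src vm D "\<lambda>u v. R v u" by (rule rev_oriented)
  have n: "223 * k + 223 * D < card V" using n by simp
  hence n': "15 * k + 5 * D \<le> card V" by linarith
  obtain I Y T W where S: "I \<subseteq> W" "W \<subseteq> V" "card I = 15 * k + 5 * D" "card W \<le> 48 * k + 15 * D"
    "Y \<subseteq> I" "card Y = k" "T \<subseteq> I" "3 * k \<le> card T"
    and Shub: "\<And>A B. rc A B \<Longrightarrow> ct {e \<in> E. src e \<in> I \<and> tgt e \<in> I} A B < k \<Longrightarrow> A \<inter> T \<noteq> {} \<Longrightarrow> B \<inter> Y = {}"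
    and Sfan: "\<And>z. z \<in> V \<Longrightarrow> 24 * k + 7 * D \<le> deg V z \<Longrightarrow> fanned k T z"
    and Sdeg: "\<And>z. z \<in> V - W \<Longrightarrow> 24 * k + 7 * D \<le> deg V z"
    by (rule sink_hub[OF k n']) blast
  obtain I' X T' W' where S': "I' \<subseteq> W'" "W' \<subseteq> V" "card I' = 15 * k + 5 * D" "card W' \<le> 48 * k + 15 * D"
    "X \<subseteq> I'" "card X = k" "T' \<subseteq> I'" "3 * k \<le> card T'"
    and Shub': "\<And>A B. rc A B \<Longrightarrow> cut_size V tgt src {e \<in> E. tgt e \<in> I' \<and> src e \<in> I'} A B < k \<Longrightarrow>
      A \<inter> T' \<noteq> {} \<Longrightarrow> B \<inter> X = {}"
    and Sfan': "\<And>z. z \<in> V \<Longrightarrow> 24 * k + 7 * D \<le> r.deg V z \<Longrightarrow> r.fanned k T' z"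
    and Sdeg': "\<And>z. z \<in> V - W' \<Longrightarrow> 24 * k + 7 * D \<le> r.deg V z"
    and low': "\<And>i v. i \<in> I' \<Longrightarrow> v \<in> V - I' \<Longrightarrow> r.deg V i \<le> r.deg V v"
    by (rule r.sink_hub[OF k n']) blast
  define Q where "Q = W \<union> W'"
  have QV: "Q \<subseteq> V" using S S' unfolding Q_def by auto
  have cQ: "card Q \<le> 96 * k + 30 * D" unfolding Q_def using card_Un_le[of W W'] S(4) S'(4) by linarith
  have IV: "I \<subseteq> V" "I' \<subseteq> V" using S S' by blast+
  have "Y \<noteq> {}" "X \<noteq> {}" using S(6) S'(6) k by auto
  moreover have "Y \<subseteq> V" "X \<subseteq> V" using S(5) S'(5) IV by blast+
  ultimately obtain P where "linkage V E src tgt vm k Y X P"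
    using linkage_exists[OF E] S(6) S'(6) by (metis order_refl)
  then interpret oriented_linkage V E src tgt vm D R k Y X P
    by (intro oriented_linkage.intro oriented_axioms)
  have XQ: "X \<subseteq> Q" and YQ: "Y \<subseteq> Q" using S S' unfolding Q_def by blast+
  have fQ: "fanned k T z" if "z \<in> V - Q" for z using that Sdeg Sfan unfolding Q_def by blast
  have fQ': "r.fanned k T' z" if "z \<in> V - Q" for z using that Sdeg' Sfan' unfolding Q_def by blast
  obtain K where K: "P \<subseteq> K" "K \<subseteq> E" "card K \<le> k * card V + 14 * k * D + 60 * k * k"
    and KA: "\<And>A B. rc A B \<Longrightarrow> ct K A B < k \<Longrightarrow> A - Q \<noteq> {} \<Longrightarrow> A \<inter> T \<noteq> {} \<or> A \<inter> X \<noteq> {}"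
    and KB: "\<And>A B. rc A B \<Longrightarrow> ct K A B < k \<Longrightarrow> B - Q \<noteq> {} \<Longrightarrow> B \<inter> T' \<noteq> {} \<or> B \<inter> Y \<noteq> {}"
    by (rule skeleton[OF QV XQ YQ fQ fQ']) ((rule that; assumption) | assumption)+
  have "k \<le> card T'" using S'(8) by linarith
  then obtain Z where Z: "Z \<subseteq> T'" "card Z = k" by (meson obtain_subset_with_card_n)
  have ZV: "Z \<subseteq> V" using Z(1) S'(7) IV(2) by blast
  hence ZV: "Z \<subseteq> V" "finite Z" using finite_subset[OF _ finV] by blast+
  have Zfan: "fanned k T z" if "z \<in> Z" for z
  proof (rule Sfan)
    show "24 * k + 7 * D \<le> deg V z"
    proof (rule low_in_high_out[OF IV(2) S'(3)])
      show "card {w \<in> V. R w i} \<le> card {w \<in> V. R w v}" if "i \<in> I'" "v \<in> V - I'" for i v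
        using low'[OF that] unfolding r.deg_def .
      show "63 * k + 22 * D + 1 < card V" using n k by linarith
      show "z \<in> I'" using that Z S'(7) by blast
    qed
  qed (use that ZV in blast)
  then have "\<forall>z\<in>Z. \<exists>N. N \<subseteq> E \<and> card N \<le> 3 * k \<and>
     (\<forall>A B. rc A B \<longrightarrow> z \<in> A \<longrightarrow> ct N A B < k \<longrightarrow> A \<inter> T \<noteq> {})" unfolding fanned_def by blast
  from bchoice[OF this] obtain N where N: "\<forall>z\<in>Z. N z \<subseteq> E \<and> card (N z) \<le> 3 * k \<and>
     (\<forall>A B. rc A B \<longrightarrow> z \<in> A \<longrightarrow> ct (N z) A B < k \<longrightarrow> A \<inter> T \<noteq> {})" ..
  define NL where "NL = (\<Union>z\<in>Z. N z)"
  have NLE: "NL \<subseteq> E" unfolding NL_def using N by blast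
  have "card NL \<le> (\<Sum>z\<in>Z. card (N z))" unfolding NL_def by (rule card_UN_le[OF ZV(2)])
  also have "\<dots> \<le> (\<Sum>z\<in>Z. 3 * k)" using N by (intro sum_mono) auto
  finally have cNL: "card NL \<le> 3 * k * k" using Z(2) by simp
  define C where "C = {e \<in> E. src e \<in> I \<and> tgt e \<in> I} \<union> {e \<in> E. tgt e \<in> I' \<and> src e \<in> I'}"
  have CE: "C \<subseteq> E" unfolding C_def by auto
  obtain H where H: "H \<subseteq> E" "conn k H" "card H \<le> card (K \<union> NL) + 4 * k * card Q + 4 * k * card (I \<union> I')"
  proof (rule thin_out[OF E _ CE _ _ QV])
    show "K \<union> NL \<subseteq> E" using K(2) NLE by auto
    show "src e \<in> I \<union> I' \<and> tgt e \<in> I \<union> I'" if "e \<in> C" for e using that unfolding C_def by auto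
    show "I \<union> I' \<subseteq> V" using IV by auto
    show "3 * card Q + 3 * k < 2 * card V" "3 * k < card V" using cQ n by linarith+
    fix A B assume rr: "rc A B" and viol: "ct (K \<union> NL \<union> C) A B < k"
    have fin: "finite (K \<union> NL \<union> C)" using K(2) NLE CE finE finite_subset by (meson Un_least)
    have sub: "ct K' A B < k" if "K' \<subseteq> K \<union> NL \<union> C" for K'
      using cut_size_mono[OF that fin, of V src tgt A B] viol by linarith
    have hubT: "B \<inter> Y = {}" if "A \<inter> T \<noteq> {}"
      by (rule Shub[OF rr _ that], rule sub) (auto simp: C_def)
    have hubT': "A \<inter> X = {}" if "B \<inter> T' \<noteq> {}"
    proof (rule Shub'[OF _ _ that])
      show "rc B A" using rr rect_sym by metis
      have "ct {e \<in> E. tgt e \<in> I' \<and> src e \<in> I'} A B < k" by (rule sub) (auto simp: C_def)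
      thus "cut_size V tgt src {e \<in> E. tgt e \<in> I' \<and> src e \<in> I'} B A < k" using cut_size_rev by metis
    qed
    have cK: "ct K A B < k" by (rule sub) auto
    show "A \<subseteq> Q \<or> B \<subseteq> Q"
    proof (rule ccontr)
      assume "\<not> ?thesis"
      hence A: "A \<inter> T \<noteq> {} \<or> A \<inter> X \<noteq> {}" and B: "B \<inter> T' \<noteq> {} \<or> B \<inter> Y \<noteq> {}"
        using KA[OF rr cK] KB[OF rr cK] by blast+
      show False
      proof (cases "A \<inter> T = {}")
        case True
        hence "B \<inter> T' = {}" using A hubT' by blast
        moreover have "A \<inter> Z = {}"
        proof (rule ccontr)
          assume "A \<inter> Z \<noteq> {}"
          then obtain z where z: "z \<in> A" "z \<in> Z" by blast
          have "ct (N z) A B < k" using z by (intro sub) (auto simp: NL_def)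
          thus False using N z rr True by blast
        qed
        \<comment> \<open>The fans keep \<open>Z\<close> out of \<open>A\<close>, and it misses
          \<open>B\<close> as well, so its \<open>k\<close> vertices alone make the cut large
          enough.\<close>
        ultimately have "Z \<subseteq> V - (A \<union> B)" using Z(1) ZV(1) by blast
        hence "k \<le> card (V - (A \<union> B))" using Z(2) card_mono[of "V - (A \<union> B)" Z] finV by auto
        thus False using cK unfolding cut_size_def by linarith
      next
        case False
        hence "B \<inter> Y = {}" by (rule hubT)
        hence "A \<inter> X = {}" using B hubT' by blast
        moreover have "ct P A B < k" using K(1) by (intro sub) auto
        ultimately show False
          using cov rr \<open>B \<inter> Y = {}\<close> unfolding link_cover_def by (metis Int_commute not_less)
      qed
    qed
  qed (rule that; assumption)
  \<comment> \<open>The sums are 14 + 120 + 40 = 174 and 60 + 3 + 384 + 120 = 567, from the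
    skeleton, the fans at \<open>Z\<close> (second sum only), the set \<open>Q\<close> and the
    core.\<close>
  have "4 * k * card Q \<le> 4 * k * (96 * k + 30 * D)" using cQ by (rule mult_le_mono2)
  moreover have "card (I \<union> I') \<le> 30 * k + 10 * D" using card_Un_le[of I I'] S(3) S'(3) by linarith
  hence "4 * k * card (I \<union> I') \<le> 4 * k * (30 * k + 10 * D)" by (rule mult_le_mono2)
  moreover have "card (K \<union> NL) \<le> card K + card NL" by (rule card_Un_le)
  ultimately have "card H \<le> k * card V + 174 * k * D + 567 * k * k"
    using H(3) K(3) cNL by (simp add: algebra_simps)
  thus ?thesis using that H(1,2) by blast
qed

text \<open>Below the threshold, one of the four terms kn in \<open>few_arcs_always\<close> is the
  leading term and the other three amount to at most 669k(k + D).\<close>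

lemma (in arc_graph) few_arcs:
  assumes E: "conn k E" and k: "1 \<le> k"
    and D: "\<And>v. v \<in> V \<Longrightarrow> card {w \<in> V - {v}. \<not> (\<exists>e\<in>E. src e = v \<and> tgt e = w) \<and>
      \<not> (\<exists>e\<in>E. src e = w \<and> tgt e = v)} \<le> D"
  obtains H where "H \<subseteq> E" "conn k H" "card H \<le> k * card V + 670 * k * D + 670 * k * k"
proof (cases "223 * (k + D) < card V")
  case True
  obtain R where "oriented V E src tgt vm D R" using orientation_exists[OF D] by blast
  then interpret oriented V E src tgt vm D R .
  obtain H where H: "H \<subseteq> E" "conn k H" "card H \<le> k * card V + 174 * k * D + 567 * k * k"
    by (rule few_arcs_dense[OF E k True])
  have "174 * k * D \<le> 670 * k * D" "567 * k * k \<le> 670 * k * k" by simp_all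
  thus ?thesis using that H by (meson add_mono order_refl order_trans)
next
  case False
  obtain H where H: "H \<subseteq> E" "conn k H" "card H \<le> 4 * k * card V"
    by (rule few_arcs_always[OF E])
  have "k * card V \<le> k * (223 * (k + D))" using False by (intro mult_le_mono2) linarith
  hence "4 * k * card V \<le> k * card V + 669 * k * D + 669 * k * k" by (simp add: algebra_simps)
  also have "\<dots> \<le> k * card V + 670 * k * D + 670 * k * k" by simp
  finally show ?thesis using that H by (meson order_trans)
qed

section \<open>Digraphs and directed multigraphs\<close>

lemma strongly_connected_iff_cut:
  "strongly_connected G \<longleftrightarrow> verts G \<noteq> {} \<and> (\<forall>A. A \<subseteq> verts G \<longrightarrow> A \<noteq> {} \<longrightarrow> A \<noteq> verts G \<longrightarrow>
     (\<exists>e\<in>arcs G. tail G e \<in> A \<and> head G e \<in> verts G - A))" (is "?L \<longleftrightarrow> ?R")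
proof
  assume L: ?L
  have "\<exists>e\<in>arcs G. tail G e \<in> A \<and> head G e \<in> verts G - A"
    if A: "A \<subseteq> verts G" "A \<noteq> {}" "A \<noteq> verts G" for A
  proof (rule ccontr)
    assume no: "\<not> ?thesis"
    obtain u v where uv: "u \<in> A" "v \<in> verts G - A" using A by blast
    hence "(u, v) \<in> rtrancl_on (verts G) (arcs_ends G)"
      using L A(1) unfolding strongly_connected_def reachable_def by blast
    hence "v \<in> A"
    proof (induction rule: rtrancl_on_induct)
      case (step y z)
      then obtain e where "e \<in> arcs G" "tail G e = y" "head G e = z" unfolding arcs_ends_conv by auto
      thus ?case using no step by blast
    qed (use uv in simp)
    thus False using uv by blast
  qed
  thus ?R using L unfolding strongly_connected_def by blast
next
  assume R: ?R
  have "(u, v) \<in> rtrancl_on (verts G) (arcs_ends G)" if uv: "u \<in> verts G" "v \<in> verts G" for u v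
  proof -
    define A where "A = {w. (u, w) \<in> rtrancl_on (verts G) (arcs_ends G)}"
    have A: "A \<subseteq> verts G" "u \<in> A" unfolding A_def using uv in_rtrancl_on_in_F by fastforce+
    have "A = verts G"
    proof (rule ccontr)
      assume "A \<noteq> verts G"
      then obtain e where e: "e \<in> arcs G" "tail G e \<in> A" "head G e \<in> verts G - A"
        using R A by blast
      hence "(tail G e, head G e) \<in> arcs_ends G" unfolding arcs_ends_conv by auto
      hence "head G e \<in> A" using e unfolding A_def by (auto intro: rtrancl_on_into_rtrancl_on)
      thus False using e by blast
    qed
    thus ?thesis using uv unfolding A_def by blast
  qed
  thus ?L using R unfolding strongly_connected_def reachable_def by blast
qed

lemma fin_digraph_arc_graph:
  assumes "fin_digraph G" "loopfree_digraph G" "vm \<Longrightarrow> nomulti_digraph G"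
  shows "arc_graph (verts G) (arcs G) (tail G) (head G) vm"
proof -
  interpret fin_digraph G by fact
  interpret loopfree_digraph G by fact
  show ?thesis
  proof
    show "e = e'" if "vm" "e \<in> arcs G" "e' \<in> arcs G" "tail G e = tail G e'" "head G e = head G e'" for e e'
      using nomulti_digraph.no_multi_arcs[OF assms(3)] that unfolding arc_to_ends_def by auto
  qed (auto simp: no_loops)
qed

lemma strongly_k_arc_connected_iff_conn:
  assumes "fin_digraph G" "loopfree_digraph G" "verts G \<noteq> {}"
  shows "strongly_k_arc_connected k G \<longleftrightarrow> arc_graph.conn (verts G) (tail G) (head G) False k (arcs G)"
proof -
  interpret arc_graph "verts G" "arcs G" "tail G" "head G" False
    using fin_digraph_arc_graph[OF assms(1,2)] by simp
  have crossing: "{e \<in> arcs G. tail G e \<in> A \<and> head G e \<in> B} = {e \<in> arcs G. tail G e \<in> A \<and> head G e \<in> verts G - A}"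
    if "rc A B" for A B
    using that unfolding rect_def by auto
  show ?thesis
  proof
    assume L: "strongly_k_arc_connected k G"
    show "conn k (arcs G)"
      unfolding conn_def
    proof (intro allI impI, rule ccontr)
      fix A B assume r: "rc A B" "A \<noteq> {}" "B \<noteq> {}" and c: "\<not> k \<le> ct (arcs G) A B"
      let ?T = "{e \<in> arcs G. tail G e \<in> A \<and> head G e \<in> B}"
      have "card ?T < k" using c unfolding cut_size_def by linarith
      hence "strongly_connected (delete_arcs G ?T)"
        by (intro L[unfolded strongly_k_arc_connected_def, rule_format]) auto
      moreover have "A \<subseteq> verts G" "A \<noteq> verts G" using r unfolding rect_def by auto
      ultimately show False
        using r(2) crossing[OF r(1)] unfolding strongly_connected_iff_cut delete_arcs_def by auto
    qed
  next
    assume R: "conn k (arcs G)"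
    show "strongly_k_arc_connected k G"
      unfolding strongly_k_arc_connected_def strongly_connected_iff_cut
    proof (intro allI impI conjI)
      fix T A assume T: "T \<subseteq> arcs G" "card T < k"
        and A: "A \<subseteq> verts (delete_arcs G T)" "A \<noteq> {}" "A \<noteq> verts (delete_arcs G T)"
      let ?M = "{e \<in> arcs G. tail G e \<in> A \<and> head G e \<in> verts G - A}"
      have r: "rc A (verts G - A)" using A unfolding rect_def delete_arcs_def by auto
      moreover have "verts G - A \<noteq> {}" using A unfolding delete_arcs_def by auto
      ultimately have "k \<le> ct (arcs G) A (verts G - A)" using R A(2) unfolding conn_def by blast
      moreover have "verts G - (A \<union> (verts G - A)) = {}" by auto
      ultimately have "k \<le> card ?M" unfolding cut_size_def by (simp only: card.empty add_0_right)
      hence "\<not> ?M \<subseteq> T" using T finE card_mono[of T ?M] finite_subset by fastforce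
      thus "\<exists>e\<in>arcs (delete_arcs G T). tail (delete_arcs G T) e \<in> A \<and>
          head (delete_arcs G T) e \<in> verts (delete_arcs G T) - A"
        unfolding delete_arcs_def by auto
    qed (use assms(3) in \<open>auto simp: delete_arcs_def\<close>)
  qed
qed

text \<open>For the forward direction delete, besides \<open>V - (A \<union> B)\<close>, one end of each arc from \<open>A\<close> to
  \<open>B\<close>, sparing a non-adjacent pair.\<close>

lemma strongly_k_connected_iff_conn:
  assumes "digraph G"
  shows "strongly_k_connected k G \<longleftrightarrow>
     k + 1 \<le> card (verts G) \<and> arc_graph.conn (verts G) (tail G) (head G) True k (arcs G)"
proof -
  interpret digraph G by fact
  interpret arc_graph "verts G" "arcs G" "tail G" "head G" True
    by (rule fin_digraph_arc_graph) unfold_locales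
  show ?thesis
  proof
    assume L: "strongly_k_connected k G"
    hence n: "k + 1 \<le> card (verts G)" unfolding strongly_k_connected_def by simp
    have "conn k (arcs G)"
      unfolding conn_def
    proof (intro allI impI, rule ccontr)
      fix A B assume r: "rc A B" "A \<noteq> {}" "B \<noteq> {}" and c: "\<not> k \<le> ct (arcs G) A B"
      define M where "M = {e \<in> arcs G. tail G e \<in> A \<and> head G e \<in> B}"
      define S where "S = verts G - (A \<union> B)"
      have fin: "finite M" "finite S" "finite A" "finite B"
        using r(1) finite_subset[OF _ finV] unfolding M_def S_def rect_def by auto
      have MS: "card M + card S < k" using c unfolding cut_size_def M_def S_def by simp
      have AB: "card M + 2 \<le> card A + card B"
        using rect_card[OF finV r(1)] n MS unfolding S_def by linarith
      have pos: "0 < card A" "0 < card B" using r fin by (auto simp: card_gt_0_iff)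
      \<comment> \<open>For nonempty \<open>A\<close> and \<open>B\<close>, the product has at least
        \<open>card A + card B - 1\<close> elements, more than \<open>card M\<close>. The bound
        \<open>AB\<close> is where \<open>k + 1 \<le> card (verts G)\<close> enters.\<close>
      have "\<not> A \<times> B \<subseteq> (\<lambda>e. (tail G e, head G e)) ` M"
      proof
        assume "A \<times> B \<subseteq> (\<lambda>e. (tail G e, head G e)) ` M"
        hence "card (A \<times> B) \<le> card M" by (rule surj_card_le[OF fin(1)])
        moreover obtain a b where "card A = Suc a" "card B = Suc b" using pos gr0_implies_Suc by metis
        ultimately show False using AB by (simp add: card_cartesian_product)
      qed
      then obtain a b where ab: "a \<in> A" "b \<in> B" "\<And>e. e \<in> M \<Longrightarrow> \<not> (tail G e = a \<and> head G e = b)" by blast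
      \<comment> \<open>\<open>g e\<close> is an end of \<open>e\<close> other than \<open>a\<close>
        and \<open>b\<close>: if the tail is \<open>a\<close>, the head is not
        \<open>b\<close>.\<close>
      define g where "g e = (if tail G e = a then head G e else tail G e)" for e
      define S' where "S' = S \<union> g ` M"
      have AB0: "A \<inter> B = {}" using r(1) unfolding rect_def by auto
      have "card S' \<le> card S + card M"
        unfolding S'_def using card_Un_le[of S "g ` M"] card_image_le[OF fin(1), of g] by linarith
      hence "card S' < k" using MS by linarith
      moreover have "S' \<subseteq> verts G" unfolding S'_def S_def M_def g_def by auto
      ultimately have sc: "strongly_connected (delete_verts G S')"
        using L unfolding strongly_k_connected_def by blast
      have aS: "a \<notin> S'" using ab AB0 unfolding S'_def S_def M_def g_def by auto
      have bS: "b \<notin> S'" using ab AB0 unfolding S'_def S_def g_def by (auto simp: M_def)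
      have "A - S' \<subseteq> verts (delete_verts G S')" "A - S' \<noteq> {}"
        using r(1) ab aS unfolding delete_verts_def rect_def by auto
      moreover have "b \<in> verts (delete_verts G S') - (A - S')"
        using r(1) ab bS AB0 unfolding delete_verts_def rect_def by auto
      ultimately obtain e where e: "e \<in> arcs G" "tail G e \<in> A - S'" "head G e \<in> verts G - S' - A"
        using sc unfolding strongly_connected_iff_cut delete_verts_def by auto
      hence "e \<in> M" unfolding M_def S'_def S_def by auto
      hence "g e \<in> S'" unfolding S'_def by blast
      thus False using e unfolding g_def by (auto split: if_splits)
    qed
    thus "k + 1 \<le> card (verts G) \<and> conn k (arcs G)" using n by simp
  next
    assume R: "k + 1 \<le> card (verts G) \<and> conn k (arcs G)"
    show "strongly_k_connected k G"
      unfolding strongly_k_connected_def strongly_connected_iff_cut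
    proof (intro allI impI conjI)
      fix S assume S: "S \<subseteq> verts G" "card S < k"
      have "card S < card (verts G)" using S R by simp
      thus "verts (delete_verts G S) \<noteq> {}" using S unfolding delete_verts_def by auto
      fix A assume A: "A \<subseteq> verts (delete_verts G S)" "A \<noteq> {}" "A \<noteq> verts (delete_verts G S)"
      define B where "B = verts G - S - A"
      have r: "rc A B" "B \<noteq> {}" using A unfolding rect_def delete_verts_def B_def by auto
      hence "k \<le> ct (arcs G) A B" using R A(2) unfolding conn_def by blast
      moreover have "verts G - (A \<union> B) = S" using A S unfolding B_def delete_verts_def by auto
      ultimately have "0 < card {e \<in> arcs G. tail G e \<in> A \<and> head G e \<in> B}"
        using S(2) unfolding cut_size_def by simp
      then obtain e where "e \<in> arcs G" "tail G e \<in> A" "head G e \<in> B" by (auto simp: card_gt_0_iff)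
      thus "\<exists>e\<in>arcs (delete_verts G S). tail (delete_verts G S) e \<in> A \<and>
          head (delete_verts G S) e \<in> verts (delete_verts G S) - A"
        using A unfolding delete_verts_def B_def by auto
    qed (use R in simp)
  qed
qed

lemma nonadjacent_le_complement_max_degree:
  assumes "finite (verts G)" "v \<in> verts G"
  shows "card {w \<in> verts G - {v}. \<not> (\<exists>e\<in>arcs G. tail G e = v \<and> head G e = w) \<and>
      \<not> (\<exists>e\<in>arcs G. tail G e = w \<and> head G e = v)} \<le> complement_max_degree G"
proof -
  have "{w \<in> verts G - {v}. \<not> (\<exists>e\<in>arcs G. tail G e = v \<and> head G e = w) \<and>
      \<not> (\<exists>e\<in>arcs G. tail G e = w \<and> head G e = v)}
    = {w \<in> verts G - {v}. (v, w) \<notin> arcs_ends G \<and> (w, v) \<notin> arcs_ends G}"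
    unfolding arcs_ends_conv by auto
  thus ?thesis unfolding complement_max_degree_def using assms by (auto intro!: Max_ge)
qed

section \<open>Sparse spanning subgraphs\<close>

lemma spanning_arcs_update:
  assumes "wf_digraph G" "F \<subseteq> arcs G"
  shows "spanning (G\<lparr>arcs := F\<rparr>) G"
proof -
  interpret wf_digraph G by fact
  have "wf_digraph (G\<lparr>arcs := F\<rparr>)" using assms(2) by unfold_locales auto
  thus ?thesis using assms unfolding spanning_def subgraph_def compatible_def by auto
qed

lemma sparse_spanning_strongly_k_connected:
  assumes "digraph G" "strongly_k_connected k G" "1 \<le> k"
  obtains H where "spanning H G" "strongly_k_connected k H"
    "card (arcs H) \<le> k * card (verts G) + 670 * k * complement_max_degree G + 670 * k^2"
proof -
  interpret digraph G by fact
  interpret arc_graph "verts G" "arcs G" "tail G" "head G" True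
    by (rule fin_digraph_arc_graph) unfold_locales
  have c: "conn k (arcs G)" "k + 1 \<le> card (verts G)"
    using assms(2) strongly_k_connected_iff_conn[OF assms(1)] by auto
  obtain F where F: "F \<subseteq> arcs G" "conn k F"
    "card F \<le> k * card (verts G) + 670 * k * complement_max_degree G + 670 * k * k"
    by (rule few_arcs[OF c(1) assms(3) nonadjacent_le_complement_max_degree[OF finV]])
      ((rule that; assumption) | assumption)+
  let ?H = "G\<lparr>arcs := F\<rparr>"
  have "e1 = e2" if "e1 \<in> F" "e2 \<in> F" "arc_to_ends ?H e1 = arc_to_ends ?H e2" for e1 e2
    using that F(1) by (intro no_multi_arcs) (auto simp: arc_to_ends_def)
  hence "digraph ?H"
    using F(1) finite_subset[OF F(1)] no_loops by unfold_locales auto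
  hence "strongly_k_connected k ?H" using strongly_k_connected_iff_conn[of ?H k] F(2) c(2) by simp
  thus ?thesis
    using that[of ?H] F spanning_arcs_update[OF wf_digraph F(1)] by (simp add: power2_eq_square mult.assoc)
qed

lemma sparse_spanning_strongly_k_arc_connected:
  assumes "fin_digraph G" "loopfree_digraph G" "verts G \<noteq> {}" "strongly_k_arc_connected k G" "1 \<le> k"
  obtains H where "spanning H G" "strongly_k_arc_connected k H"
    "card (arcs H) \<le> k * card (verts G) + 670 * k * complement_max_degree G + 670 * k^2"
proof -
  interpret fin_digraph G by fact
  interpret loopfree_digraph G by fact
  interpret arc_graph "verts G" "arcs G" "tail G" "head G" False
    using fin_digraph_arc_graph[OF assms(1,2)] by simp
  have c: "conn k (arcs G)"
    using assms(4) strongly_k_arc_connected_iff_conn[OF assms(1-3)] by simp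
  obtain F where F: "F \<subseteq> arcs G" "conn k F"
    "card F \<le> k * card (verts G) + 670 * k * complement_max_degree G + 670 * k * k"
    by (rule few_arcs[OF c assms(5) nonadjacent_le_complement_max_degree[OF finV]])
      ((rule that; assumption) | assumption)+
  let ?H = "G\<lparr>arcs := F\<rparr>"
  have "fin_digraph ?H" "loopfree_digraph ?H"
    using F(1) finite_subset[OF F(1)] no_loops by (unfold_locales; auto)+
  hence "strongly_k_arc_connected k ?H"
    using strongly_k_arc_connected_iff_conn[of ?H k] F(2) assms(3) by simp
  thus ?thesis
    using that[of ?H] F spanning_arcs_update[OF wf_digraph F(1)] by (simp add: power2_eq_square mult.assoc)
qed

theorem theorem1p3:
  fixes k n :: nat
  assumes "k \<ge> 1" and "n \<ge> 1"
  shows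
    "(\<forall>D :: ('a, 'b) pre_digraph.
        digraph D \<and> card (verts D) = n \<and> strongly_k_connected k D \<longrightarrow>
        (\<exists>H. spanning H D \<and> strongly_k_connected k H \<and>
             card (arcs H) \<le> k * n + 800 * k * complement_max_degree D + 800 * k^2)) \<and>
     (\<forall>D :: ('c, 'd) pre_digraph.
        fin_digraph D \<and> loopfree_digraph D \<and> card (verts D) = n \<and> strongly_k_arc_connected k D \<longrightarrow>
        (\<exists>H. spanning H D \<and> strongly_k_arc_connected k H \<and>
             card (arcs H) \<le> k * n + 670 * k * complement_max_degree D + 670 * k^2))"
proof (intro conjI allI impI; elim conjE)
  fix D :: "('a, 'b) pre_digraph"
  assume D: "digraph D" "card (verts D) = n" "strongly_k_connected k D"
  obtain H where H: "spanning H D" "strongly_k_connected k H"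
    "card (arcs H) \<le> k * card (verts D) + 670 * k * complement_max_degree D + 670 * k^2"
    by (rule sparse_spanning_strongly_k_connected[OF D(1,3) assms(1)])
  \<comment> \<open>Both connectivity notions come from \<open>few_arcs\<close>, so the vertex
    version is obtained with 670 as well.\<close>
  have "670 * k * complement_max_degree D \<le> 800 * k * complement_max_degree D" by simp
  hence "card (arcs H) \<le> k * n + 800 * k * complement_max_degree D + 800 * k^2"
    using H(3) unfolding D(2) by linarith
  with H show "\<exists>H. spanning H D \<and> strongly_k_connected k H \<and>
      card (arcs H) \<le> k * n + 800 * k * complement_max_degree D + 800 * k^2" by blast
next
  fix D :: "('c, 'd) pre_digraph"
  assume D: "fin_digraph D" "loopfree_digraph D" "card (verts D) = n" "strongly_k_arc_connected k D"
  have "verts D \<noteq> {}" using D(3) assms(2) by auto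
  then obtain H where "spanning H D" "strongly_k_arc_connected k H"
    "card (arcs H) \<le> k * card (verts D) + 670 * k * complement_max_degree D + 670 * k^2"
    by (rule sparse_spanning_strongly_k_arc_connected[OF D(1,2) _ D(4) assms(1)])
  thus "\<exists>H. spanning H D \<and> strongly_k_arc_connected k H \<and>
      card (arcs H) \<le> k * n + 670 * k * complement_max_degree D + 670 * k^2"
    unfolding D(3) by blast
qed

end
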